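(* Let $n\ge2$, let $U\subset\mathbb{R}$ be an open interval and $\mathbf f=(f_1,\dots,f_{n-1}):U\to\mathbb{R}^{n-1}$ real analytic, and put $\mathbf y(x)=(1,x,f_1(x),\dots,f_{n-1}(x))$. Assume $W_{\mathbf y}(x)\neq0$ for all $x\in U$. Let $B_0\subset U$ be a compact interval. Then: (a) there are positive constants $k_0,\rho_0,\delta_0$ depending only on $B_0$ such that for any interval $B\subset B_0$ there are positive constants $C_0=C_0(B)$, $Q_0=Q_0(B)$ such that for all $Q\ge Q_0$ and all $\psi$ with $C_0Q^{-3/(2n-1)}<\psi<C_0^{-1}$, $$\mu_1\big(\Delta^{\delta_0}(Q,\psi,B,\rho)\cap B\big)\ge k_0\mu_1(B),\qquad\rho:=\rho_0(\psi^{n-1}Q^2)^{-1};$$ (b) there are constants $\delta_0>0$, $k_1>0$ such that for any interval $B\subset B_0$ there exist $Q_0,C_0>0$ such that for all $Q\ge Q_0$ and all $\psi$ with $C_0Q^{-3/(2n-1)}<\psi<C_0^{-1}$, $$\#\mathcal R^{\delta_0}(Q,\psi,B)\ge k_1\psi^{n-1}Q^2\mu_1(B).$$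
   Context: $W_{\mathbf y}(x)=\det\big(y_i^{(j)}(x)\big)_{0\le i,j\le n}$ is the Wronskian of the coordinate functions $y_0=1,y_1=x,y_2=f_1,\dots,y_n=f_{n-1}$. $\mu_1$ is Lebesgue measure on $\mathbb{R}$. For $S\subset U$: $\mathcal R^{\delta}(Q,\psi,S)=\{(q,a,\mathbf b)\in\mathbb N\times\mathbb Z\times\mathbb Z^{n-1}:a/q\in S,\ \delta Q<q\le Q,\ |q\mathbf f(a/q)-\mathbf b|_\infty\le\psi,\ \gcd(q,a,\mathbf b)=1\}$ and $\Delta^{\delta}(Q,\psi,S,\rho)=\bigcup_{(q,a,\mathbf b)\in\mathcal R^\delta(Q,\psi,S)}(a/q-\rho,a/q+\rho)$. *)

theory Defs
  imports "HOL-Analysis.Analysis" "Jordan_Normal_Form.Determinant"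
begin

text \<open>
  The map \<open>(f\<^sub>1, \<dots>, f\<^sub>n\<^sub>-\<^sub>1)\<close> is a family \<open>f :: nat \<Rightarrow> real \<Rightarrow> real\<close>, of which only the
  indices \<open>1, \<dots>, n - 1\<close> and the values on the open interval \<open>U\<close> matter; an integer vector
  \<open>b \<in> \<int>\<^sup>n\<^sup>-\<^sup>1\<close> is an extensional function on \<open>{1..n-1}\<close>, so that distinct functions are
  distinct vectors and counting them is meaningful.  The index set is nonempty, hence the
  maximum expressing the sup norm is meaningful, as soon as \<open>n \<ge> 2\<close>.
\<close>

definition real_analytic_on :: "(real \<Rightarrow> real) \<Rightarrow> real set \<Rightarrow> bool" where
  "real_analytic_on g U \<longleftrightarrow> (\<forall>x\<in>U. \<exists>F. (\<lambda>h. g (x + h)) has_fps_expansion F)"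

definition coord :: "(nat \<Rightarrow> real \<Rightarrow> real) \<Rightarrow> nat \<Rightarrow> real \<Rightarrow> real" where
  "coord f i x = (if i = 0 then 1 else if i = 1 then x else f (i - 1) x)"

definition wronskian :: "nat \<Rightarrow> (nat \<Rightarrow> real \<Rightarrow> real) \<Rightarrow> real \<Rightarrow> real" where
  "wronskian n y x =
     Determinant.det (Matrix.mat (n + 1) (n + 1) (\<lambda>(i, j). (deriv ^^ j) (y i) x))"

definition rat_points ::
  "nat \<Rightarrow> (nat \<Rightarrow> real \<Rightarrow> real) \<Rightarrow> real \<Rightarrow> real \<Rightarrow> real \<Rightarrow> real set \<Rightarrow> (nat \<times> int \<times> (nat \<Rightarrow> int)) set"
  where
  "rat_points n f \<delta> Q \<psi> S =
     {(q, a, b). b \<in> {1..n-1} \<rightarrow>\<^sub>E (UNIV :: int set)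
        \<and> real_of_int a / real q \<in> S
        \<and> \<delta> * Q < real q \<and> real q \<le> Q
        \<and> (MAX i\<in>{1..n-1}. \<bar>real q * f i (real_of_int a / real q) - real_of_int (b i)\<bar>) \<le> \<psi>
        \<and> Gcd ({int q, a} \<union> b ` {1..n-1}) = 1}"

definition rat_nbhd ::
  "nat \<Rightarrow> (nat \<Rightarrow> real \<Rightarrow> real) \<Rightarrow> real \<Rightarrow> real \<Rightarrow> real \<Rightarrow> real set \<Rightarrow> real \<Rightarrow> real set"
  where
  "rat_nbhd n f \<delta> Q \<psi> S \<rho> =
     (\<Union>(q, a, b) \<in> rat_points n f \<delta> Q \<psi> S.
        {real_of_int a / real q - \<rho> <..< real_of_int a / real q + \<rho>})"

end

theory Submission
  imports Defs
begin

text \<open>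
  Write \<open>y = (1, x, f 1, \<dots>, f (n - 1))\<close> and \<open>v = (q, a, b)\<close>.  In the basis \<open>y(x), y'(x), e 2, \<dots>, e n\<close>
  the coordinates of \<open>v\<close> are \<open>q\<close>, \<open>a - q x\<close> and \<open>b i - q f i - (a - q x) f' i\<close>; scaling them by
  \<open>1 / Q\<close>, \<open>\<psi> ^ (n - 1) * Q\<close> and \<open>1 / \<psi>\<close> gives a family of unimodular lattices indexed by \<open>x\<close>.  Kleinbock and Margulis'
  quantitative nondivergence shows that for \<open>x\<close> in a set of positive proportion this lattice has no
  vector shorter than a constant.  For such \<open>x\<close>, Dirichlet's theorem in a box that is long in the
  direction of \<open>q\<close> only gives \<open>v\<close> with \<open>q\<close> of order \<open>Q\<close>, and by Taylor's formula \<open>a / q\<close> is a rational point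
  near the curve: the quadratic error \<open>Q \<rho>\<^sup>2\<close> is below \<open>\<psi>\<close> exactly because \<open>\<psi> ^ (2 n - 1) Q ^ 3\<close> is large.

  Nondivergence requires the covolume of every rational subspace to be large somewhere on the
  interval.  The covolumes are computed by completing a basis to a square matrix with the
  vectors of the moving frame; completing by both \<open>y\<close> and \<open>y'\<close> produces a Wronskian of two linear forms in \<open>y\<close>.
\<close>

section \<open>Linear families of analytic functions\<close>

text \<open>Completing by \<open>y'\<close> is forced. With \<open>T = 1 / \<psi>\<close> and
  \<open>K = \<psi> ^ (n - 1) * Q\<close>, the minors formed from a subspace of dimension
  \<open>j\<close>, the row \<open>y\<close> and \<open>n - j\<close> unit vectors carry only the
  factor \<open>K * T ^ (j - 1)\<close>; for \<open>j = 1\<close> and \<open>n > 2\<close> it tends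
  to zero at the lower end of the range of \<psi>. With \<open>y'\<close> added, \<open>K\<close>
  cancels and \<open>T ^ j\<close> remains. A hyperplane has room for \<open>y\<close> alone, where
  the factor is \<open>Q\<close>.

  All minors of the frame lie in the span of finitely many products of entries of \<open>y\<close>
  and \<open>y'\<close>. These products may be linearly dependent, so the Wronskian condition gives
  no derivative bound for their combinations; the uniform estimate of sublevel sets comes from
  analyticity.

  The constants separate accordingly. The bound on short vectors and the admissible length of
  intervals come from compactness of \<open>B0\<close> and lead to \<open>k0\<close>,
  \<open>\<rho>0\<close>, \<open>\<delta>0\<close>. Compactness of a set of coefficients, for a
  fixed interval, bounds linear forms and their Wronskians from below; this bound only restricts how
  large \<open>Q\<close> and \<open>1 / \<psi>\<close> must be, that is, it enters \<open>C0\<close>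
  and \<open>Q0\<close>.\<close>

lemma higher_deriv_shift:
  "(deriv ^^ n) (\<lambda>h. g (x + h)) = (\<lambda>h. (deriv ^^ n) g (x + h :: real) :: real)"
proof (induction n)
  case (Suc n)
  have "deriv (\<lambda>h. G (x + h)) = (\<lambda>h. deriv G (x + h))" for G :: "real \<Rightarrow> real"
  proof
    fix h
    have "DERIV G (x + h) :> D \<longleftrightarrow> DERIV (\<lambda>h. G (x + h)) h :> D" for D
      using DERIV_shift[of G D h x] by (simp only: add.commute[of _ x])
    then show "deriv (\<lambda>h. G (x + h)) h = deriv G (x + h)" by (simp add: deriv_def)
  qed
  then show ?case using Suc by simp
qed simp

lemma real_analytic_on_const: "real_analytic_on (\<lambda>_. c) U"
  unfolding real_analytic_on_def using has_fps_expansion_const by blast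

lemma real_analytic_on_ident: "real_analytic_on (\<lambda>x. x) U"
  unfolding real_analytic_on_def
  using has_fps_expansion_add[OF has_fps_expansion_const has_fps_expansion_fps_X] by blast

lemma real_analytic_on_add:
  "real_analytic_on f U \<Longrightarrow> real_analytic_on g U \<Longrightarrow> real_analytic_on (\<lambda>x. f x + g x) U"
  unfolding real_analytic_on_def using has_fps_expansion_add by blast

lemma real_analytic_on_mult:
  "real_analytic_on f U \<Longrightarrow> real_analytic_on g U \<Longrightarrow> real_analytic_on (\<lambda>x. f x * g x) U"
  unfolding real_analytic_on_def using has_fps_expansion_mult by blast

lemma real_analytic_on_prod:
  "(\<And>i. i \<in> I \<Longrightarrow> real_analytic_on (f i) U) \<Longrightarrow> real_analytic_on (\<lambda>x. \<Prod>i\<in>I. f i x) U"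
proof (induction I rule: infinite_finite_induct)
  case (insert i I)
  then show ?case by (simp add: real_analytic_on_mult)
qed (auto simp: real_analytic_on_const)

lemma real_analytic_on_deriv:
  assumes "real_analytic_on g U" shows "real_analytic_on (deriv g) U"
  unfolding real_analytic_on_def
proof
  fix x assume "x \<in> U"
  then obtain F where "(\<lambda>h. g (x + h)) has_fps_expansion F"
    using assms unfolding real_analytic_on_def by blast
  then have "deriv (\<lambda>h. g (x + h)) has_fps_expansion fps_deriv F"
    by (rule has_fps_expansion_deriv)
  then have "(\<lambda>h. deriv g (x + h)) has_fps_expansion fps_deriv F"
    using higher_deriv_shift[of 1 g x] by simp
  then show "\<exists>F. (\<lambda>h. deriv g (x + h)) has_fps_expansion F" by blast
qed

lemma real_analytic_on_higher_deriv:
  "real_analytic_on g U \<Longrightarrow> real_analytic_on ((deriv ^^ n) g) U"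
  by (induction n) (auto intro: real_analytic_on_deriv)

lemma real_analytic_on_has_deriv:
  assumes "real_analytic_on g U" "x \<in> U"
  shows "(g has_real_derivative deriv g x) (at x)"
proof -
  obtain F where F: "(\<lambda>h. g (x + h)) has_fps_expansion F"
    using assms unfolding real_analytic_on_def by blast
  then have r: "fps_conv_radius F > 0" and ev: "eventually (\<lambda>h. eval_fps F h = g (x + h)) (nhds 0)"
    by (auto simp: has_fps_expansion_def)
  have "(eval_fps F has_field_derivative eval_fps (fps_deriv F) 0) (at 0)"
    by (rule has_field_derivative_eval_fps) (use r in \<open>auto simp: zero_ereal_def\<close>)
  then have "((\<lambda>h. g (x + h)) has_field_derivative eval_fps (fps_deriv F) 0) (at 0)"
    using DERIV_cong_ev[OF refl ev refl] by simp
  then have "(g has_field_derivative eval_fps (fps_deriv F) 0) (at x)"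
    using DERIV_shift[of g _ 0 x] by (simp add: add.commute)
  then show ?thesis using DERIV_imp_deriv by metis
qed

lemma real_analytic_on_has_higher_deriv:
  assumes "real_analytic_on g U" "x \<in> U"
  shows "((deriv ^^ n) g has_real_derivative (deriv ^^ Suc n) g x) (at x)"
  using real_analytic_on_has_deriv[OF real_analytic_on_higher_deriv[OF assms(1)] assms(2)] by simp

lemma real_analytic_on_continuous:
  "real_analytic_on g U \<Longrightarrow> S \<subseteq> U \<Longrightarrow> continuous_on S g"
  by (meson DERIV_isCont continuous_at_imp_continuous_on real_analytic_on_has_deriv subsetD)

lemma real_analytic_on_locally_zero:
  assumes "real_analytic_on g U" "x \<in> U" "\<And>n. (deriv ^^ n) g x = 0"
  shows "\<exists>r>0. \<forall>y\<in>ball x r. g y = 0"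
proof -
  obtain F where F: "(\<lambda>h. g (x + h)) has_fps_expansion F"
    using assms unfolding real_analytic_on_def by blast
  have "fps_nth F n = 0" for n
  proof -
    have "(deriv ^^ n) (\<lambda>h. g (x + h)) has_fps_expansion (fps_deriv ^^ n) F"
      by (induction n) (auto intro: F has_fps_expansion_deriv)
    then have "eventually (\<lambda>z. eval_fps ((fps_deriv ^^ n) F) z = (deriv ^^ n) (\<lambda>h. g (x + h)) z) (nhds 0)"
      unfolding has_fps_expansion_def by blast
    from eventually_nhds_x_imp_x[OF this]
    have "fps_nth ((fps_deriv ^^ n) F) 0 = (deriv ^^ n) (\<lambda>h. g (x + h)) 0"
      by (simp add: eval_fps_at_0)
    moreover have "fps_nth ((fps_deriv ^^ n) G) 0 = fact n * fps_nth G n" for G :: "real fps"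
      by (induction n arbitrary: G) (simp_all add: funpow_Suc_right algebra_simps del: funpow.simps)
    ultimately show ?thesis using assms(3)[of n] by (simp add: higher_deriv_shift)
  qed
  then have "F = 0" by (simp add: fps_eq_iff)
  then have "eventually (\<lambda>h. 0 = g (x + h)) (nhds 0)"
    using F by (simp add: has_fps_expansion_def)
  then obtain r where "r > 0" and r: "\<And>h. dist h 0 < r \<Longrightarrow> 0 = g (x + h)"
    unfolding eventually_nhds_metric by blast
  have "g y = 0" if "y \<in> ball x r" for y
    using r[of "y - x"] that by (simp add: dist_real_def abs_minus_commute)
  with \<open>r > 0\<close> show ?thesis by blast
qed

section \<open>Combinations of finitely many analytic functions near a point\<close>

lemma higher_deriv_lincomb:
  assumes "open U" "x \<in> U" "\<And>i. i \<in> I \<Longrightarrow> real_analytic_on (h i) U"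
  shows "(deriv ^^ n) (\<lambda>x. \<Sum>i\<in>I. c i * h i x) x = (\<Sum>i\<in>I. c i * (deriv ^^ n) (h i) x)"
  using assms(2)
proof (induction n arbitrary: x)
  case (Suc n)
  have "eventually (\<lambda>x. (deriv ^^ n) (\<lambda>x. \<Sum>i\<in>I. c i * h i x) x = (\<Sum>i\<in>I. c i * (deriv ^^ n) (h i) x)) (nhds x)"
    using eventually_nhds_in_open[OF assms(1) Suc.prems] by eventually_elim (rule Suc.IH)
  then have "(deriv ^^ Suc n) (\<lambda>x. \<Sum>i\<in>I. c i * h i x) x = deriv (\<lambda>x. \<Sum>i\<in>I. c i * (deriv ^^ n) (h i) x) x"
    by (simp add: deriv_cong_ev)
  also have "\<dots> = (\<Sum>i\<in>I. c i * (deriv ^^ Suc n) (h i) x)"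
    by (intro DERIV_imp_deriv DERIV_sum DERIV_cmult real_analytic_on_has_higher_deriv)
       (use assms Suc.prems in auto)
  finally show ?case .
qed simp

text \<open>Under linear dependence of the \<open>h i\<close> the coefficients \<open>c\<close> are
  not controlled by the function they define, hence the second representation \<open>c'\<close> of
  the same function. The quantifier over \<open>M\<close> expresses a bound by the largest of the
  derivatives of order up to \<open>d\<close> at \<open>x0\<close>.\<close>

definition span_coeff_bound ::
  "'i set \<Rightarrow> ('i \<Rightarrow> real \<Rightarrow> real) \<Rightarrow> real \<Rightarrow> nat \<Rightarrow> real \<Rightarrow> real \<Rightarrow> bool" where
  "span_coeff_bound I h x0 d L r \<longleftrightarrow> (\<forall>c. \<exists>c'.
     (\<forall>x\<in>ball x0 r. (\<Sum>i\<in>I. c i * h i x) = (\<Sum>i\<in>I. c' i * h i x)) \<and>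
     (\<forall>M. (\<forall>k\<le>d. \<bar>\<Sum>i\<in>I. c i * (deriv ^^ k) (h i) x0\<bar> \<le> M) \<longrightarrow> (\<forall>i\<in>I. \<bar>c' i\<bar> \<le> L * M)))"

text \<open>Elimination, one function at a time. If all derivatives of \<open>h j\<close> vanish at
  \<open>x0\<close>, then \<open>h j\<close> vanishes nearby and its coefficient may be set to zero.
  Otherwise multiples of \<open>h j\<close> are subtracted from the other functions so that their
  derivatives of order \<open>o'\<close> vanish at \<open>x0\<close>; this derivative of the sum
  then reads off the coefficient of \<open>h j\<close>.\<close>

lemma span_coefficient_bound:
  assumes "finite I" "open U" "x0 \<in> U" "\<And>i. i \<in> I \<Longrightarrow> real_analytic_on (h i) U"
  shows "\<exists>d L r. L > 0 \<and> r > 0 \<and> ball x0 r \<subseteq> U \<and> span_coeff_bound I h x0 d L r"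
  using assms(1,4)
proof (induction I arbitrary: h rule: finite_induct)
  case empty
  obtain r where "r > 0" "ball x0 r \<subseteq> U" using assms(2,3) open_contains_ball by blast
  then show ?case unfolding span_coeff_bound_def by - (rule exI[of _ "0::nat"], rule exI[of _ "1::real"], rule exI[of _ r], auto)
next
  case (insert j I)
  have anj: "real_analytic_on (h j) U" and anI: "\<And>i. i \<in> I \<Longrightarrow> real_analytic_on (h i) U"
    using insert.prems by auto
  show ?case
  proof (cases "\<forall>n. (deriv ^^ n) (h j) x0 = 0")
    case True
    then obtain r1 where r1: "r1 > 0" "\<forall>y\<in>ball x0 r1. h j y = 0"
      using real_analytic_on_locally_zero[OF anj assms(3)] by blast
    obtain d L r where L: "L > 0" and r: "r > 0" "ball x0 r \<subseteq> U"
      and sc: "span_coeff_bound I h x0 d L r"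
      using insert.IH[of h, OF anI] by blast
    note P = sc[unfolded span_coeff_bound_def, THEN spec]
    show ?thesis unfolding span_coeff_bound_def
    proof (rule exI[of _ d], rule exI[of _ L], rule exI[of _ "min r r1"], intro conjI allI)
      fix c
      obtain c' where "\<forall>x\<in>ball x0 r. (\<Sum>i\<in>I. c i * h i x) = (\<Sum>i\<in>I. c' i * h i x)"
        and "\<forall>M. (\<forall>k\<le>d. \<bar>\<Sum>i\<in>I. c i * (deriv ^^ k) (h i) x0\<bar> \<le> M) \<longrightarrow> (\<forall>i\<in>I. \<bar>c' i\<bar> \<le> L * M)"
        using P[of c] by (elim exE conjE) (rule that)
      note c1 = this(1)[rule_format] and c2 = this(2)[THEN spec, THEN mp]
      have eqI: "(\<Sum>i\<in>I. (c'(j := 0)) i * F i) = (\<Sum>i\<in>I. c' i * F i)" for F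
        by (rule sum.cong) (use insert.hyps in auto)
      show "\<exists>c'. (\<forall>x\<in>ball x0 (min r r1). (\<Sum>i\<in>insert j I. c i * h i x) = (\<Sum>i\<in>insert j I. c' i * h i x)) \<and>
       (\<forall>M. (\<forall>k\<le>d. \<bar>\<Sum>i\<in>insert j I. c i * (deriv ^^ k) (h i) x0\<bar> \<le> M) \<longrightarrow> (\<forall>i\<in>insert j I. \<bar>c' i\<bar> \<le> L * M))"
      proof (intro exI[of _ "c'(j := 0)"] conjI allI impI ballI)
        fix x assume "x \<in> ball x0 (min r r1)"
        then show "(\<Sum>i\<in>insert j I. c i * h i x) = (\<Sum>i\<in>insert j I. (c'(j := 0)) i * h i x)"
          using insert.hyps r1 c1[of x] eqI[of "\<lambda>i. h i x"] by simp
      next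
        fix M i assume M: "\<forall>k\<le>d. \<bar>\<Sum>i\<in>insert j I. c i * (deriv ^^ k) (h i) x0\<bar> \<le> M" and i: "i \<in> insert j I"
        then have "\<forall>k\<le>d. \<bar>\<Sum>i\<in>I. c i * (deriv ^^ k) (h i) x0\<bar> \<le> M"
          using insert.hyps True by simp
        moreover have "0 \<le> M" using order_trans[OF abs_ge_zero M[rule_format, OF le0]] by blast
        ultimately show "\<bar>(c'(j := 0)) i\<bar> \<le> L * M" using c2 i L by auto
      qed
    qed (use r r1 L in auto)
  next
    case False
    then obtain o' where D0: "(deriv ^^ o') (h j) x0 \<noteq> 0" by blast
    define D where "D = (deriv ^^ o') (h j) x0"
    define t where "t i = (deriv ^^ o') (h i) x0 / D" for i
    define h' where "h' i = (\<lambda>x. h i x - t i * h j x)" for i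
    have h'_alt: "h' i = (\<lambda>x. h i x + (\<lambda>_. - t i) x * h j x)" for i by (simp add: h'_def)
    have an': "real_analytic_on (h' i) U" if "i \<in> I" for i
      unfolding h'_alt by (intro real_analytic_on_add real_analytic_on_mult real_analytic_on_const anI anj that)
    have dh': "(deriv ^^ k) (h' i) x0 = (deriv ^^ k) (h i) x0 - t i * (deriv ^^ k) (h j) x0" if "i \<in> I" for i k
    proof -
      have ne: "i \<noteq> j" using that insert.hyps by blast
      have "h' i = (\<lambda>x. \<Sum>l\<in>{i, j}. (if l = i then 1 else - t i) * h l x)"
        using ne by (auto simp: h'_def)
      then show ?thesis
        using higher_deriv_lincomb[OF assms(2,3), of "{i,j}" h k "\<lambda>l. if l = i then 1 else - t i"] ne that insert.prems
        by auto
    qed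
    obtain d L r where L: "L > 0" and r: "r > 0" "ball x0 r \<subseteq> U"
      and sc: "span_coeff_bound I h' x0 d L r"
      using insert.IH[of h', OF an'] by blast
    note P = sc[unfolded span_coeff_bound_def, THEN spec]
    \<comment> \<open>Removing the part \<open>e * h j\<close> enlarges the bound on derivatives by
      the factor \<open>1 + H / \<bar>D\<bar>\<close>. Hence \<open>L1\<close> for the reduced
      family; the bracket in \<open>L2\<close> bounds the coefficient of \<open>h j\<close> after
      the substitution is undone.\<close>
    define H where "H = (\<Sum>k\<le>d. \<bar>(deriv ^^ k) (h j) x0\<bar>)"
    define L1 where "L1 = L * (1 + H / \<bar>D\<bar>)"
    define L2 where "L2 = L1 + (1 / \<bar>D\<bar> + (\<Sum>i\<in>I. L1 * \<bar>t i\<bar>))"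
    have Dn: "D \<noteq> 0" using D0 D_def by simp
    have H0: "H \<ge> 0" by (simp add: H_def sum_nonneg)
    then have L1: "L1 > 0" unfolding L1_def by (intro mult_pos_pos L) (simp add: add_pos_nonneg)
    have L2': "1 / \<bar>D\<bar> + (\<Sum>i\<in>I. L1 * \<bar>t i\<bar>) \<ge> 0" using L1 by (intro add_nonneg_nonneg sum_nonneg) auto
    show ?thesis unfolding span_coeff_bound_def
    proof (rule exI[of _ "max d o'"], rule exI[of _ L2], rule exI[of _ r], intro conjI allI)
      show "L2 > 0" using L1 L2' unfolding L2_def by linarith
      fix c
      define e where "e = c j + (\<Sum>i\<in>I. c i * t i)"
      obtain c' where "\<forall>x\<in>ball x0 r. (\<Sum>i\<in>I. c i * h' i x) = (\<Sum>i\<in>I. c' i * h' i x)"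
        and "\<forall>M. (\<forall>k\<le>d. \<bar>\<Sum>i\<in>I. c i * (deriv ^^ k) (h' i) x0\<bar> \<le> M) \<longrightarrow> (\<forall>i\<in>I. \<bar>c' i\<bar> \<le> L * M)"
        using P[of c] by (elim exE conjE) (rule that)
      note c1 = this(1)[rule_format] and c2 = this(2)[THEN spec, THEN mp]
      define c'' where "c'' = c'(j := e - (\<Sum>i\<in>I. c' i * t i))"
      have eqI: "(\<Sum>i\<in>I. c'' i * F i) = (\<Sum>i\<in>I. c' i * F i)" for F
        by (rule sum.cong) (use insert.hyps in \<open>auto simp: c''_def\<close>)
      have e1: "(\<Sum>i\<in>insert j I. c i * h i x) = (\<Sum>i\<in>I. c i * h' i x) + e * h j x" for x
        using insert.hyps by (simp add: e_def h'_def algebra_simps sum_subtractf sum_distrib_left)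
      have e2: "(\<Sum>i\<in>insert j I. c'' i * h i x) = (\<Sum>i\<in>I. c' i * h' i x) + e * h j x" for x
        using insert.hyps eqI[of "\<lambda>i. h i x"]
        by (simp add: h'_def algebra_simps sum_subtractf sum_distrib_left c''_def)
      have e3: "(\<Sum>i\<in>insert j I. c i * (deriv ^^ k) (h i) x0) = (\<Sum>i\<in>I. c i * (deriv ^^ k) (h' i) x0) + e * (deriv ^^ k) (h j) x0" for k
        using insert.hyps by (simp add: e_def dh' algebra_simps sum_subtractf sum_distrib_left)
      have z: "(\<Sum>i\<in>I. c i * (deriv ^^ o') (h' i) x0) = 0"
        by (rule sum.neutral) (use Dn in \<open>auto simp: dh' t_def D_def\<close>)
      show "\<exists>c'. (\<forall>x\<in>ball x0 r. (\<Sum>i\<in>insert j I. c i * h i x) = (\<Sum>i\<in>insert j I. c' i * h i x)) \<and>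
       (\<forall>M. (\<forall>k\<le>max d o'. \<bar>\<Sum>i\<in>insert j I. c i * (deriv ^^ k) (h i) x0\<bar> \<le> M) \<longrightarrow> (\<forall>i\<in>insert j I. \<bar>c' i\<bar> \<le> L2 * M))"
      proof (intro exI[of _ c''] conjI allI impI ballI)
        fix x assume "x \<in> ball x0 r"
        then show "(\<Sum>i\<in>insert j I. c i * h i x) = (\<Sum>i\<in>insert j I. c'' i * h i x)"
          using e1 e2 c1 by metis
      next
        fix M i assume M: "\<forall>k\<le>max d o'. \<bar>\<Sum>i\<in>insert j I. c i * (deriv ^^ k) (h i) x0\<bar> \<le> M" and i: "i \<in> insert j I"
        then have M0: "0 \<le> M" using order_trans[OF abs_ge_zero M[rule_format, OF le0]] by blast
        have "\<bar>e * D\<bar> \<le> M" using M e3[of o'] z unfolding D_def by (metis add_0 max.cobounded2)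
        then have eb: "\<bar>e\<bar> \<le> M / \<bar>D\<bar>" using Dn by (simp add: abs_mult pos_le_divide_eq)
        have "\<bar>\<Sum>i\<in>I. c i * (deriv ^^ k) (h' i) x0\<bar> \<le> (1 + H / \<bar>D\<bar>) * M" if "k \<le> d" for k
        proof -
          have "\<bar>(deriv ^^ k) (h j) x0\<bar> \<le> H" unfolding H_def
            by (rule member_le_sum) (use that in auto)
          then have "\<bar>e * (deriv ^^ k) (h j) x0\<bar> \<le> M / \<bar>D\<bar> * H"
            unfolding abs_mult using eb M0 by (intro mult_mono) auto
          moreover have "\<bar>\<Sum>i\<in>insert j I. c i * (deriv ^^ k) (h i) x0\<bar> \<le> M" using M that by auto
          ultimately show ?thesis using e3[of k] by (simp add: algebra_simps)
        qed
        then have cb: "\<And>i. i \<in> I \<Longrightarrow> \<bar>c' i\<bar> \<le> L1 * M"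
          using c2[of "(1 + H / \<bar>D\<bar>) * M"] by (simp add: L1_def mult.assoc)
        show "\<bar>c'' i\<bar> \<le> L2 * M"
        proof (cases "i = j")
          case True
          have "\<bar>\<Sum>i\<in>I. c' i * t i\<bar> \<le> (\<Sum>i\<in>I. L1 * \<bar>t i\<bar> * M)"
          proof (rule order_trans[OF sum_abs sum_mono])
            fix i assume "i \<in> I"
            then show "\<bar>c' i * t i\<bar> \<le> L1 * \<bar>t i\<bar> * M"
              using mult_right_mono[OF cb[of i], of "\<bar>t i\<bar>"] by (simp add: abs_mult algebra_simps)
          qed
          then have "\<bar>c'' i\<bar> \<le> (1 / \<bar>D\<bar> + (\<Sum>i\<in>I. L1 * \<bar>t i\<bar>)) * M"
            using eb True by (simp add: c''_def algebra_simps sum_distrib_left)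
          then show ?thesis unfolding L2_def using L1 M0 by (simp add: ring_distribs add_increasing)
        next
          case False
          then have "\<bar>c'' i\<bar> \<le> L1 * M" using i cb by (simp add: c''_def)
          then show ?thesis unfolding L2_def distrib_right using mult_nonneg_nonneg[OF L2' M0] by (simp add: distrib_right)
        qed
      qed
    qed (use r in auto)
  qed
qed

text \<open>Take the order \<open>k\<close> whose derivative at \<open>x0\<close> is largest, with
  value \<open>M\<close> in modulus. The coefficients are at most \<open>L * M\<close>, so the
  derivative of order \<open>k + 1\<close> is at most \<open>A * M\<close> nearby. On a ball of
  radius \<open>s\<close> with \<open>s * A \<le> 1 / 3\<close> the derivative of order
  \<open>k\<close> thus has modulus between \<open>2 * M / 3\<close> and \<open>4 * M / 3\<close>,
  which gives the ratio 2.\<close>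

lemma span_comparable_derivative:
  assumes "finite I" "open U" "x0 \<in> U" "\<And>i. i \<in> I \<Longrightarrow> real_analytic_on (h i) U"
  shows "\<exists>d r. r > 0 \<and> ball x0 r \<subseteq> U \<and> (\<forall>c. \<exists>c'.
     (\<forall>x\<in>ball x0 r. (\<Sum>i\<in>I. c i * h i x) = (\<Sum>i\<in>I. c' i * h i x)) \<and>
     (\<exists>k\<le>d. \<forall>x\<in>ball x0 r. \<forall>y\<in>ball x0 r.
        \<bar>\<Sum>i\<in>I. c' i * (deriv ^^ k) (h i) x\<bar> \<le> 2 * \<bar>\<Sum>i\<in>I. c' i * (deriv ^^ k) (h i) y\<bar>))"
proof -
  obtain d L r where L: "L > 0" and r: "r > 0" "ball x0 r \<subseteq> U"
    and sc: "span_coeff_bound I h x0 d L r"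
    using span_coefficient_bound[of I U x0 h, OF assms] by blast
  note P = sc[unfolded span_coeff_bound_def, THEN spec]
  define K where "K = cball x0 (r/2)"
  have KU: "K \<subseteq> U" and Kr: "K \<subseteq> ball x0 r" using r unfolding K_def by (auto simp: subset_iff)
  have "\<exists>H. \<forall>x\<in>K. \<bar>(deriv ^^ k) (h i) x\<bar> \<le> H" if "i \<in> I" for i k
  proof -
    have "compact ((deriv ^^ k) (h i) ` K)"
      by (intro compact_continuous_image real_analytic_on_continuous[OF real_analytic_on_higher_deriv[OF assms(4)[OF that]] KU])
         (simp add: K_def)
    then have "bounded ((deriv ^^ k) (h i) ` K)" by (rule compact_imp_bounded)
    then show ?thesis unfolding bounded_iff by auto
  qed
  then obtain H0 where H0: "\<And>i k x. i \<in> I \<Longrightarrow> x \<in> K \<Longrightarrow> \<bar>(deriv ^^ k) (h i) x\<bar> \<le> H0 i k" by metis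
  define H where "H = (\<Sum>i\<in>I. \<Sum>k\<le>Suc d. \<bar>H0 i k\<bar>)"
  have H: "\<bar>(deriv ^^ k) (h i) x\<bar> \<le> H" if "i \<in> I" "x \<in> K" "k \<le> Suc d" for i k x
  proof -
    have "\<bar>(deriv ^^ k) (h i) x\<bar> \<le> \<bar>H0 i k\<bar>" using H0[of i x k] that by linarith
    also have "\<dots> \<le> (\<Sum>k\<le>Suc d. \<bar>H0 i k\<bar>)" by (rule member_le_sum) (use that in auto)
    also have "\<dots> \<le> H" unfolding H_def
      by (rule member_le_sum[where f = "\<lambda>i. \<Sum>k\<le>Suc d. \<bar>H0 i k\<bar>"]) (use that assms(1) in \<open>auto intro: sum_nonneg\<close>)
    finally show ?thesis .
  qed
  define A where "A = real (card I) * (L * H)"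
  have "H \<ge> 0" by (simp add: H_def sum_nonneg)
  then have A0: "A \<ge> 0" using L by (simp add: A_def)
  define s where "s = min (r/2) (1 / (3 * (A + 1)))"
  have s: "s > 0" "s \<le> r / 2" using r A0 by (auto simp: s_def)
  have "s \<le> 1 / (3 * (A + 1))" by (simp add: s_def)
  then have "s * (3 * (A + 1)) \<le> 1" using A0 by (simp add: pos_le_divide_eq)
  then have sA: "s * A \<le> 1 / 3" using s by (simp add: algebra_simps)
  have sK: "ball x0 s \<subseteq> K" using s by (auto simp: K_def)
  show ?thesis
  proof (rule exI[of _ d], rule exI[of _ s], intro conjI allI)
    show "ball x0 s \<subseteq> U" using sK KU by blast
    fix c
    obtain c' where "\<forall>x\<in>ball x0 r. (\<Sum>i\<in>I. c i * h i x) = (\<Sum>i\<in>I. c' i * h i x)"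
        and "\<forall>M. (\<forall>k\<le>d. \<bar>\<Sum>i\<in>I. c i * (deriv ^^ k) (h i) x0\<bar> \<le> M) \<longrightarrow> (\<forall>i\<in>I. \<bar>c' i\<bar> \<le> L * M)"
      using P[of c] by (elim exE conjE) (rule that)
      note c1 = this(1)[rule_format] and c2 = this(2)[THEN spec, THEN mp]
    define G where "G k x = (\<Sum>i\<in>I. c' i * (deriv ^^ k) (h i) x)" for k x
    have Gc: "G k x0 = (\<Sum>i\<in>I. c i * (deriv ^^ k) (h i) x0)" for k
    proof -
      have "eventually (\<lambda>x. x \<in> ball x0 r) (nhds x0)"
        by (rule eventually_nhds_in_open) (use r in auto)
      then have "eventually (\<lambda>x. (\<Sum>i\<in>I. c i * h i x) = (\<Sum>i\<in>I. c' i * h i x)) (nhds x0)"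
        by eventually_elim (rule c1)
      then have "(deriv ^^ k) (\<lambda>x. \<Sum>i\<in>I. c i * h i x) x0 = (deriv ^^ k) (\<lambda>x. \<Sum>i\<in>I. c' i * h i x) x0"
        by (rule higher_deriv_cong_ev) simp
      then show ?thesis
        using higher_deriv_lincomb[OF assms(2,3), of I h k c] higher_deriv_lincomb[OF assms(2,3), of I h k c']
        by (simp add: G_def assms(4))
    qed
    define M where "M = Max ((\<lambda>k. \<bar>G k x0\<bar>) ` {..d})"
    have "M \<in> (\<lambda>k. \<bar>G k x0\<bar>) ` {..d}" unfolding M_def by (rule Max_in) auto
    then obtain k where k: "k \<le> d" "M = \<bar>G k x0\<bar>" by blast
    have "\<bar>G k x0\<bar> \<le> M" if "k \<le> d" for k unfolding M_def using that by (intro Max_ge) auto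
    then have cb: "\<And>i. i \<in> I \<Longrightarrow> \<bar>c' i\<bar> \<le> L * M" using c2[of M] Gc by simp
    have dG: "(G k has_real_derivative G (Suc k) x) (at x)" if "x \<in> U" for x k
      unfolding G_def by (intro DERIV_sum DERIV_cmult real_analytic_on_has_higher_deriv) (use assms that in auto)
    have bG: "\<bar>G (Suc k) x\<bar> \<le> A * M" if "x \<in> K" for x
    proof -
      have "\<bar>G (Suc k) x\<bar> \<le> (\<Sum>i\<in>I. L * M * H)" unfolding G_def
      proof (rule order_trans[OF sum_abs sum_mono])
        fix i assume i: "i \<in> I"
        then have "0 \<le> L * M" using cb[of i] by linarith
        then show "\<bar>c' i * (deriv ^^ Suc k) (h i) x\<bar> \<le> L * M * H"
          unfolding abs_mult using cb[OF i] H[OF i that, of "Suc k"] k by (intro mult_mono) auto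
      qed
      then show ?thesis by (simp add: A_def algebra_simps)
    qed
    have M0: "M \<ge> 0" using k by simp
    have near: "\<bar>G k x - G k x0\<bar> \<le> M / 3" if x: "x \<in> ball x0 s" for x
    proof -
      have "norm (G k x - G k x0) \<le> (A * M) * norm (x - x0)"
      proof (rule field_differentiable_bound[of K "G k" "G (Suc k)"])
        show "convex K" by (simp add: K_def)
        show "(G k has_field_derivative G (Suc k) z) (at z within K)" if "z \<in> K" for z
          using dG KU that by (meson has_field_derivative_at_within subsetD)
      qed (use bG x sK r in \<open>auto simp: K_def\<close>)
      also have "\<dots> \<le> (A * M) * s"
        using x A0 M0 by (intro mult_left_mono) (auto simp: dist_real_def)
      also have "\<dots> \<le> M / 3" using mult_right_mono[OF sA M0] by (simp add: algebra_simps)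
      finally show ?thesis by simp
    qed
    have "\<bar>G k x\<bar> \<le> 2 * \<bar>G k y\<bar>" if "x \<in> ball x0 s" "y \<in> ball x0 s" for x y
      using near[OF that(1)] near[OF that(2)] k(2) M0 by linarith
    then show "\<exists>c'. (\<forall>x\<in>ball x0 s. (\<Sum>i\<in>I. c i * h i x) = (\<Sum>i\<in>I. c' i * h i x)) \<and>
     (\<exists>k\<le>d. \<forall>x\<in>ball x0 s. \<forall>y\<in>ball x0 s.
        \<bar>\<Sum>i\<in>I. c' i * (deriv ^^ k) (h i) x\<bar> \<le> 2 * \<bar>\<Sum>i\<in>I. c' i * (deriv ^^ k) (h i) y\<bar>)"
      using k(1) c1 sK Kr unfolding G_def by (intro exI[of _ c']) blast
  qed (use s in auto)
qed

section \<open>Measure of sublevel sets of such combinations\<close>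

lemma sublevel_set_in_sets:
  fixes g :: "real \<Rightarrow> real"
  assumes "continuous_on {a..b} g"
  shows "{x\<in>{a..b}. g x < t} \<in> sets lborel"
proof -
  obtain A where A: "open A" "A \<inter> {a..b} = g -` {..<t} \<inter> {a..b}"
    using continuous_on_open_invariant[THEN iffD1, THEN spec, THEN mp, OF assms open_lessThan] by blast
  have "{x\<in>{a..b}. g x < t} = g -` {..<t} \<inter> {a..b}" by auto
  then have "{x\<in>{a..b}. g x < t} = A \<inter> {a..b}" unfolding A(2) .
  then show ?thesis using A(1) by auto
qed

text \<open>The number of points is \<open>2 ^ k\<close> because each differentiation consumes them
  in disjoint pairs of neighbours, which keeps the remaining ones separated by the same
  distance.\<close>

definition separated_bound :: "nat \<Rightarrow> real \<Rightarrow> real \<Rightarrow> bool" where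
  "separated_bound k \<sigma> C \<longleftrightarrow> (\<forall>G a b p \<epsilon>. a < b \<longrightarrow>
    (\<forall>i<k. \<forall>x\<in>{a..b}. (G i has_real_derivative G (Suc i) x) (at x)) \<longrightarrow>
    (\<forall>x\<in>{a..b}. \<forall>y\<in>{a..b}. \<bar>G k x :: real\<bar> \<le> 2 * \<bar>G k y\<bar>) \<longrightarrow>
    (\<forall>i<2^k. p i \<in> {a..b} \<and> \<bar>G 0 (p i)\<bar> \<le> \<epsilon>) \<longrightarrow>
    (\<forall>i. Suc i < 2^k \<longrightarrow> p i + \<sigma> * (b - a) \<le> p (Suc i)) \<longrightarrow>
    (\<forall>x\<in>{a..b}. \<bar>G 0 x\<bar> \<le> C * \<epsilon>))"

text \<open>The mean value theorem between \<open>p (2 * i)\<close> and \<open>p (2 * i + 1)\<close>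
  yields half as many separated points at which the derivative is small. By induction the derivative
  is small on the whole interval, and integrating from \<open>p 0\<close> bounds the function. At
  \<open>k = 0\<close> the comparability of values does the work.\<close>

lemma bound_from_separated_points:
  assumes "\<sigma> > 0"
  shows "\<exists>C>0. separated_bound k \<sigma> C"
proof (induction k)
  case 0
  show ?case unfolding separated_bound_def
  proof (intro exI[of _ 2] conjI allI impI ballI)
    fix G :: "nat \<Rightarrow> real \<Rightarrow> real" and a b :: real and p :: "nat \<Rightarrow> real" and \<epsilon> x
    assume c: "\<forall>x\<in>{a..b}. \<forall>y\<in>{a..b}. \<bar>G 0 x\<bar> \<le> 2 * \<bar>G 0 y\<bar>"
      and p: "\<forall>i<2^0. p i \<in> {a..b} \<and> \<bar>G 0 (p i)\<bar> \<le> \<epsilon>" and x: "x \<in> {a..b}"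
    from p have "p 0 \<in> {a..b}" "\<bar>G 0 (p 0)\<bar> \<le> \<epsilon>" by auto
    then show "\<bar>G 0 x\<bar> \<le> 2 * \<epsilon>" using c[rule_format, OF x, of "p 0"] by linarith
  qed simp
next
  case (Suc k)
  then obtain C where C: "C > 0" and "separated_bound k \<sigma> C" by blast
  note IH = this(2)[unfolded separated_bound_def, THEN spec, THEN spec, THEN spec, THEN spec, THEN spec,
      THEN mp, THEN mp, THEN mp, THEN mp, THEN mp, THEN bspec]
  show ?case unfolding separated_bound_def
  proof (intro exI[of _ "1 + 2 * C / \<sigma>"] conjI allI impI ballI)
    show "1 + 2 * C / \<sigma> > 0" using C assms by (simp add: add_pos_nonneg)
    fix G :: "nat \<Rightarrow> real \<Rightarrow> real" and a b :: real and p :: "nat \<Rightarrow> real" and \<epsilon> x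
    assume ab: "a < b"
      and d: "\<forall>i<Suc k. \<forall>x\<in>{a..b}. (G i has_real_derivative G (Suc i) x) (at x)"
      and c: "\<forall>x\<in>{a..b}. \<forall>y\<in>{a..b}. \<bar>G (Suc k) x\<bar> \<le> 2 * \<bar>G (Suc k) y\<bar>"
      and p: "\<forall>i<2^Suc k. p i \<in> {a..b} \<and> \<bar>G 0 (p i)\<bar> \<le> \<epsilon>"
      and sep: "\<forall>i. Suc i < 2^Suc k \<longrightarrow> p i + \<sigma> * (b - a) \<le> p (Suc i)" and x: "x \<in> {a..b}"
    have ds: "\<sigma> * (b - a) > 0" using assms ab by simp
    have d0: "(G 0 has_real_derivative G 1 z) (at z)" if "z \<in> {a..b}" for z
      using d that by auto
    have "\<exists>q. p (2*i) \<le> q \<and> q \<le> p (2*i+1) \<and> \<bar>G 1 q\<bar> \<le> 2 * \<epsilon> / (\<sigma> * (b - a))" if "i < 2^k" for i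
    proof -
      have i: "2*i < 2^Suc k" "2*i+1 < 2^Suc k" using that by auto
      have P: "p (2*i) \<in> {a..b}" "p (2*i+1) \<in> {a..b}" "\<bar>G 0 (p (2*i))\<bar> \<le> \<epsilon>" "\<bar>G 0 (p (2*i+1))\<bar> \<le> \<epsilon>"
        using p i by blast+
      have s: "p (2*i) + \<sigma> * (b - a) \<le> p (2*i+1)" using sep i by auto
      have "\<exists>z>p (2*i). z < p (2*i+1) \<and> G 0 (p (2*i+1)) - G 0 (p (2*i)) = (p (2*i+1) - p (2*i)) * G 1 z"
        by (rule MVT2) (use s ds P d0 in auto)
      then obtain z where z: "z > p (2*i)" "z < p (2*i+1)"
        and e: "G 0 (p (2*i+1)) - G 0 (p (2*i)) = (p (2*i+1) - p (2*i)) * G 1 z" by blast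
      have "(\<sigma> * (b - a)) * \<bar>G 1 z\<bar> \<le> \<bar>(p (2*i+1) - p (2*i)) * G 1 z\<bar>"
        unfolding abs_mult using s ds by (intro mult_right_mono) auto
      also have "\<dots> \<le> 2 * \<epsilon>" using e P by linarith
      finally have "\<bar>G 1 z\<bar> \<le> 2 * \<epsilon> / (\<sigma> * (b - a))" using ds by (simp add: pos_le_divide_eq mult.commute)
      then show ?thesis using z less_imp_le by blast
    qed
    then have "\<forall>i. \<exists>q. i < 2^k \<longrightarrow> p (2*i) \<le> q \<and> q \<le> p (2*i+1) \<and> \<bar>G 1 q\<bar> \<le> 2 * \<epsilon> / (\<sigma> * (b - a))"
      by blast
    from choice[OF this] obtain q where q: "\<And>i. i < 2^k \<Longrightarrow> p (2*i) \<le> q i \<and> q i \<le> p (2*i+1) \<and> \<bar>G 1 (q i)\<bar> \<le> 2 * \<epsilon> / (\<sigma> * (b - a))"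
      by blast
    have G1: "\<bar>G 1 z\<bar> \<le> C * (2 * \<epsilon> / (\<sigma> * (b - a)))" if z: "z \<in> {a..b}" for z
    proof -
      have "\<bar>(\<lambda>i. G (Suc i)) 0 z\<bar> \<le> C * (2 * \<epsilon> / (\<sigma> * (b - a)))"
      proof (rule IH[of a b "\<lambda>i. G (Suc i)" q])
        show "\<forall>i<k. \<forall>x\<in>{a..b}. (G (Suc i) has_real_derivative G (Suc (Suc i)) x) (at x)" using d by auto
        show "\<forall>i<2 ^ k. q i \<in> {a..b} \<and> \<bar>G (Suc 0) (q i)\<bar> \<le> 2 * \<epsilon> / (\<sigma> * (b - a))"
        proof (intro allI impI)
          fix i :: nat assume i: "i < 2^k"
          then have "2*i < 2^Suc k" "2*i+1 < 2^Suc k" by auto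
          then have "p (2*i) \<in> {a..b}" "p (2*i+1) \<in> {a..b}" using p by blast+
          then show "q i \<in> {a..b} \<and> \<bar>G (Suc 0) (q i)\<bar> \<le> 2 * \<epsilon> / (\<sigma> * (b - a))"
            using q[OF i] by auto
        qed
        show "\<forall>i. Suc i < 2 ^ k \<longrightarrow> q i + \<sigma> * (b - a) \<le> q (Suc i)"
        proof (intro allI impI)
          fix i :: nat assume i: "Suc i < 2^k"
          then have "Suc (2*i+1) < 2^Suc k" by auto
          then have "p (2*i+1) + \<sigma> * (b - a) \<le> p (2 * Suc i)" using sep[rule_format, of "2*i+1"] by simp
          then show "q i + \<sigma> * (b - a) \<le> q (Suc i)" using q[of i] q[of "Suc i"] i by auto
        qed
      qed (use ab c z in auto)
      then show ?thesis by simp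
    qed
    have p0: "p 0 \<in> {a..b}" "\<bar>G 0 (p 0)\<bar> \<le> \<epsilon>" using p by auto
    have "norm (G 0 x - G 0 (p 0)) \<le> (C * (2 * \<epsilon> / (\<sigma> * (b - a)))) * norm (x - p 0)"
    proof (rule field_differentiable_bound[of "{a..b}" "G 0" "G 1"])
      show "(G 0 has_field_derivative G 1 z) (at z within {a..b})" if "z \<in> {a..b}" for z
        using d0[OF that] by (rule has_field_derivative_at_within)
    qed (use G1 x p0 in auto)
    also have "\<dots> \<le> (C * (2 * \<epsilon> / (\<sigma> * (b - a)))) * (b - a)"
      using x p0 order_trans[OF abs_ge_zero G1[OF x]] by (intro mult_left_mono) auto
    also have "\<dots> = 2 * C / \<sigma> * \<epsilon>" using ab by simp
    finally show "\<bar>G 0 x\<bar> \<le> (1 + 2 * C / \<sigma>) * \<epsilon>" using p0 by (simp add: algebra_simps)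
  qed
qed

text \<open>A greedy choice from the left. The infimum need not be attained, so the chosen point
  lies within \<tau> of it and the discarded piece has length \<open>2 * \<tau>\<close>; hence the
  factor 2.\<close>

lemma separated_points_of_measure:
  fixes a b \<tau> :: real
  assumes "\<tau> > 0" "E \<in> sets lborel" "E \<subseteq> {a..b}" "measure lborel E > 2 * real m * \<tau>"
  shows "\<exists>p. (\<forall>i\<le>m. p i \<in> E) \<and> (\<forall>i<m. p i + \<tau> \<le> p (Suc i))"
  using assms(2-)
proof (induction m arbitrary: a E)
  case 0
  then have "E \<noteq> {}" by auto
  then obtain x where "x \<in> E" by blast
  then show ?case by (intro exI[of _ "\<lambda>_. x"]) auto
next
  case (Suc m)
  have "0 \<le> 2 * real (Suc m) * \<tau>" using assms(1) by simp
  then have ne: "E \<noteq> {}" using Suc.prems(3) by auto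
  have bb: "bdd_below E" using Suc.prems(2) by (meson bdd_below_Icc bdd_below_mono)
  define i0 where "i0 = Inf E"
  have "\<exists>x\<in>E. x < i0 + \<tau>" using cInf_lessD[OF ne, of "i0 + \<tau>"] assms(1) unfolding i0_def by auto
  then obtain x0 where x0: "x0 \<in> E" "x0 < i0 + \<tau>" by blast
  define E' where "E' = E \<inter> {x0+\<tau>..}"
  have E': "E' \<in> sets lborel" unfolding E'_def using Suc.prems(1) by auto
  have fin: "A \<in> fmeasurable lborel" if "A \<in> sets lborel" "A \<subseteq> {a..b}" for A
    using fmeasurableI2[OF fmeasurable_compact[OF compact_Icc] that(2,1)] .
  have sub: "E \<subseteq> E' \<union> {i0..i0+2*\<tau>}"
  proof
    fix y assume y: "y \<in> E"
    then have "i0 \<le> y" unfolding i0_def using bb by (rule cInf_lower)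
    then show "y \<in> E' \<union> {i0..i0+2*\<tau>}" using y x0 by (auto simp: E'_def)
  qed
  have fE': "E' \<in> fmeasurable lborel" by (rule fin[OF E']) (use Suc.prems(2) in \<open>auto simp: E'_def\<close>)
  have "measure lborel E \<le> measure lborel (E' \<union> {i0..i0+2*\<tau>})"
    by (rule measure_mono_fmeasurable[OF sub]) (use Suc.prems(1) fE' fmeasurable_compact[OF compact_Icc, of i0 "i0 + 2 * \<tau>"] in \<open>auto intro!: fmeasurable.Un\<close>)
  also have "\<dots> \<le> measure lborel E' + measure lborel {i0..i0+2*\<tau>}"
    by (rule measure_Un_le) (use E' in auto)
  also have "measure lborel {i0..i0+2*\<tau>} = 2 * \<tau>" using assms(1) by simp
  finally have "measure lborel E' > 2 * real m * \<tau>" using Suc.prems(3) by (simp add: algebra_simps)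
  then obtain p where p: "\<forall>i\<le>m. p i \<in> E'" "\<forall>i<m. p i + \<tau> \<le> p (Suc i)"
    using Suc.IH[OF E', of a] Suc.prems(2) by (auto simp: E'_def)
  define p' where "p' = (\<lambda>i. case i of 0 \<Rightarrow> x0 | Suc j \<Rightarrow> p j)"
  have "p' i \<in> E" if "i \<le> Suc m" for i
    using that p(1) x0 by (auto simp: p'_def E'_def split: nat.split)
  moreover have "p' i + \<tau> \<le> p' (Suc i)" if "i < Suc m" for i
    using that p by (cases i) (auto simp: p'_def E'_def)
  ultimately show ?case by blast
qed

text \<open>A uniform version of the \<open>(C, \<alpha>)\<close>-good property of Kleinbock and Margulis.\<close>

lemma span_uniformly_good:
  assumes "finite I" "open U" "\<And>i. i \<in> I \<Longrightarrow> real_analytic_on (h i) U"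
    and "compact B" "B \<subseteq> U" "\<kappa> > 0"
  shows "\<exists>\<epsilon>>0. \<exists>\<eta>>0. \<epsilon> < 1 \<and> (\<forall>c a b. a < b \<longrightarrow> {a..b} \<subseteq> B \<longrightarrow> b - a < \<eta> \<longrightarrow>
     (\<exists>x\<in>{a..b}. 1 \<le> \<bar>\<Sum>i\<in>I. c i * h i x\<bar>) \<longrightarrow>
     measure lborel {x\<in>{a..b}. \<bar>\<Sum>i\<in>I. c i * h i x\<bar> < \<epsilon>} \<le> \<kappa> * (b - a))"
proof -
  define good where "good x0 d r \<longleftrightarrow> r > 0 \<and> ball x0 r \<subseteq> U \<and> (\<forall>c. \<exists>c'.
     (\<forall>x\<in>ball x0 r. (\<Sum>i\<in>I. c i * h i x) = (\<Sum>i\<in>I. c' i * h i x)) \<and>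
     (\<exists>k\<le>d. \<forall>x\<in>ball x0 r. \<forall>y\<in>ball x0 r.
        \<bar>\<Sum>i\<in>I. c' i * (deriv ^^ k) (h i) x\<bar> \<le> 2 * \<bar>\<Sum>i\<in>I. c' i * (deriv ^^ k) (h i) y\<bar>))" for x0 r and d :: nat
  have "\<exists>d r. good x0 d r" if "x0 \<in> B" for x0
    unfolding good_def by (rule span_comparable_derivative[OF assms(1,2) _ assms(3)]) (use assms(5) that in auto)
  then obtain d r where gd: "\<And>x0. x0 \<in> B \<Longrightarrow> good x0 (d x0) (r x0)" by metis
  have "B \<subseteq> (\<Union>x\<in>B. ball x (r x))" 
  proof
    fix x assume "x \<in> B"
    then have "r x > 0" using gd by (simp add: good_def)
    then show "x \<in> (\<Union>x\<in>B. ball x (r x))" using \<open>x \<in> B\<close> by (intro UN_I[of x]) auto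
  qed
  then obtain F where F: "F \<subseteq> B" "finite F" "B \<subseteq> (\<Union>x\<in>F. ball x (r x))"
    using compactE_image[OF assms(4), of B "\<lambda>x. ball x (r x)"] by auto
  \<comment> \<open>A Lebesgue number of the finite cover: each shorter interval lies in one ball,
    on which a single derivative is comparable with itself.\<close>
  obtain \<eta> where \<eta>: "\<eta> > 0" "\<And>T. T \<subseteq> B \<Longrightarrow> T \<noteq> {} \<Longrightarrow> diameter T < \<eta> \<Longrightarrow> \<exists>x\<in>F. T \<subseteq> ball x (r x)"
  proof (cases "F = {}")
    case True
    then have "B = {}" using F by auto
    then show ?thesis using that[of 1] by auto
  next
    case False
    obtain \<delta> where "\<delta> > 0" "\<And>T. T \<subseteq> B \<Longrightarrow> diameter T < \<delta> \<Longrightarrow> \<exists>S\<in>(\<lambda>x. ball x (r x)) ` F. T \<subseteq> S"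
      by (rule Lebesgue_number_lemma[OF assms(4), of "(\<lambda>x. ball x (r x)) ` F"]) (use False F in auto)
    then show ?thesis using that[of \<delta>] by simp
  qed
  define D where "D = (\<Sum>x\<in>F. d x)"
  have dD: "d x \<le> D" if "x \<in> F" for x unfolding D_def by (rule member_le_sum) (use that F in auto)
  \<comment> \<open>Since \<open>2 * 2 ^ k * \<sigma> k = \<kappa>\<close>, a sublevel set of
    measure above \<open>\<kappa> * (b - a)\<close> contains \<open>2 ^ k\<close> points separated
    by \<open>\<sigma> k * (b - a)\<close>.\<close>
  define \<sigma> where "\<sigma> k = \<kappa> / (2 * 2 ^ k)" for k :: nat
  have \<sigma>: "\<sigma> k > 0" for k using assms(6) by (simp add: \<sigma>_def)
  have "\<exists>C>0. separated_bound k (\<sigma> k) C" for k by (rule bound_from_separated_points[OF \<sigma>])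
  then have "\<exists>C. \<forall>k. C k > 0 \<and> separated_bound k (\<sigma> k) (C k)" by (intro choice allI) blast
  then obtain C where C: "\<And>k. C k > 0" and sb: "\<And>k. separated_bound k (\<sigma> k) (C k)" by blast
  note sb = sb[unfolded separated_bound_def, THEN spec, THEN spec, THEN spec, THEN spec, THEN spec,
      THEN mp, THEN mp, THEN mp, THEN mp, THEN mp]
  \<comment> \<open>Chosen so that \<open>C k * \<epsilon> < 1\<close> for every order
    \<open>k\<close> that can occur; the bound from separated points then contradicts a value of
    modulus at least 1.\<close>
  define \<epsilon> where "\<epsilon> = 1 / (2 + (\<Sum>k\<le>D. C k))"
  have sC: "(\<Sum>k\<le>D. C k) \<ge> 0" using C by (intro sum_nonneg) (simp add: less_imp_le)
  have eps: "\<epsilon> > 0" "\<epsilon> < 1" using sC by (auto simp: \<epsilon>_def)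
  have Ce: "C k * \<epsilon> < 1" if "k \<le> D" for k
  proof -
    have "C k \<le> (\<Sum>k\<le>D. C k)" by (rule member_le_sum) (use that C in \<open>auto simp: less_imp_le\<close>)
    then show ?thesis using sC by (simp add: \<epsilon>_def)
  qed
  show ?thesis
  proof (rule exI[of _ \<epsilon>], intro conjI eps, rule exI[of _ \<eta>], intro conjI eps \<eta>(1) allI impI)
    fix c a b assume ab: "a < b" "{a..b} \<subseteq> B" "b - a < \<eta>" and big: "\<exists>x\<in>{a..b}. 1 \<le> \<bar>\<Sum>i\<in>I. c i * h i x\<bar>"
    have "diameter {a..b} = b - a" using ab(1) by (simp add: diameter_closed_interval)
    then obtain x0 where x0: "x0 \<in> F" "{a..b} \<subseteq> ball x0 (r x0)" using \<eta>(2)[of "{a..b}"] ab by auto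
    then have g: "good x0 (d x0) (r x0)" using gd F by blast
    then obtain c' k where c': "\<forall>x\<in>ball x0 (r x0). (\<Sum>i\<in>I. c i * h i x) = (\<Sum>i\<in>I. c' i * h i x)"
      and k: "k \<le> d x0" and comp: "\<forall>x\<in>ball x0 (r x0). \<forall>y\<in>ball x0 (r x0).
        \<bar>\<Sum>i\<in>I. c' i * (deriv ^^ k) (h i) x\<bar> \<le> 2 * \<bar>\<Sum>i\<in>I. c' i * (deriv ^^ k) (h i) y\<bar>"
      unfolding good_def by (elim conjE allE[of _ c] exE) (rule that)
    define E where "E = {x\<in>{a..b}. \<bar>\<Sum>i\<in>I. c i * h i x\<bar> < \<epsilon>}"
    define G where "G k x = (\<Sum>i\<in>I. c' i * (deriv ^^ k) (h i) x)" for k x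
    have abU: "{a..b} \<subseteq> U" using ab assms(5) by blast
    have G0: "G 0 x = (\<Sum>i\<in>I. c i * h i x)" if "x \<in> {a..b}" for x
      using c' x0 that by (auto simp: G_def)
    have cont: "continuous_on {a..b} (\<lambda>x. \<bar>\<Sum>i\<in>I. c i * h i x\<bar>)"
      by (intro continuous_intros real_analytic_on_continuous[OF assms(3) abU])
    have Es: "E \<in> sets lborel" unfolding E_def by (rule sublevel_set_in_sets[OF cont])
    have "measure lborel E \<le> \<kappa> * (b - a)"
    proof (rule ccontr)
      assume "\<not> ?thesis"
      then have gt: "measure lborel E > \<kappa> * (b - a)" by simp
      have "2 * real (2 ^ k - 1) * (\<sigma> k * (b - a)) \<le> 2 * 2 ^ k * (\<sigma> k * (b - a))"
        using \<sigma>[of k] ab(1) by (intro mult_right_mono) auto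
      also have "\<dots> = \<kappa> * (b - a)" by (simp add: \<sigma>_def)
      finally have mE: "measure lborel E > 2 * real (2 ^ k - 1) * (\<sigma> k * (b - a))" using gt by linarith
      have Eab: "E \<subseteq> {a..b}" and s0: "\<sigma> k * (b - a) > 0" using \<sigma>[of k] ab(1) by (auto simp: E_def)
      obtain p where p: "\<forall>i\<le>2 ^ k - 1. p i \<in> E" "\<forall>i<2 ^ k - 1. p i + \<sigma> k * (b - a) \<le> p (Suc i)"
        using separated_points_of_measure[OF s0 Es Eab mE] by blast
      have "\<forall>x\<in>{a..b}. \<bar>G 0 x\<bar> \<le> C k * \<epsilon>"
      proof (rule sb[OF ab(1)])
        show "\<forall>i<k. \<forall>x\<in>{a..b}. (G i has_real_derivative G (Suc i) x) (at x)"
          unfolding G_def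
          by (intro allI impI ballI DERIV_sum DERIV_cmult real_analytic_on_has_higher_deriv) (use assms(3) abU in \<open>auto simp del: funpow.simps\<close>)
        show "\<forall>x\<in>{a..b}. \<forall>y\<in>{a..b}. \<bar>G k x\<bar> \<le> 2 * \<bar>G k y\<bar>"
          using comp x0(2) unfolding G_def by blast
        show "\<forall>i<2 ^ k. p i \<in> {a..b} \<and> \<bar>G 0 (p i)\<bar> \<le> \<epsilon>"
        proof (intro allI impI)
          fix i :: nat assume "i < 2 ^ k"
          then have "i \<le> 2 ^ k - 1" by linarith
          then have "p i \<in> E" using p by blast
          then show "p i \<in> {a..b} \<and> \<bar>G 0 (p i)\<bar> \<le> \<epsilon>" using G0[of "p i"] by (auto simp: E_def)
        qed
        show "\<forall>i. Suc i < 2 ^ k \<longrightarrow> p i + \<sigma> k * (b - a) \<le> p (Suc i)" using p(2) by auto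
      qed
      moreover have "C k * \<epsilon> < 1" using Ce[of k] k dD[OF x0(1)] by linarith
      moreover obtain x where "x \<in> {a..b}" "1 \<le> \<bar>\<Sum>i\<in>I. c i * h i x\<bar>" using big by blast
      ultimately show False using G0[of x] by fastforce
    qed
    then show "measure lborel {x\<in>{a..b}. \<bar>\<Sum>i\<in>I. c i * h i x\<bar> < \<epsilon>} \<le> \<kappa> * (b - a)"
      by (simp add: E_def)
  qed
qed

section \<open>Marked points\<close>

lemma emeasure_UN_le_mult:
  assumes "countable C" "\<And>y. y \<in> C \<Longrightarrow> N y \<in> sets M" "\<And>y. y \<in> C \<Longrightarrow> D y \<in> sets M"
    and "disjoint_family_on N C" "\<And>y. y \<in> C \<Longrightarrow> emeasure M (D y) \<le> c * emeasure M (N y)"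
  shows "emeasure M (\<Union>y\<in>C. D y) \<le> c * emeasure M (\<Union>y\<in>C. N y)"
proof -
  \<comment> \<open>Each \<open>Ci i\<close> is empty or a singleton, which turns the countable,
    possibly finite, index set into a sequence.\<close>
  define Ci where "Ci i = {y \<in> C. to_nat_on C y = i}" for i
  have Ci: "Ci i = {} \<or> (\<exists>y\<in>C. Ci i = {y})" for i
  proof (cases "Ci i = {}")
    case False
    then obtain y where y: "y \<in> C" "to_nat_on C y = i" by (auto simp: Ci_def)
    then have "Ci i = {y}" using inj_on_to_nat_on[OF assms(1)] by (auto simp: Ci_def inj_on_def)
    then show ?thesis using y by blast
  qed simp
  define A where "A i = (\<Union>y\<in>Ci i. N y)" for i
  define B where "B i = (\<Union>y\<in>Ci i. D y)" for i
  have UA: "(\<Union>y\<in>C. N y) = (\<Union>i. A i)" and UB: "(\<Union>y\<in>C. D y) = (\<Union>i. B i)"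
    by (auto simp: A_def B_def Ci_def)
  have sA: "A i \<in> sets M" and sB: "B i \<in> sets M" and le: "emeasure M (B i) \<le> c * emeasure M (A i)" for i
    using Ci[of i] assms by (auto simp: A_def B_def)
  have dj: "disjoint_family A"
    unfolding disjoint_family_on_def
  proof (intro ballI impI)
    fix i j :: nat assume "i \<noteq> j"
    have "N y \<inter> N z = {}" if "y \<in> Ci i" "z \<in> Ci j" for y z
    proof -
      have "y \<in> C" "z \<in> C" "y \<noteq> z" using that \<open>i \<noteq> j\<close> by (auto simp: Ci_def)
      then show ?thesis using assms(4) by (auto simp: disjoint_family_on_def)
    qed
    then show "A i \<inter> A j = {}" by (auto simp: A_def)
  qed
  have "emeasure M (\<Union>i. B i) \<le> (\<Sum>i. emeasure M (B i))"
    by (rule emeasure_subadditive_countably) (use sB in auto)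
  also have "\<dots> \<le> (\<Sum>i. c * emeasure M (A i))"
    by (intro suminf_le) (use le in auto)
  also have "\<dots> = c * (\<Sum>i. emeasure M (A i))" by simp
  also have "(\<Sum>i. emeasure M (A i)) = emeasure M (\<Union>i. A i)"
    by (rule suminf_emeasure) (use sA dj in auto)
  finally show ?thesis by (simp add: UA UB)
qed

text \<open>The lower bounds, \<epsilon> inside the flag \<open>F\<close> and 1 for elements
  extending it, are what excludes short vectors. The upper bound inside the flag controls the
  covolume of the subspace to which such a vector is added.\<close>

definition marks ::
  "('p \<Rightarrow> 'p \<Rightarrow> bool) \<Rightarrow> ('p \<Rightarrow> real \<Rightarrow> real) \<Rightarrow> real \<Rightarrow> 'p set \<Rightarrow> 'p set \<Rightarrow> real \<Rightarrow> bool" where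
  "marks cmp \<psi> \<epsilon> P F x \<longleftrightarrow> finite F \<and> F \<subseteq> P \<and> (\<forall>p\<in>F. \<forall>q\<in>F. cmp p q) \<and>
     (\<forall>p\<in>F. \<epsilon> \<le> \<psi> p x \<and> \<psi> p x < 1) \<and> (\<forall>q\<in>P. q \<notin> F \<longrightarrow> (\<forall>p\<in>F. cmp p q) \<longrightarrow> 1 \<le> \<psi> q x)"

text \<open>
  The induction of Kleinbock and Margulis.  A point \<open>y\<close> that is not marked by the empty flag lies on
  an interval on which one \<open>\<psi> p\<close> stays below \<open>1\<close>; taking the longest such interval makes the
  hypotheses hold on it for all elements comparable with \<open>p\<close>, and \<open>p\<close> is added to the flags found
  there.  Since only a positive proportion is claimed, Vitali's lemma can replace Besicovitch's.
\<close>

lemma positive_proportion_marked: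
  fixes \<psi> :: "'p \<Rightarrow> real \<Rightarrow> real" and rk :: "'p \<Rightarrow> nat"
  assumes refl: "\<And>p. cmp p p" and sym: "\<And>p q. cmp p q \<Longrightarrow> cmp q p"
    and rank: "\<And>p q. p \<in> P0 \<Longrightarrow> q \<in> P0 \<Longrightarrow> cmp p q \<Longrightarrow> rk p = rk q \<Longrightarrow> p = q"
    and good: "\<And>p a b. p \<in> P0 \<Longrightarrow> {a..b} \<subseteq> B \<Longrightarrow> a < b \<Longrightarrow> \<exists>x\<in>{a..b}. 1 \<le> \<psi> p x \<Longrightarrow>
      measure lborel {x\<in>{a..b}. \<psi> p x < \<epsilon>} \<le> \<kappa> * (b - a)"
    and cont: "\<And>p. p \<in> P0 \<Longrightarrow> continuous_on B (\<psi> p)"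
    and fin: "\<And>x. x \<in> B \<Longrightarrow> finite {p \<in> P0. \<psi> p x < 1}"
    and \<kappa>: "\<kappa> \<le> 1 / (2 * 20 ^ m)"
    and "P \<subseteq> P0" "rk ` P \<subseteq> R" "finite R" "card R \<le> m" "a < b" "{a..b} \<subseteq> B"
      "\<And>p. p \<in> P \<Longrightarrow> \<exists>x\<in>{a..b}. 1 \<le> \<psi> p x"
  shows "\<exists>M\<in>sets lborel. M \<subseteq> {a..b} \<and> (b - a) / 20 ^ m \<le> measure lborel M \<and>
    (\<forall>x\<in>M. \<exists>F. marks cmp \<psi> \<epsilon> P F x)"
  using assms(7-)
proof (induction m arbitrary: P R a b)
  case 0
  then have "P = {}" by auto
  then have "marks cmp \<psi> \<epsilon> P {} x" for x by (simp add: marks_def)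
  then show ?case using 0(6) by (intro bexI[of _ "{a..b}"]) (auto intro: exI[of _ "{}"])
next
  case (Suc m)
  note PP = Suc.prems(2)
  have fmE: "X \<in> fmeasurable lborel" if "X \<in> sets lborel" "X \<subseteq> {a..b}" for X
    using fmeasurableI2[OF fmeasurable_compact[OF compact_Icc] that(2,1)] .
  have cab: "continuous_on {a..b} (\<psi> p)" if "p \<in> P" for p
    using cont continuous_on_subset Suc.prems(7) PP that by blast
  \<comment> \<open>Continuity is known on the interval only, so its relatively open sublevel sets
    are cut out by open sets of the line.\<close>
  have "\<exists>U. open U \<and> U \<inter> {a..b} = {x\<in>{a..b}. \<psi> p x < t}" if p: "p \<in> P" for p t
  proof -
    obtain U where "open U" "U \<inter> {a..b} = \<psi> p -` {..<t} \<inter> {a..b}"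
      using continuous_on_open_invariant[THEN iffD1, THEN spec, THEN mp, OF cab[OF p] open_lessThan] by blast
    moreover have "\<psi> p -` {..<t} \<inter> {a..b} = {x\<in>{a..b}. \<psi> p x < t}" by auto
    ultimately show ?thesis by metis
  qed
  note ex = this
  define U where "U p t = (SOME U. open U \<and> U \<inter> {a..b} = {x\<in>{a..b}. \<psi> p x < t})" for p t
  have U: "open (U p t)" "U p t \<inter> {a..b} = {x\<in>{a..b}. \<psi> p x < t}" if "p \<in> P" for p t
    using someI_ex[OF ex[OF that, of t]] unfolding U_def by blast+
  have Umem: "x \<in> U p t \<longleftrightarrow> \<psi> p x < t" if "p \<in> P" "x \<in> {a..b}" for p x t
    using U(2)[OF that(1), of t] that(2) by blast
  define Z where "Z p = {x\<in>{a..b}. 1 \<le> \<psi> p x}" for p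
  have Zeq: "Z p = {a..b} - U p 1" if "p \<in> P" for p unfolding Z_def using Umem[OF that] by force
  have Zc: "closed (Z p)" if "p \<in> P" for p unfolding Zeq[OF that] using U(1)[OF that] by (intro closed_Diff) auto
  have Zn: "Z p \<noteq> {}" if "p \<in> P" for p using Suc.prems(8)[OF that] by (auto simp: Z_def)
  define E where "E = {x\<in>{a..b}. \<exists>p\<in>P. \<psi> p x < 1}"
  have "E = (\<Union>p\<in>P. U p 1) \<inter> {a..b}" unfolding E_def using Umem by blast
  moreover have "open (\<Union>p\<in>P. U p 1)" using U(1) by blast
  ultimately have Es: "E \<in> sets lborel" by auto
  \<comment> \<open>\<open>infdist y (Z p)\<close> measures how far from \<open>y\<close> the
    function \<open>\<psi> p\<close> stays below 1. By \<open>fin\<close> only finitely many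
    \<open>p\<close> are below 1 at \<open>y\<close>, so a largest distance exists.\<close>
  have "\<exists>p. p \<in> P \<and> \<psi> p y < 1 \<and> (\<forall>q\<in>P. \<psi> q y < 1 \<longrightarrow> infdist y (Z q) \<le> infdist y (Z p))" if "y \<in> E" for y
  proof -
    define S where "S = {p\<in>P. \<psi> p y < 1}"
    have "y \<in> B" using that Suc.prems(7) by (auto simp: E_def)
    then have "finite S" by (rule finite_subset[OF _ fin, rotated]) (use PP in \<open>auto simp: S_def\<close>)
    moreover have "S \<noteq> {}" using that by (auto simp: S_def E_def)
    ultimately have fS: "finite S" "S \<noteq> {}" by blast+
    then have "Max ((\<lambda>p. infdist y (Z p)) ` S) \<in> (\<lambda>p. infdist y (Z p)) ` S" by (intro Max_in) auto
    then obtain p where "p \<in> S" and mx: "Max ((\<lambda>p. infdist y (Z p)) ` S) = infdist y (Z p)" by blast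
    moreover have "infdist y (Z q) \<le> infdist y (Z p)" if "q \<in> S" for q
      unfolding mx[symmetric] using fS that by (intro Max_ge) auto
    ultimately have "p \<in> P" "\<psi> p y < 1" "\<forall>q\<in>P. \<psi> q y < 1 \<longrightarrow> infdist y (Z q) \<le> infdist y (Z p)"
      by (auto simp: S_def)
    then show ?thesis by blast
  qed
  then have "\<forall>y\<in>E. \<exists>p. p \<in> P \<and> \<psi> p y < 1 \<and> (\<forall>q\<in>P. \<psi> q y < 1 \<longrightarrow> infdist y (Z q) \<le> infdist y (Z p))"
    by blast
  from bchoice[OF this] obtain pp where "\<forall>y\<in>E. pp y \<in> P \<and> \<psi> (pp y) y < 1 \<and>
      (\<forall>q\<in>P. \<psi> q y < 1 \<longrightarrow> infdist y (Z q) \<le> infdist y (Z (pp y)))" ..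
  then have pp: "\<And>y. y \<in> E \<Longrightarrow> pp y \<in> P" "\<And>y. y \<in> E \<Longrightarrow> \<psi> (pp y) y < 1"
    "\<And>y q. y \<in> E \<Longrightarrow> q \<in> P \<Longrightarrow> \<psi> q y < 1 \<Longrightarrow> infdist y (Z q) \<le> infdist y (Z (pp y))"
    by simp_all
  define r where "r y = infdist y (Z (pp y))" for y
  have Eab: "E \<subseteq> {a..b}" by (auto simp: E_def)
  have att: "\<exists>z\<in>Z q. infdist y (Z q) = dist y z" if "q \<in> P" for q y
    using infdist_attains_inf[OF Zc[OF that] Zn[OF that], of y] by blast
  have rpos: "r y > 0" if "y \<in> E" for y
  proof -
    have "y \<notin> Z (pp y)" using pp(2)[OF that] by (auto simp: Z_def)
    then show ?thesis unfolding r_def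
      using Zc Zn pp(1)[OF that] by (simp add: infdist_pos_not_in_closed)
  qed
  have rle: "r y \<le> b - a" if y: "y \<in> E" for y
  proof -
    obtain z where "z \<in> Z (pp y)" "r y = dist y z" using att[OF pp(1)[OF y], of y] by (auto simp: r_def)
    moreover have "y \<in> {a..b}" using y Eab by blast
    ultimately show ?thesis by (auto simp: Z_def dist_real_def)
  qed
  \<comment> \<open>Clipping to \<open>{a..b}\<close> keeps length at least \<open>r y\<close>,
    because \<open>r y \<le> b - a\<close>. The interval is closed so that it contains a nearest
    point of every \<open>Z q\<close> at distance exactly \<open>r y\<close>.\<close>
  define l u where "l y = max a (y - r y)" and "u y = min b (y + r y)" for y
  have lu: "u y - l y \<ge> r y" "l y < u y" "{l y..u y} \<subseteq> {a..b}" if "y \<in> E" for y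
  proof -
    have yab: "y \<in> {a..b}" using that Eab by blast
    then show "u y - l y \<ge> r y" "l y < u y" "{l y..u y} \<subseteq> {a..b}"
      using rpos[OF that] rle[OF that] by (auto simp: l_def u_def)
  qed
  have meets: "\<exists>x\<in>{l y..u y}. 1 \<le> \<psi> q x" if y: "y \<in> E" and q: "q \<in> P" for y q
  proof (cases "\<psi> q y < 1")
    case True
    then have "infdist y (Z q) \<le> r y" using pp(3) y q by (simp add: r_def)
    moreover obtain z where "z \<in> Z q" "infdist y (Z q) = dist y z" using att[OF q] by blast
    ultimately have "z \<in> {l y..u y}" "1 \<le> \<psi> q z"
      using Eab y by (auto simp: Z_def l_def u_def dist_real_def)
    then show ?thesis by blast
  next
    case False
    then show ?thesis using rpos[OF y] Eab y by (intro bexI[of _ y]) (auto simp: l_def u_def)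
  qed
  have "\<exists>N. N \<in> sets lborel \<and> N \<subseteq> ball y (r y) \<inter> E \<and> r y / (2 * 20 ^ m) \<le> measure lborel N \<and>
     (\<forall>x\<in>N. \<exists>F. marks cmp \<psi> \<epsilon> P F x)" if y: "y \<in> E" for y
  proof -
    define p where "p = pp y"
    have p: "p \<in> P" using pp(1)[OF y] by (simp add: p_def)
    define P' where "P' = {q\<in>P. cmp p q \<and> q \<noteq> p}"
    have lB: "{l y..u y} \<subseteq> B" using lu(3)[OF y] Suc.prems(7) by blast
    \<comment> \<open>An element comparable with \<open>p\<close> and of the same rank equals
      \<open>p\<close>, so the ranks in \<open>P'\<close> avoid \<open>rk p\<close> and one rank is
      used up.\<close>
    have rk: "rk ` P' \<subseteq> R - {rk p}"
      using rank PP Suc.prems(3) p unfolding P'_def by blast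
    have rkp: "rk p \<in> R" using p Suc.prems(3) by blast
    have "\<kappa> \<le> 1 / (2 * 20 ^ m)"
      by (rule order_trans[OF Suc.prems(1)]) (simp add: field_simps)
    then have "\<exists>M\<in>sets lborel. M \<subseteq> {l y..u y} \<and> (u y - l y) / 20 ^ m \<le> measure lborel M \<and>
        (\<forall>x\<in>M. \<exists>F. marks cmp \<psi> \<epsilon> P' F x)"
      by (rule Suc.IH[of P' "R - {rk p}" "l y" "u y"])
         (use PP rk rkp Suc.prems(4,5) lu(2)[OF y] lB meets[OF y] in \<open>auto simp: P'_def\<close>)
    then obtain M where M: "M \<in> sets lborel" "M \<subseteq> {l y..u y}" "(u y - l y) / 20 ^ m \<le> measure lborel M"
      "\<And>x. x\<in>M \<Longrightarrow> \<exists>F. marks cmp \<psi> \<epsilon> P' F x"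
      by blast
    define X where "X = {x\<in>{l y..u y}. \<psi> p x < \<epsilon>}"
    have "X = U p \<epsilon> \<inter> {l y..u y}" unfolding X_def using Umem[OF p] lu(3)[OF y] by blast
    then have Xs: "X \<in> sets lborel" using U(1)[OF p, of \<epsilon>] by auto
    have Xm: "measure lborel X \<le> \<kappa> * (u y - l y)"
      unfolding X_def using p PP by (intro good lB lu(2)[OF y] meets[OF y]) auto
    \<comment> \<open>The ends are removed so that the rest lies in the open ball, on which
      \<open>\<psi> p\<close> is still below 1.\<close>
    define Y where "Y = {y - r y, y + r y}"
    have Ys: "Y \<in> sets lborel" "Y \<in> null_sets lborel"
      unfolding Y_def by (auto intro!: finite_imp_null_set_lborel)
    define N where "N = M - (X \<union> Y)"
    have Ns: "N \<in> sets lborel" unfolding N_def using M Xs Ys by blast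
    have "X \<subseteq> {l y..u y}" "N \<subseteq> {l y..u y}" using M(2) by (auto simp: X_def N_def)
    then have fX: "X \<in> fmeasurable lborel" and fN: "N \<in> fmeasurable lborel"
      using fmE Xs Ns lu(3)[OF y] by (meson subset_trans)+
    have fY: "Y \<in> fmeasurable lborel" unfolding Y_def by (intro fmeasurable_compact) auto
    have "measure lborel M \<le> measure lborel (N \<union> (X \<union> Y))"
      by (rule measure_mono_fmeasurable) (use M(1) fmeasurable.Un[OF fN fmeasurable.Un[OF fX fY]] in \<open>auto simp: N_def\<close>)
    also have "\<dots> \<le> measure lborel N + measure lborel (X \<union> Y)"
      by (rule measure_Un_le) (use Ns Xs Ys in auto)
    also have "measure lborel (X \<union> Y) \<le> measure lborel X + measure lborel Y"
      by (rule measure_Un_le) (use Xs Ys in auto)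
    also have "measure lborel Y = 0" using Ys(2) by (simp add: null_sets_def measure_def)
    finally have "measure lborel N \<ge> (u y - l y) / 20 ^ m - \<kappa> * (u y - l y)" using M(3) Xm by linarith
    \<comment> \<open>By the choice of \<kappa>, discarding \<open>X\<close> costs at most half of
      the measure provided by the induction.\<close>
    moreover have "\<kappa> * (u y - l y) \<le> 1 / (2 * 20 ^ m) * (u y - l y)"
      using \<open>\<kappa> \<le> 1 / (2 * 20 ^ m)\<close> lu(2)[OF y] by (intro mult_right_mono) auto
    moreover have "r y / (2 * 20 ^ m) \<le> (u y - l y) / (2 * 20 ^ m)"
      using lu(1)[OF y] by (intro divide_right_mono) auto
    moreover have "(u y - l y) / 20 ^ m - 1 / (2 * 20 ^ m) * (u y - l y) = (u y - l y) / (2 * 20 ^ m)"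
      by (simp add: field_simps)
    ultimately have Nm: "r y / (2 * 20 ^ m) \<le> measure lborel N" by linarith
    have Nx: "x \<in> ball y (r y)" "x \<in> {a..b}" "\<epsilon> \<le> \<psi> p x" "\<psi> p x < 1" "\<exists>F. marks cmp \<psi> \<epsilon> P' F x" if "x \<in> N" for x
    proof -
      have x: "x \<in> M" "x \<in> {l y..u y}" "x \<notin> X" "x \<notin> Y" using that M(2) by (auto simp: N_def)
      then show "x \<in> ball y (r y)" by (auto simp: l_def u_def Y_def dist_real_def abs_less_iff less_le)
      show xab: "x \<in> {a..b}" using x lu(3)[OF y] by blast
      show "\<epsilon> \<le> \<psi> p x" using x by (auto simp: X_def)
      show "\<exists>F. marks cmp \<psi> \<epsilon> P' F x" using M(4) x by blast
      show "\<psi> p x < 1"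
      proof (rule ccontr)
        assume "\<not> \<psi> p x < 1"
        then have "x \<in> Z p" using xab by (simp add: Z_def)
        then have "r y \<le> dist y x" unfolding r_def p_def[symmetric] by (rule infdist_le)
        then show False using \<open>x \<in> ball y (r y)\<close> by simp
      qed
    qed
    have "\<exists>F. marks cmp \<psi> \<epsilon> P F x" if x: "x \<in> N" for x
    proof -
      obtain F where F: "marks cmp \<psi> \<epsilon> P' F x" using Nx(5)[OF x] by blast
      have "marks cmp \<psi> \<epsilon> P (insert p F) x"
        unfolding marks_def
      proof (intro conjI)
        show "\<forall>q\<in>P. q \<notin> insert p F \<longrightarrow> (\<forall>p'\<in>insert p F. cmp p' q) \<longrightarrow> 1 \<le> \<psi> q x"
          using F unfolding marks_def P'_def by blast
        show "\<forall>p'\<in>insert p F. \<forall>q\<in>insert p F. cmp p' q"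
          using F refl sym unfolding marks_def P'_def by blast
      qed (use F p Nx[OF x] in \<open>auto simp: marks_def P'_def\<close>)
      then show ?thesis by blast
    qed
    moreover have "N \<subseteq> ball y (r y) \<inter> E"
      using Nx p unfolding E_def by blast
    ultimately show ?thesis using Ns Nm by blast
  qed
  then have "\<forall>y\<in>E. \<exists>N. N \<in> sets lborel \<and> N \<subseteq> ball y (r y) \<inter> E \<and> r y / (2 * 20 ^ m) \<le> measure lborel N \<and>
     (\<forall>x\<in>N. \<exists>F. marks cmp \<psi> \<epsilon> P F x)" by blast
  from bchoice[OF this] obtain N where "\<forall>y\<in>E. N y \<in> sets lborel \<and> N y \<subseteq> ball y (r y) \<inter> E \<and>
     r y / (2 * 20 ^ m) \<le> measure lborel (N y) \<and> (\<forall>x\<in>N y. \<exists>F. marks cmp \<psi> \<epsilon> P F x)" ..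
  then have N: "\<And>y. y \<in> E \<Longrightarrow> N y \<in> sets lborel" "\<And>y. y \<in> E \<Longrightarrow> N y \<subseteq> ball y (r y) \<inter> E"
    "\<And>y. y \<in> E \<Longrightarrow> r y / (2 * 20 ^ m) \<le> measure lborel (N y)"
    "\<And>y x. y \<in> E \<Longrightarrow> x \<in> N y \<Longrightarrow> \<exists>F. marks cmp \<psi> \<epsilon> P F x"
    by blast+
  have cov: "E \<subseteq> (\<Union>y\<in>E. ball y (r y))" using rpos by auto
  obtain C where C: "countable C" "C \<subseteq> E" "pairwise (\<lambda>i j. disjnt (ball i (r i)) (ball j (r j))) C"
    "E \<subseteq> (\<Union>i\<in>C. ball i (5 * r i))"
    by (rule Vitali_covering_lemma_balls[OF cov, of "b - a"], simp add: rpos rle, rule that)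
  define T where "T = (\<Union>y\<in>C. N y)"
  have Ts: "T \<in> sets lborel" unfolding T_def using C N(1) by (intro sets.countable_UN') auto
  have TE: "T \<subseteq> E" unfolding T_def using N(2) C(2) by blast
  have "emeasure lborel E \<le> emeasure lborel (\<Union>i\<in>C. ball i (5 * r i))"
    by (rule emeasure_mono[OF C(4)]) (use C(1) in \<open>auto intro!: sets.countable_UN'\<close>)
  \<comment> \<open>Origin of the 20: the ball enlarged five times has length
    \<open>10 * r y\<close>, while \<open>N y\<close> has measure at least
    \<open>r y / (2 * 20 ^ m)\<close>.\<close>
  also have "\<dots> \<le> ennreal (20 ^ Suc m) * emeasure lborel T"
    unfolding T_def
  proof (rule emeasure_UN_le_mult[OF C(1)])
    show "disjoint_family_on N C"
      unfolding disjoint_family_on_def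
    proof (intro ballI impI)
      fix i j assume ij: "i \<in> C" "j \<in> C" "i \<noteq> j"
      then have "disjnt (ball i (r i)) (ball j (r j))" using C(3) by (auto simp: pairwise_def)
      then show "N i \<inter> N j = {}" using N(2) ij C(2) unfolding disjnt_def by blast
    qed
    fix y assume "y \<in> C"
    then have y: "y \<in> E" using C by blast
    have "N y \<in> fmeasurable lborel" using fmE N(1,2)[OF y] Eab by blast
    then have eN: "emeasure lborel (N y) = ennreal (measure lborel (N y))"
      by (rule emeasure_eq_measure2)
    have "emeasure lborel (ball y (5 * r y)) = emeasure lborel {y - 5 * r y<..<y + 5 * r y}"
      by (simp add: ball_eq_greaterThanLessThan)
    also have "\<dots> = ennreal (10 * r y)" using rpos[OF y] by simp
    also have "\<dots> \<le> ennreal (20 ^ Suc m * measure lborel (N y))"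
      using N(3)[OF y] by (intro ennreal_leI) (simp add: field_simps)
    also have "\<dots> = ennreal (20 ^ Suc m) * emeasure lborel (N y)" by (simp add: eN ennreal_mult')
    finally show "emeasure lborel (ball y (5 * r y)) \<le> ennreal (20 ^ Suc m) * emeasure lborel (N y)" .
  qed (use N(1) C(2) in auto)
  finally have ET: "emeasure lborel E \<le> ennreal (20 ^ Suc m) * emeasure lborel T" .
  have fE: "E \<in> fmeasurable lborel" and fT: "T \<in> fmeasurable lborel"
    using fmE Es Eab Ts TE by blast+
  have "ennreal (measure lborel E) \<le> ennreal (20 ^ Suc m * measure lborel T)"
    using ET by (simp add: emeasure_eq_measure2[OF fE] emeasure_eq_measure2[OF fT] ennreal_mult')
  then have mET: "measure lborel E \<le> 20 ^ Suc m * measure lborel T"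
    by (subst (asm) ennreal_le_iff) auto
  define M where "M = ({a..b} - E) \<union> T"
  have Ms: "M \<in> sets lborel" unfolding M_def using Es Ts by auto
  have fD: "{a..b} - E \<in> fmeasurable lborel" by (rule fmE) (use Es in auto)
  have mM: "measure lborel M = measure lborel ({a..b} - E) + measure lborel T"
    unfolding M_def by (rule measure_Union) (use fD fT TE in \<open>auto simp: fmeasurableD2 fmeasurableD\<close>)
  have "measure lborel (({a..b} - E) \<union> E) = measure lborel ({a..b} - E) + measure lborel E"
    by (rule measure_Union) (use fD fE in \<open>auto simp: fmeasurableD2 fmeasurableD\<close>)
  also have "({a..b} - E) \<union> E = {a..b}" using Eab by blast
  finally have mab: "b - a = measure lborel ({a..b} - E) + measure lborel E" using Suc.prems(6) by simp
  have "1 * measure lborel ({a..b} - E) \<le> 20 ^ Suc m * measure lborel ({a..b} - E)"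
    by (intro mult_right_mono one_le_power) auto
  then have "b - a \<le> 20 ^ Suc m * measure lborel M"
    using mET unfolding mab mM distrib_left by linarith
  then have "(b - a) / 20 ^ Suc m \<le> measure lborel M" by (simp add: pos_divide_le_eq mult.commute)
  moreover have "\<exists>F. marks cmp \<psi> \<epsilon> P F x" if "x \<in> M" for x
  proof (cases "x \<in> T")
    case True
    then show ?thesis using N(4) C(2) unfolding T_def by blast
  next
    case False
    then have "marks cmp \<psi> \<epsilon> P {} x" using that by (auto simp: M_def E_def marks_def not_less)
    then show ?thesis by blast
  qed
  moreover have "M \<subseteq> {a..b}" using TE Eab by (auto simp: M_def)
  ultimately show ?case using Ms by blast
qed

section \<open>Determinants and spans\<close>

definition rdet :: "nat \<Rightarrow> (nat \<Rightarrow> nat \<Rightarrow> real) \<Rightarrow> real" where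
  "rdet k c = Determinant.det (Matrix.mat k k (\<lambda>(i, j). c i j))"

lemma rdet_leibniz:
  "rdet k c = (\<Sum>p | p permutes {0..<k}. of_int (sign p) * (\<Prod>i = 0..<k. c i (p i)))"
proof -
  have "rdet k c = (\<Sum>p | p permutes {0..<k}.
      of_int (sign p) * (\<Prod>i = 0..<k. Matrix.mat k k (\<lambda>(i, j). c i j) $$ (i, p i)))"
    unfolding rdet_def by (rule det_def') simp
  also have "\<dots> = (\<Sum>p | p permutes {0..<k}. of_int (sign p) * (\<Prod>i = 0..<k. c i (p i)))"
  proof (intro sum.cong refl arg_cong2[of _ _ _ _ "(*)"] prod.cong)
    fix p i assume "p \<in> {p. p permutes {0..<k}}" "i \<in> {0..<k}"
    then have "p i < k" "i < k" using permutes_in_image[of p "{0..<k}" i] by auto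
    then show "Matrix.mat k k (\<lambda>(i, j). c i j) $$ (i, p i) = c i (p i)" by simp
  qed
  finally show ?thesis .
qed

lemma permutes_lessThan_le: "p permutes {0..<k} \<Longrightarrow> i < k \<Longrightarrow> p i < (k::nat)"
  using permutes_in_image[of p "{0..<k}" i] by auto

lemma rdet_cong:
  assumes "\<And>i j. i < k \<Longrightarrow> j < k \<Longrightarrow> c i j = c' i j"
  shows "rdet k c = rdet k c'"
  unfolding rdet_def by (rule arg_cong[of _ _ Determinant.det], rule eq_matI) (use assms in auto)

lemma rdet_upd:
  assumes "t < k"
  shows "rdet k (c(t := w)) =
    (\<Sum>p | p permutes {0..<k}. of_int (sign p) * (w (p t) * (\<Prod>i\<in>{0..<k} - {t}. c i (p i))))"
  unfolding rdet_leibniz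
proof (intro sum.cong refl arg_cong2[of _ _ _ _ "(*)"])
  fix p
  have "(\<Prod>i = 0..<k. (c(t := w)) i (p i)) = w (p t) * (\<Prod>i\<in>{0..<k} - {t}. (c(t := w)) i (p i))"
    using assms by (subst prod.remove[of _ t]) auto
  also have "(\<Prod>i\<in>{0..<k} - {t}. (c(t := w)) i (p i)) = (\<Prod>i\<in>{0..<k} - {t}. c i (p i))"
    by (rule prod.cong) auto
  finally show "(\<Prod>i = 0..<k. (c(t := w)) i (p i)) = w (p t) * (\<Prod>i\<in>{0..<k} - {t}. c i (p i))" .
qed

lemma rdet_row_sum:
  assumes "t < k"
  shows "rdet k (c(t := (\<lambda>j. \<Sum>l\<in>L. a l * w l j))) = (\<Sum>l\<in>L. a l * rdet k (c(t := w l)))"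
  unfolding rdet_upd[OF assms] sum_distrib_left sum_distrib_right
  by (subst sum.swap) (simp add: algebra_simps)

lemma rdet_row_lincomb:
  assumes "t < k" "\<And>j. j < k \<Longrightarrow> v j = (\<Sum>l\<in>L. a l * w l j)"
  shows "rdet k (c(t := v)) = (\<Sum>l\<in>L. a l * rdet k (c(t := w l)))"
proof -
  have "rdet k (c(t := v)) = rdet k (c(t := (\<lambda>j. \<Sum>l\<in>L. a l * w l j)))"
    by (rule rdet_cong) (use assms in auto)
  then show ?thesis using rdet_row_sum[OF assms(1)] by simp
qed

text \<open>Multilinearity in all rows of \<open>T\<close> at once; \<open>J\<close> records the
  summand chosen in each row.\<close>

lemma rdet_rows_sum:
  assumes "T \<subseteq> {..<k}" "finite L"
  shows "rdet k (\<lambda>t. if t \<in> T then (\<lambda>j. \<Sum>l\<in>L. A t l * w l j) else c t) =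
    (\<Sum>J\<in>T \<rightarrow>\<^sub>E L. (\<Prod>t\<in>T. A t (J t)) * rdet k (\<lambda>t. if t \<in> T then w (J t) else c t))"
proof -
  have fT: "finite T" using assms(1) finite_subset by blast
  have sp: "(\<Prod>i = 0..<k. (if i \<in> T then f i else g i)) = (\<Prod>i\<in>T. f i) * (\<Prod>i\<in>{0..<k} - T. g i)"
    for f g :: "nat \<Rightarrow> real"
  proof -
    have "(\<Prod>i = 0..<k. (if i \<in> T then f i else g i)) = (\<Prod>i\<in>{0..<k} \<inter> {i. i \<in> T}. f i) * (\<Prod>i\<in>{0..<k} \<inter> - {i. i \<in> T}. g i)"
      by (rule prod.If_cases) simp
    moreover have "{0..<k} \<inter> {i. i \<in> T} = T" "{0..<k} \<inter> - {i. i \<in> T} = {0..<k} - T" using assms(1) by auto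
    ultimately show ?thesis by simp
  qed
  have e: "(\<Prod>i = 0..<k. (if i \<in> T then (\<lambda>j. \<Sum>l\<in>L. A i l * w l j) else c i) (p i)) =
     (\<Sum>J\<in>T \<rightarrow>\<^sub>E L. (\<Prod>t\<in>T. A t (J t)) * (\<Prod>i = 0..<k. (if i \<in> T then w (J i) else c i) (p i)))" for p
  proof -
    have "(\<Prod>i = 0..<k. (if i \<in> T then (\<lambda>j. \<Sum>l\<in>L. A i l * w l j) else c i) (p i)) =
        (\<Prod>i\<in>T. \<Sum>l\<in>L. A i l * w l (p i)) * (\<Prod>i\<in>{0..<k} - T. c i (p i))"
      by (subst sp[symmetric]) (rule prod.cong, auto)
    also have "(\<Prod>i\<in>T. \<Sum>l\<in>L. A i l * w l (p i)) = (\<Sum>J\<in>T \<rightarrow>\<^sub>E L. \<Prod>i\<in>T. A i (J i) * w (J i) (p i))"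
      by (rule prod_sum_PiE) (use fT assms(2) in auto)
    also have "\<dots> * (\<Prod>i\<in>{0..<k} - T. c i (p i)) =
       (\<Sum>J\<in>T \<rightarrow>\<^sub>E L. (\<Prod>t\<in>T. A t (J t)) * ((\<Prod>i\<in>T. w (J i) (p i)) * (\<Prod>i\<in>{0..<k} - T. c i (p i))))"
      by (simp add: sum_distrib_right prod.distrib mult.assoc)
    also have "\<dots> = (\<Sum>J\<in>T \<rightarrow>\<^sub>E L. (\<Prod>t\<in>T. A t (J t)) * (\<Prod>i = 0..<k. (if i \<in> T then w (J i) else c i) (p i)))"
      by (subst sp[symmetric]) (intro sum.cong refl arg_cong2[of _ _ _ _ "(*)"] prod.cong, auto)
    finally show ?thesis .
  qed
  show ?thesis unfolding rdet_leibniz e sum_distrib_left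
    by (subst sum.swap) (simp add: algebra_simps)
qed

lemma rdet_scale_rows: "rdet k (\<lambda>t j. s t * c t j) = (\<Prod>t<k. s t) * rdet k c"
  unfolding rdet_leibniz prod.distrib sum_distrib_left atLeast0LessThan by (simp add: algebra_simps)

lemma rdet_identical_rows:
  assumes "i < k" "j < k" "i \<noteq> j" "\<And>l. l < k \<Longrightarrow> c i l = c j l"
  shows "rdet k c = 0"
  unfolding rdet_def
  by (rule det_identical_rows[of _ k i j]) (use assms in \<open>auto intro!: eq_vecI\<close>)

lemma rdet_swap_rows:
  assumes "i < k" "j < k" "i \<noteq> j"
  shows "rdet k (c(i := c j, j := c i)) = - rdet k c"
proof -
  have "swaprows i j (Matrix.mat k k (\<lambda>(i, j). c i j)) = Matrix.mat k k (\<lambda>(i', j'). (c(i := c j, j := c i)) i' j')"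
    by (rule eq_matI) (use assms in auto)
  moreover have "Determinant.det (swaprows i j (Matrix.mat k k (\<lambda>(i, j). c i j))) =
      - Determinant.det (Matrix.mat k k (\<lambda>(i, j). c i j))"
    by (rule det_swaprows[OF assms]) simp
  ultimately show ?thesis unfolding rdet_def by (simp del: fun_upd_apply)
qed

lemma rdet_identity: "rdet k (\<lambda>i j. if i = j then 1 else 0) = 1"
proof -
  have "Matrix.mat k k (\<lambda>(i, j). if i = j then 1 else 0 :: real) = 1\<^sub>m k" by (rule eq_matI) auto
  then show ?thesis unfolding rdet_def by simp
qed

lemma rdet_mult:
  "rdet k (\<lambda>i j. \<Sum>t<k. M i t * c t j) = rdet k M * rdet k c"
proof -
  have "Matrix.mat k k (\<lambda>(i, j). \<Sum>t<k. M i t * c t j) =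
      Matrix.mat k k (\<lambda>(i, j). M i j) * Matrix.mat k k (\<lambda>(i, j). c i j)"
    by (rule eq_matI) (auto simp: scalar_prod_def atLeast0LessThan)
  then show ?thesis unfolding rdet_def by (subst det_mult[of _ k, symmetric]) auto
qed

lemma rdet_in_Ints:
  assumes "\<And>i j. i < k \<Longrightarrow> j < k \<Longrightarrow> c i j \<in> \<int>"
  shows "rdet k c \<in> \<int>"
  unfolding rdet_leibniz
  by (intro Ints_sum Ints_mult Ints_prod) (use assms permutes_lessThan_le in auto)

lemma rdet_le_fact:
  assumes "\<And>i j. i < k \<Longrightarrow> j < k \<Longrightarrow> \<bar>c i j\<bar> \<le> 1"
  shows "\<bar>rdet k c\<bar> \<le> fact k"
proof -
  have "\<bar>rdet k c\<bar> \<le> (\<Sum>p | p permutes {0..<k}. 1)"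
    unfolding rdet_leibniz
  proof (rule order_trans[OF sum_abs sum_mono])
    fix p assume "p \<in> {p. p permutes {0..<k}}"
    then have "(\<Prod>i = 0..<k. \<bar>c i (p i)\<bar>) \<le> 1"
      by (intro prod_le_1) (use assms permutes_lessThan_le in auto)
    then show "\<bar>real_of_int (sign p) * (\<Prod>i = 0..<k. c i (p i))\<bar> \<le> 1"
      by (simp add: abs_mult abs_prod sign_def)
  qed
  also have "\<dots> = fact k" by (simp add: card_permutations[of _ k])
  finally show ?thesis .
qed

lemma rdet_solve:
  assumes "rdet k c \<noteq> 0"
  shows "\<exists>a. \<forall>j<k. v j = (\<Sum>t<k. a t * c t j)"
proof -
  define A where "A = Matrix.mat k k (\<lambda>(i, j). c i j)"
  define B where "B = adj_mat A"
  have A: "A \<in> carrier_mat k k" by (simp add: A_def)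
  have B: "B \<in> carrier_mat k k" "B * A = Determinant.det A \<cdot>\<^sub>m 1\<^sub>m k"
    unfolding B_def using adj_mat[OF A] by auto
  define D where "D = rdet k c"
  have D: "D = Determinant.det A" "D \<noteq> 0" using assms by (auto simp: D_def rdet_def A_def)
  have inv: "(\<Sum>t<k. B $$ (i, t) * c t j) = (if i = j then D else 0)" if "i < k" "j < k" for i j
  proof -
    have "(B * A) $$ (i, j) = (\<Sum>t<k. B $$ (i, t) * c t j)"
      using that A B(1) by (simp add: scalar_prod_def atLeast0LessThan A_def)
    then show ?thesis using B(2) that D by (cases "i = j") auto
  qed
  define a where "a t = (\<Sum>i<k. v i * B $$ (i, t)) / D" for t
  have "v j = (\<Sum>t<k. a t * c t j)" if "j < k" for j
  proof -
    have "(\<Sum>t<k. a t * c t j) = (\<Sum>t<k. \<Sum>i<k. v i * (B $$ (i, t) * c t j)) / D"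
      unfolding a_def sum_divide_distrib sum_distrib_right by (simp add: algebra_simps)
    also have "(\<Sum>t<k. \<Sum>i<k. v i * (B $$ (i, t) * c t j)) = (\<Sum>i<k. v i * (\<Sum>t<k. B $$ (i, t) * c t j))"
      unfolding sum_distrib_left by (rule sum.swap)
    also have "\<dots> = (\<Sum>i<k. if i = j then v i * D else 0)"
      by (rule sum.cong) (use inv that in auto)
    also have "\<dots> = v j * D" using that by simp
    finally show ?thesis using D by simp
  qed
  then show ?thesis by blast
qed

lemma rdet_upd_lincomb:
  assumes "t < k" "\<And>j. j < k \<Longrightarrow> v j = (\<Sum>l<k. a l * c l j)"
  shows "rdet k (c(t := v)) = a t * rdet k c"
proof -
  have "rdet k (c(t := v)) = (\<Sum>l<k. a l * rdet k (c(t := c l)))"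
    by (rule rdet_row_lincomb) (use assms in auto)
  also have "\<dots> = (\<Sum>l<k. if l = t then a t * rdet k c else 0)"
  proof (intro sum.cong refl)
    fix l assume "l \<in> {..<k}"
    then show "a l * rdet k (c(t := c l)) = (if l = t then a t * rdet k c else 0)"
      using rdet_identical_rows[of l k t "c(t := c l)"] assms(1) by auto
  qed
  also have "\<dots> = a t * rdet k c" using assms(1) by simp
  finally show ?thesis .
qed

text \<open>Cramer's rule for two rows. In the expansion of \<open>v\<close> only \<open>c t\<close>
  and \<open>c s\<close> survive, the latter with the sign of the exchange of the two rows.\<close>

lemma rdet_upd2_lincomb:
  assumes "s < k" "t < k" "s \<noteq> t"
    and u: "\<And>j. j < k \<Longrightarrow> u j = (\<Sum>l<k. a l * c l j)" and v: "\<And>j. j < k \<Longrightarrow> v j = (\<Sum>l<k. b l * c l j)"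
  shows "rdet k (c(s := u, t := v)) = (a s * b t - b s * a t) * rdet k c"
proof -
  have "rdet k (c(s := u, t := v)) = (\<Sum>l<k. b l * rdet k (c(s := u, t := c l)))"
    by (rule rdet_row_lincomb) (use assms in auto)
  also have "\<dots> = (\<Sum>l<k. (if l = t then b t * (a s * rdet k c) else 0) + (if l = s then b s * (- (a t * rdet k c)) else 0))"
  proof (intro sum.cong refl)
    fix l assume l: "l \<in> {..<k}"
    consider "l = t" | "l = s" | "l \<noteq> t" "l \<noteq> s" by blast
    then show "b l * rdet k (c(s := u, t := c l)) =
      (if l = t then b t * (a s * rdet k c) else 0) + (if l = s then b s * (- (a t * rdet k c)) else 0)"
    proof cases
      case 1
      then have "c(s := u, t := c l) = c(s := u)" using assms(3) by auto
      then show ?thesis using 1 assms(3) rdet_upd_lincomb[OF assms(1) u] by simp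
    next
      case 2
      define c' where "c' = c(t := u)"
      have "c(s := u, t := c l) = c'(s := c' t, t := c' s)" using assms(3) 2 by (auto simp: c'_def)
      then have "rdet k (c(s := u, t := c l)) = - rdet k c'" using rdet_swap_rows[of s k t c'] assms by simp
      also have "rdet k c' = a t * rdet k c" unfolding c'_def by (rule rdet_upd_lincomb[OF assms(2) u])
      finally have X: "rdet k (c(s := u, t := c l)) = - (a t * rdet k c)" .
      show ?thesis unfolding X using 2 assms(3) by simp
    next
      case 3
      have "rdet k (c(s := u, t := c l)) = 0"
        by (rule rdet_identical_rows[of l k t]) (use 3 l assms in auto)
      then show ?thesis using 3 by simp
    qed
  qed
  also have "\<dots> = (a s * b t - b s * a t) * rdet k c"
    using assms by (simp add: sum.distrib algebra_simps)
  finally show ?thesis .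
qed

lemma rdet_independent_rows:
  assumes "rdet k c \<noteq> 0" "\<And>j. j < k \<Longrightarrow> (\<Sum>t<k. a t * c t j) = 0" "t < k"
  shows "a t = 0"
proof -
  have "rdet k (c(t := (\<lambda>_. 0))) = a t * rdet k c"
    by (rule rdet_upd_lincomb) (use assms in auto)
  moreover have "rdet k (c(t := (\<lambda>_. 0))) = 0"
    using rdet_row_lincomb[of t k "\<lambda>_. 0" "\<lambda>_::nat. 0" "\<lambda>_ _. 0" "{}" c] assms(3) by simp
  ultimately show ?thesis using assms(1) by simp
qed

section \<open>Independence and spans through completed determinants\<close>

definition mix :: "nat \<Rightarrow> (nat \<Rightarrow> 'a) \<Rightarrow> (nat \<Rightarrow> 'a) \<Rightarrow> nat \<Rightarrow> 'a" where
  "mix j vs C = (\<lambda>t. if t < j then vs t else C t)"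

text \<open>For independent \<open>vs\<close> this is the linear span of \<open>vs 0, \<dots>, vs (j - 1)\<close>.\<close>

definition lspan :: "nat \<Rightarrow> nat \<Rightarrow> (nat \<Rightarrow> nat \<Rightarrow> real) \<Rightarrow> (nat \<Rightarrow> real) set" where
  "lspan k j vs = {v. \<forall>C. rdet k (mix j vs (C(j := v))) = 0}"

definition lindep :: "nat \<Rightarrow> nat \<Rightarrow> (nat \<Rightarrow> nat \<Rightarrow> real) \<Rightarrow> bool" where
  "lindep k j vs \<longleftrightarrow> (\<forall>C. rdet k (mix j vs C) = 0)"

lemma mix_upd: "mix j vs (C(j := v)) = (mix j vs C)(j := v)"
  by (auto simp: mix_def)

lemma mix_Suc: "mix (Suc j) (vs(j := v)) C = (mix j vs C)(j := v)"
  by (auto simp: mix_def)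

lemma lspanI_lincomb:
  assumes "j < k" "\<And>i. i < k \<Longrightarrow> v i = (\<Sum>t<j. a t * vs t i)"
  shows "v \<in> lspan k j vs"
proof -
  have "rdet k (mix j vs (C(j := v))) = 0" for C
  proof -
    have "rdet k ((mix j vs C)(j := v)) = (\<Sum>t<j. a t * rdet k ((mix j vs C)(j := vs t)))"
      by (rule rdet_row_lincomb) (use assms in auto)
    also have "\<dots> = 0"
    proof (intro sum.neutral ballI)
      fix t assume "t \<in> {..<j}"
      then have "rdet k ((mix j vs C)(j := vs t)) = 0"
        by (intro rdet_identical_rows[of t k j]) (use assms(1) in \<open>auto simp: mix_def\<close>)
      then show "a t * rdet k ((mix j vs C)(j := vs t)) = 0" by simp
    qed
    finally show ?thesis by (simp add: mix_upd)
  qed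
  then show ?thesis by (simp add: lspan_def)
qed

text \<open>Expand \<open>v\<close> in the rows of a nonsingular completion of \<open>vs\<close>. By
  Cramer's rule the coefficients with index at least \<open>j\<close> are determinants that vanish
  by definition of \<open>lspan\<close>; for an index other than \<open>j\<close> two rows are first
  exchanged.\<close>

lemma lspan_lincomb:
  assumes "\<not> lindep k j vs" "j < k" "v \<in> lspan k j vs"
  shows "\<exists>a. \<forall>i<k. v i = (\<Sum>t<j. a t * vs t i)"
proof -
  obtain C where C: "rdet k (mix j vs C) \<noteq> 0" using assms(1) by (auto simp: lindep_def)
  define c where "c = mix j vs C"
  obtain a where a: "\<And>i. i < k \<Longrightarrow> v i = (\<Sum>t<k. a t * c t i)"
    using rdet_solve[of k c v] C unfolding c_def by blast
  have z: "a t = 0" if t: "j \<le> t" "t < k" for t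
  proof -
    have 1: "rdet k (c(t := v)) = a t * rdet k c" by (rule rdet_upd_lincomb[OF t(2) a])
    have "rdet k (c(t := v)) = 0"
    proof (cases "t = j")
      case True
      then have "c(t := v) = mix j vs (C(j := v))" by (simp add: mix_upd c_def)
      then show ?thesis using assms(3) by (simp add: lspan_def)
    next
      case False
      define c' where "c' = mix j vs ((C(t := C j))(j := v))"
      have "c(t := v) = c'(j := c' t, t := c' j)"
        using False t by (auto simp: c_def c'_def mix_def fun_eq_iff)
      then have "rdet k (c(t := v)) = - rdet k c'"
        using rdet_swap_rows[of j k t c'] False assms(2) t by simp
      then show ?thesis using assms(3) by (simp add: lspan_def c'_def)
    qed
    then show ?thesis using 1 C by (simp add: c_def)
  qed
  have "v i = (\<Sum>t<j. a t * vs t i)" if "i < k" for i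
  proof -
    have "v i = (\<Sum>t<k. a t * c t i)" by (rule a[OF that])
    also have "\<dots> = (\<Sum>t<j. a t * c t i)"
      by (rule sum.mono_neutral_right) (use assms(2) z in auto)
    also have "\<dots> = (\<Sum>t<j. a t * vs t i)" by (rule sum.cong) (auto simp: c_def mix_def)
    finally show ?thesis .
  qed
  then show ?thesis by blast
qed

lemma lspan_base: "j < k \<Longrightarrow> t < j \<Longrightarrow> vs t \<in> lspan k j vs"
  by (rule lspanI_lincomb[of _ _ _ "\<lambda>s. if s = t then 1 else 0"]) (auto simp: if_distrib[of "\<lambda>x. x * _"] cong: if_cong)

lemma lspan_closed:
  assumes "j < k" "\<And>l. l \<in> L \<Longrightarrow> w l \<in> lspan k j vs" "\<And>i. i < k \<Longrightarrow> v i = (\<Sum>l\<in>L. a l * w l i)"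
  shows "v \<in> lspan k j vs"
proof -
  have "rdet k ((mix j vs C)(j := v)) = 0" for C
  proof -
    have "rdet k ((mix j vs C)(j := v)) = (\<Sum>l\<in>L. a l * rdet k ((mix j vs C)(j := w l)))"
      by (rule rdet_row_lincomb[OF assms(1,3)])
    also have "\<dots> = 0"
      by (intro sum.neutral ballI) (use assms(2) in \<open>auto simp: lspan_def mix_upd\<close>)
    finally show ?thesis .
  qed
  then show ?thesis by (simp add: lspan_def mix_upd)
qed

text \<open>Two bases of one subspace have proportional exterior products. The factor is the
  determinant of the base change, extended by the identity on the completing rows; it is nonzero
  because \<open>vs\<close> is independent.\<close>

lemma rdet_mix_proportional:
  assumes "\<not> lindep k j vs" "\<not> lindep k j vs'" "j < k" "\<And>t. t < j \<Longrightarrow> vs t \<in> lspan k j vs'"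
  shows "\<exists>c0. c0 \<noteq> 0 \<and> (\<forall>C. rdet k (mix j vs C) = c0 * rdet k (mix j vs' C))"
proof -
  have "\<exists>a. \<forall>i<k. vs t i = (\<Sum>s<j. a s * vs' s i)" if "t < j" for t
    by (rule lspan_lincomb[OF assms(2,3) assms(4)[OF that]])
  then obtain a where a: "\<And>t i. t < j \<Longrightarrow> i < k \<Longrightarrow> vs t i = (\<Sum>s<j. a t s * vs' s i)" by metis
  define M where "M i s = (if i < j then (if s < j then a i s else 0) else (if s = i then 1 else 0))" for i s
  have e: "rdet k (mix j vs C) = rdet k M * rdet k (mix j vs' C)" for C
  proof -
    have "rdet k (mix j vs C) = rdet k (\<lambda>i l. \<Sum>s<k. M i s * mix j vs' C s l)"
    proof (rule rdet_cong)
      fix i l assume il: "i < k" "l < k"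
      show "mix j vs C i l = (\<Sum>s<k. M i s * mix j vs' C s l)"
      proof (cases "i < j")
        case True
        have "(\<Sum>s<k. M i s * mix j vs' C s l) = (\<Sum>s<j. M i s * mix j vs' C s l)"
          by (rule sum.mono_neutral_right) (use assms(3) True in \<open>auto simp: M_def\<close>)
        also have "\<dots> = (\<Sum>s<j. a i s * vs' s l)" by (rule sum.cong) (use True in \<open>auto simp: M_def mix_def\<close>)
        finally show ?thesis using a[OF True il(2)] True by (simp add: mix_def)
      next
        case False
        then have "(\<Sum>s<k. M i s * mix j vs' C s l) = (\<Sum>s<k. if s = i then C i l else 0)"
          by (intro sum.cong) (auto simp: M_def mix_def)
        then show ?thesis using False il by (simp add: mix_def)
      qed
    qed
    then show ?thesis using rdet_mult by simp
  qed
  have "rdet k M \<noteq> 0" using assms(1) e by (auto simp: lindep_def)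
  then show ?thesis using e by blast
qed

lemma lspan_eqI:
  assumes "c0 \<noteq> 0" "\<And>C. rdet k (mix j vs C) = c0 * rdet k (mix j vs' C)"
  shows "lspan k j vs = lspan k j vs'"
  unfolding lspan_def using assms by simp

section \<open>Covolumes of rational subspaces\<close>

definition unitv :: "nat \<Rightarrow> nat \<Rightarrow> real" where
  "unitv i = (\<lambda>j. if i = j then 1 else 0)"

text \<open>
  The norm of the exterior product of the rows of \<open>vs\<close>, in the coordinates dual to the frame \<open>c\<close>:
  completing \<open>vs\<close> by members of the frame keeps all determinants of size \<open>k\<close>.
\<close>

definition covol :: "nat \<Rightarrow> (nat \<Rightarrow> nat \<Rightarrow> real) \<Rightarrow> nat \<Rightarrow> (nat \<Rightarrow> nat \<Rightarrow> real) \<Rightarrow> real" where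
  "covol k c j vs = Max ((\<lambda>J. \<bar>rdet k (mix j vs (\<lambda>t. c (J t)))\<bar>) ` ({j..<k} \<rightarrow>\<^sub>E {..<k}))"

lemma finite_completions: "finite ({j..<k} \<rightarrow>\<^sub>E {..<k::nat})"
  by (intro finite_PiE) auto

lemma completions_nonempty: "{j..<k} \<rightarrow>\<^sub>E {..<k::nat} \<noteq> {}"
  by (auto simp: PiE_eq_empty_iff)

lemma covol_ge: "J \<in> {j..<k} \<rightarrow>\<^sub>E {..<k} \<Longrightarrow> \<bar>rdet k (mix j vs (\<lambda>t. c (J t)))\<bar> \<le> covol k c j vs"
  unfolding covol_def using finite_completions by (intro Max_ge) auto

lemma covol_attained: "\<exists>J\<in>{j..<k} \<rightarrow>\<^sub>E {..<k}. covol k c j vs = \<bar>rdet k (mix j vs (\<lambda>t. c (J t)))\<bar>"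
proof -
  have "covol k c j vs \<in> (\<lambda>J. \<bar>rdet k (mix j vs (\<lambda>t. c (J t)))\<bar>) ` ({j..<k} \<rightarrow>\<^sub>E {..<k})"
    unfolding covol_def by (rule Max_in) (use finite_completions completions_nonempty in auto)
  then show ?thesis by auto
qed

lemma covol_nonneg: "0 \<le> covol k c j vs"
  using covol_attained[where c = c and k = k and j = j and vs = vs] by auto

lemma covol_scale:
  assumes "\<And>C. rdet k (mix j vs C) = c0 * rdet k (mix j vs' C)"
  shows "covol k c j vs = \<bar>c0\<bar> * covol k c j vs'"
proof (rule antisym)
  obtain J where J: "J \<in> {j..<k} \<rightarrow>\<^sub>E {..<k}" "covol k c j vs = \<bar>rdet k (mix j vs (\<lambda>t. c (J t)))\<bar>"
    using covol_attained by blast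
  show "covol k c j vs \<le> \<bar>c0\<bar> * covol k c j vs'"
    unfolding J(2) assms abs_mult using covol_ge[OF J(1)] by (intro mult_left_mono) auto
next
  obtain J where J: "J \<in> {j..<k} \<rightarrow>\<^sub>E {..<k}" "covol k c j vs' = \<bar>rdet k (mix j vs' (\<lambda>t. c (J t)))\<bar>"
    using covol_attained by blast
  show "\<bar>c0\<bar> * covol k c j vs' \<le> covol k c j vs"
    unfolding J(2) abs_mult[symmetric] assms[symmetric] by (rule covol_ge[OF J(1)])
qed

lemma rdet_mix_cong:
  assumes "\<And>t i. j \<le> t \<Longrightarrow> t < k \<Longrightarrow> i < k \<Longrightarrow> C t i = C' t i"
  shows "rdet k (mix j vs C) = rdet k (mix j vs C')"
  by (rule rdet_cong) (use assms in \<open>auto simp: mix_def\<close>)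

lemma rdet_mix_expand:
  assumes "\<And>t i. j \<le> t \<Longrightarrow> t < k \<Longrightarrow> i < k \<Longrightarrow> C t i = (\<Sum>l<k. A t l * c l i)"
  shows "rdet k (mix j vs C) =
    (\<Sum>J\<in>{j..<k} \<rightarrow>\<^sub>E {..<k}. (\<Prod>t\<in>{j..<k}. A t (J t)) * rdet k (mix j vs (\<lambda>t. c (J t))))"
proof -
  have "rdet k (mix j vs C) = rdet k (\<lambda>t. if t \<in> {j..<k} then (\<lambda>i. \<Sum>l<k. A t l * c l i) else vs t)"
    by (rule rdet_cong) (use assms in \<open>auto simp: mix_def\<close>)
  also have "\<dots> = (\<Sum>J\<in>{j..<k} \<rightarrow>\<^sub>E {..<k}. (\<Prod>t\<in>{j..<k}. A t (J t)) *
      rdet k (\<lambda>t. if t \<in> {j..<k} then c (J t) else vs t))"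
    by (rule rdet_rows_sum) auto
  also have "\<dots> = (\<Sum>J\<in>{j..<k} \<rightarrow>\<^sub>E {..<k}. (\<Prod>t\<in>{j..<k}. A t (J t)) * rdet k (mix j vs (\<lambda>t. c (J t))))"
    by (intro sum.cong refl arg_cong2[of _ _ _ _ "(*)"] rdet_cong) (auto simp: mix_def)
  finally show ?thesis .
qed

lemma unitv_expand: "i < k \<Longrightarrow> (v :: nat \<Rightarrow> real) i = (\<Sum>l<k. v l * unitv l i)"
  by (simp add: unitv_def if_distrib cong: if_cong)

lemma rdet_mix_unitv_expand:
  "rdet k (mix j vs C) =
    (\<Sum>J\<in>{j..<k} \<rightarrow>\<^sub>E {..<k}. (\<Prod>t\<in>{j..<k}. C t (J t)) * rdet k (mix j vs (\<lambda>t. unitv (J t))))"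
  by (rule rdet_mix_expand) (rule unitv_expand)

lemma covol_unitv_pos:
  assumes "\<not> lindep k j vs"
  shows "covol k unitv j vs > 0"
proof (rule ccontr)
  assume "\<not> ?thesis"
  then have "covol k unitv j vs = 0" using covol_nonneg[of k unitv j vs] by simp
  then have z: "rdet k (mix j vs (\<lambda>t. unitv (J t))) = 0" if "J \<in> {j..<k} \<rightarrow>\<^sub>E {..<k}" for J
    using covol_ge[OF that, of vs unitv] by simp
  have "rdet k (mix j vs C) = 0" for C
    unfolding rdet_mix_unitv_expand[of k j vs C] using z by simp
  then show False using assms by (simp add: lindep_def)
qed

text \<open>The completions by unit vectors are the Pluecker coordinates, and all other completions
  are linear combinations of them.\<close>

lemma mix_eq_from_unitv:
  assumes "\<And>J. J \<in> {j..<k} \<rightarrow>\<^sub>E {..<k} \<Longrightarrow>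
    rdet k (mix j vs (\<lambda>t. unitv (J t))) = rdet k (mix j vs' (\<lambda>t. unitv (J t)))"
  shows "rdet k (mix j vs C) = rdet k (mix j vs' C)"
  unfolding rdet_mix_unitv_expand[of k j _ C] using assms by simp

text \<open>Serves to turn a bound in the frame at one fixed point into a bound on integer minors,
  so \<open>K\<close> may depend on the frame.\<close>

lemma covol_change_frame:
  assumes "rdet k c \<noteq> 0"
  shows "\<exists>K. \<forall>vs. covol k unitv j vs \<le> K * covol k c j vs"
proof -
  have "\<forall>l. \<exists>a. \<forall>i<k. unitv l i = (\<Sum>t<k. a t * c t i)" using rdet_solve[OF assms] by blast
  from choice[OF this] obtain a where a: "\<And>l i. i < k \<Longrightarrow> unitv l i = (\<Sum>t<k. a l t * c t i)" by blast
  define K where "K = (\<Sum>J'\<in>{j..<k} \<rightarrow>\<^sub>E {..<k}. \<Sum>J\<in>{j..<k} \<rightarrow>\<^sub>E {..<k}. \<bar>\<Prod>t\<in>{j..<k}. a (J' t) (J t)\<bar>)"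
  have "covol k unitv j vs \<le> K * covol k c j vs" for vs
  proof -
    obtain J' where J': "J' \<in> {j..<k} \<rightarrow>\<^sub>E {..<k}" "covol k unitv j vs = \<bar>rdet k (mix j vs (\<lambda>t. unitv (J' t)))\<bar>"
      using covol_attained by blast
    have ex: "rdet k (mix j vs (\<lambda>t. unitv (J' t))) =
       (\<Sum>J\<in>{j..<k} \<rightarrow>\<^sub>E {..<k}. (\<Prod>t\<in>{j..<k}. a (J' t) (J t)) * rdet k (mix j vs (\<lambda>t. c (J t))))"
      by (rule rdet_mix_expand) (rule a)
    have "covol k unitv j vs \<le> (\<Sum>J\<in>{j..<k} \<rightarrow>\<^sub>E {..<k}. \<bar>(\<Prod>t\<in>{j..<k}. a (J' t) (J t)) * rdet k (mix j vs (\<lambda>t. c (J t)))\<bar>)"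
      unfolding J'(2) ex by (rule sum_abs)
    also have "\<dots> \<le> (\<Sum>J\<in>{j..<k} \<rightarrow>\<^sub>E {..<k}. \<bar>\<Prod>t\<in>{j..<k}. a (J' t) (J t)\<bar> * covol k c j vs)"
      unfolding abs_mult by (intro sum_mono mult_left_mono covol_ge) auto
    also have "\<dots> = (\<Sum>J\<in>{j..<k} \<rightarrow>\<^sub>E {..<k}. \<bar>\<Prod>t\<in>{j..<k}. a (J' t) (J t)\<bar>) * covol k c j vs"
      by (simp add: sum_distrib_right)
    also have "\<dots> \<le> K * covol k c j vs"
      unfolding K_def
      by (intro mult_right_mono covol_nonneg
           member_le_sum[where f = "\<lambda>J'. \<Sum>J\<in>{j..<k} \<rightarrow>\<^sub>E {..<k}. \<bar>\<Prod>t\<in>{j..<k}. a (J' t) (J t)\<bar>"])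
         (use J' finite_completions in \<open>auto intro: sum_nonneg\<close>)
    finally show ?thesis .
  qed
  then show ?thesis by blast
qed

text \<open>Linearity in row \<open>j\<close>: with a member of the frame in that row the
  determinant is one of those counted by \<open>covol k c j vs\<close>.\<close>

lemma covol_add_vector:
  assumes "j < k" "\<And>i. i < k \<Longrightarrow> v i = (\<Sum>l<k. x l * c l i)"
  shows "covol k c (Suc j) (vs(j := v)) \<le> (\<Sum>l<k. \<bar>x l\<bar>) * covol k c j vs"
proof -
  obtain J where J: "J \<in> {Suc j..<k} \<rightarrow>\<^sub>E {..<k}"
      "covol k c (Suc j) (vs(j := v)) = \<bar>rdet k (mix (Suc j) (vs(j := v)) (\<lambda>t. c (J t)))\<bar>"
    using covol_attained by blast
  have ex: "rdet k (mix (Suc j) (vs(j := v)) (\<lambda>t. c (J t))) = (\<Sum>l<k. x l * rdet k ((mix j vs (\<lambda>t. c (J t)))(j := c l)))"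
    unfolding mix_Suc by (rule rdet_row_lincomb[OF assms])
  have "covol k c (Suc j) (vs(j := v)) \<le> (\<Sum>l<k. \<bar>x l * rdet k ((mix j vs (\<lambda>t. c (J t)))(j := c l))\<bar>)"
    unfolding J(2) ex by (rule sum_abs)
  also have "\<dots> \<le> (\<Sum>l<k. \<bar>x l\<bar> * covol k c j vs)"
    unfolding abs_mult
  proof (intro sum_mono mult_left_mono)
    fix l assume l: "l \<in> {..<k}"
    have J': "J(j := l) \<in> {j..<k} \<rightarrow>\<^sub>E {..<k}"
      using J(1) l assms(1) by (auto simp: PiE_iff extensional_def)
    have e: "(mix j vs (\<lambda>t. c (J t)))(j := c l) = mix j vs (\<lambda>t. c ((J(j := l)) t))"
      by (auto simp: mix_def)
    show "\<bar>rdet k ((mix j vs (\<lambda>t. c (J t)))(j := c l))\<bar> \<le> covol k c j vs"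
      unfolding e by (rule covol_ge[OF J'])
  qed auto
  finally show ?thesis by (simp add: sum_distrib_right)
qed

text \<open>With no vectors kept, the minor is the determinant of a matrix of zeros and ones times
  that of the frame. This is the covolume of the zero subspace, up to the constant
  \<open>fact k\<close>.\<close>

lemma covol_0_le:
  assumes "\<bar>rdet k c\<bar> \<le> 1"
  shows "covol k c 0 vs \<le> fact k"
proof -
  obtain J where J: "J \<in> {0..<k} \<rightarrow>\<^sub>E {..<k}" "covol k c 0 vs = \<bar>rdet k (mix 0 vs (\<lambda>t. c (J t)))\<bar>"
    using covol_attained by blast
  have "rdet k (mix 0 vs (\<lambda>t. c (J t))) = rdet k (\<lambda>i l. \<Sum>s<k. unitv (J i) s * c s l)"
  proof (rule rdet_cong)
    fix i l assume "i < k" "l < k"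
    then have "J i < k" using J(1) by auto
    then show "mix 0 vs (\<lambda>t. c (J t)) i l = (\<Sum>s<k. unitv (J i) s * c s l)"
      by (simp add: mix_def unitv_def if_distrib[of "\<lambda>x. x * _"] cong: if_cong)
  qed
  also have "\<dots> = rdet k (\<lambda>i. unitv (J i)) * rdet k c" by (rule rdet_mult)
  finally have "covol k c 0 vs = \<bar>rdet k (\<lambda>i. unitv (J i))\<bar> * \<bar>rdet k c\<bar>" by (simp add: J(2) abs_mult)
  also have "\<dots> \<le> fact k * 1"
    by (intro mult_mono rdet_le_fact assms) (auto simp: unitv_def)
  finally show ?thesis by simp
qed

section \<open>Rational subspaces and their integer bases\<close>

definition integral_tuple :: "nat \<Rightarrow> nat \<Rightarrow> (nat \<Rightarrow> nat \<Rightarrow> real) \<Rightarrow> bool" where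
  "integral_tuple k j vs \<longleftrightarrow> (\<forall>t<j. \<forall>i<k. vs t i \<in> \<int>)"

definition spans :: "nat \<Rightarrow> nat \<times> (nat \<Rightarrow> real) set \<Rightarrow> (nat \<Rightarrow> nat \<Rightarrow> real) \<Rightarrow> bool" where
  "spans k p vs \<longleftrightarrow> integral_tuple k (fst p) vs \<and> \<not> lindep k (fst p) vs \<and> lspan k (fst p) vs = snd p"

text \<open>Proper nonzero subspaces only. The dimension is part of the pair because it serves as
  the rank in the induction on marked points.\<close>

definition subspaces :: "nat \<Rightarrow> (nat \<times> (nat \<Rightarrow> real) set) set" where
  "subspaces k = {p. 1 \<le> fst p \<and> fst p < k \<and> (\<exists>vs. spans k p vs)}"

text \<open>
  It plays the part of a basis of the lattice of integer points of the subspace.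
\<close>

definition minimal_tuple :: "nat \<Rightarrow> nat \<times> (nat \<Rightarrow> real) set \<Rightarrow> nat \<Rightarrow> nat \<Rightarrow> real" where
  "minimal_tuple k p = (SOME vs. spans k p vs \<and>
     (\<forall>vs'. spans k p vs' \<longrightarrow> covol k unitv (fst p) vs \<le> covol k unitv (fst p) vs'))"

definition subspace_covol :: "nat \<Rightarrow> (nat \<Rightarrow> nat \<Rightarrow> real) \<Rightarrow> nat \<times> (nat \<Rightarrow> real) set \<Rightarrow> real" where
  "subspace_covol k c p = covol k c (fst p) (minimal_tuple k p)"

lemma integral_mix_unitv:
  "integral_tuple k j vs \<Longrightarrow> rdet k (mix j vs (\<lambda>t. unitv (J t))) \<in> \<int>"
  by (intro rdet_in_Ints) (auto simp: mix_def integral_tuple_def unitv_def)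

lemma covol_unitv_ge_1:
  assumes "integral_tuple k j vs" "\<not> lindep k j vs"
  shows "1 \<le> covol k unitv j vs"
proof -
  obtain J where J: "J \<in> {j..<k} \<rightarrow>\<^sub>E {..<k}" "covol k unitv j vs = \<bar>rdet k (mix j vs (\<lambda>t. unitv (J t)))\<bar>"
    using covol_attained by blast
  have "rdet k (mix j vs (\<lambda>t. unitv (J t))) \<in> \<int>" by (rule integral_mix_unitv[OF assms(1)])
  moreover have "rdet k (mix j vs (\<lambda>t. unitv (J t))) \<noteq> 0" using covol_unitv_pos[OF assms(2)] J by auto
  ultimately show ?thesis unfolding J(2) by (rule Ints_nonzero_abs_ge1)
qed

text \<open>Minors of integral tuples are integers, so in the standard frame these covolumes are
  natural numbers and a least one is attained.\<close>

lemma minimal_tuple_exists: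
  assumes "p \<in> subspaces k"
  shows "spans k p (minimal_tuple k p)"
    and "spans k p vs' \<Longrightarrow> covol k unitv (fst p) (minimal_tuple k p) \<le> covol k unitv (fst p) vs'"
proof -
  obtain vs where vs: "spans k p vs" using assms by (auto simp: subspaces_def)
  define h where "h vs = nat \<lfloor>covol k unitv (fst p) vs\<rfloor>" for vs
  obtain v0 where v0: "spans k p v0" "\<And>vs'. spans k p vs' \<Longrightarrow> h v0 \<le> h vs'"
    using ex_has_least_nat[of "spans k p" vs h] vs by blast
  have int: "covol k unitv (fst p) vs = real (h vs)" if "spans k p vs" for vs
  proof -
    obtain J where J: "J \<in> {fst p..<k} \<rightarrow>\<^sub>E {..<k}"
        "covol k unitv (fst p) vs = \<bar>rdet k (mix (fst p) vs (\<lambda>t. unitv (J t)))\<bar>"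
      using covol_attained by blast
    have "covol k unitv (fst p) vs \<in> \<int>"
      unfolding J(2) using integral_mix_unitv that by (auto simp: spans_def intro: Ints_abs)
    then show ?thesis using covol_nonneg[of k unitv "fst p" vs] by (auto simp: h_def elim!: Ints_cases)
  qed
  have "spans k p v0 \<and> (\<forall>vs'. spans k p vs' \<longrightarrow> covol k unitv (fst p) v0 \<le> covol k unitv (fst p) vs')"
    using v0 int by simp
  then have "spans k p (minimal_tuple k p) \<and> (\<forall>vs'. spans k p vs' \<longrightarrow>
      covol k unitv (fst p) (minimal_tuple k p) \<le> covol k unitv (fst p) vs')"
    unfolding minimal_tuple_def
    by (rule someI[where P = "\<lambda>vs. spans k p vs \<and>
      (\<forall>vs'. spans k p vs' \<longrightarrow> covol k unitv (fst p) vs \<le> covol k unitv (fst p) vs')"])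
  then show "spans k p (minimal_tuple k p)"
    "spans k p vs' \<Longrightarrow> covol k unitv (fst p) (minimal_tuple k p) \<le> covol k unitv (fst p) vs'" by blast+
qed

text \<open>Minimality was required in the standard frame, but the ratio of the covolumes of two
  bases of a subspace is the same number \<open>\<bar>c0\<bar>\<close> in every frame; hence the
  minimal tuple is minimal in the moving frame too.\<close>

lemma subspace_covol_le:
  assumes "p \<in> subspaces k" "spans k p vs"
  shows "subspace_covol k c p \<le> covol k c (fst p) vs"
proof -
  define j where "j = fst p"
  define ms where "ms = minimal_tuple k p"
  have jk: "j < k" using assms(1) by (simp add: subspaces_def j_def)
  have ms: "spans k p ms" unfolding ms_def by (rule minimal_tuple_exists[OF assms(1)])
  have "ms t \<in> lspan k j vs" if "t < j" for t
    using lspan_base[OF jk that, of ms] ms assms(2) by (simp add: spans_def j_def)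
  then obtain c0 where c0: "\<And>C. rdet k (mix j ms C) = c0 * rdet k (mix j vs C)"
    using rdet_mix_proportional[of k j ms vs] ms assms(2) jk by (auto simp: spans_def j_def)
  have "covol k unitv j ms \<le> covol k unitv j vs"
    unfolding ms_def j_def by (rule minimal_tuple_exists(2)[OF assms])
  then have "\<bar>c0\<bar> * covol k unitv j vs \<le> 1 * covol k unitv j vs" using covol_scale[OF c0] by simp
  moreover have "covol k unitv j vs > 0" using covol_unitv_pos assms(2) by (simp add: spans_def j_def)
  ultimately have "\<bar>c0\<bar> \<le> 1" by simp
  then have "covol k c j ms \<le> covol k c j vs"
    using covol_scale[OF c0, of c] mult_right_mono[of "\<bar>c0\<bar>" 1 "covol k c j vs"] covol_nonneg by simp
  then show ?thesis by (simp add: subspace_covol_def ms_def j_def)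
qed

section \<open>Flags of subspaces and short vectors\<close>

definition comparable :: "nat \<times> 'a set \<Rightarrow> nat \<times> 'a set \<Rightarrow> bool" where
  "comparable p q \<longleftrightarrow> snd p \<subseteq> snd q \<or> snd q \<subseteq> snd p"

lemma subspaces_subset_eq:
  assumes "p \<in> subspaces k" "q \<in> subspaces k" "fst p = fst q" "snd p \<subseteq> snd q"
  shows "p = q"
proof -
  obtain vs vs' where v: "spans k p vs" "spans k q vs'" using assms by (auto simp: subspaces_def)
  have jk: "fst p < k" using assms(1) by (simp add: subspaces_def)
  have "vs t \<in> lspan k (fst p) vs'" if "t < fst p" for t
    using lspan_base[OF jk that, of vs] v assms by (auto simp: spans_def)
  then obtain c0 where "c0 \<noteq> 0" "\<And>C. rdet k (mix (fst p) vs C) = c0 * rdet k (mix (fst p) vs' C)"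
    using rdet_mix_proportional[of k "fst p" vs vs'] v jk assms(3) by (auto simp: spans_def)
  then have "lspan k (fst p) vs = lspan k (fst p) vs'" by (rule lspan_eqI)
  then show ?thesis using v assms(3) by (auto simp: spans_def prod_eq_iff)
qed

lemma comparable_same_dim:
  assumes "p \<in> subspaces k" "q \<in> subspaces k" "comparable p q" "fst p = fst q"
  shows "p = q"
  using assms subspaces_subset_eq[of p k q] subspaces_subset_eq[of q k p] by (auto simp: comparable_def)

text \<open>In each dimension a subspace is determined by the Pluecker coordinates of its minimal
  tuple. These are integers, bounded by a constant of the frame when the covolume is below
  1.\<close>

lemma finite_small_subspaces:
  assumes "rdet k c \<noteq> 0"
  shows "finite {p \<in> subspaces k. subspace_covol k c p < 1}"
proof -
  define S where "S j = {p \<in> subspaces k. subspace_covol k c p < 1 \<and> fst p = j}" for j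
  have "finite (S j)" for j
  proof -
    obtain K where K: "\<And>vs. covol k unitv j vs \<le> K * covol k c j vs" using covol_change_frame[OF assms] by blast
    define g where "g p = (\<lambda>J\<in>{j..<k} \<rightarrow>\<^sub>E {..<k}. \<lfloor>rdet k (mix j (minimal_tuple k p) (\<lambda>t. unitv (J t)))\<rfloor>)" for p
    have gi: "real_of_int \<lfloor>rdet k (mix j (minimal_tuple k p) (\<lambda>t. unitv (J t)))\<rfloor> =
        rdet k (mix j (minimal_tuple k p) (\<lambda>t. unitv (J t)))" if "p \<in> S j" for p J
    proof -
      have "rdet k (mix j (minimal_tuple k p) (\<lambda>t. unitv (J t))) \<in> \<int>"
        using minimal_tuple_exists(1)[of p k] that integral_mix_unitv by (auto simp: S_def spans_def)
      then show ?thesis by (auto elim: Ints_cases)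
    qed
    have "g ` S j \<subseteq> ({j..<k} \<rightarrow>\<^sub>E {..<k}) \<rightarrow>\<^sub>E {- \<lceil>\<bar>K\<bar>\<rceil>..\<lceil>\<bar>K\<bar>\<rceil>}"
    proof
      fix y assume "y \<in> g ` S j"
      then obtain p where p: "p \<in> S j" "y = g p" by blast
      have "\<bar>rdet k (mix j (minimal_tuple k p) (\<lambda>t. unitv (J t)))\<bar> \<le> \<bar>K\<bar>" if "J \<in> {j..<k} \<rightarrow>\<^sub>E {..<k}" for J
      proof -
        have "covol k c j (minimal_tuple k p) \<le> 1" using p by (auto simp: S_def subspace_covol_def)
        then have "K * covol k c j (minimal_tuple k p) \<le> \<bar>K\<bar> * 1"
          using covol_nonneg[of k c j] by (intro mult_mono) auto
        then show ?thesis using covol_ge[OF that, of "minimal_tuple k p" unitv] K[of "minimal_tuple k p"] by linarith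
      qed
      note bd = this
      have "\<bar>\<lfloor>rdet k (mix j (minimal_tuple k p) (\<lambda>t. unitv (J t)))\<rfloor>\<bar> \<le> \<lceil>\<bar>K\<bar>\<rceil>" if "J \<in> {j..<k} \<rightarrow>\<^sub>E {..<k}" for J
      proof -
        have "real_of_int \<bar>\<lfloor>rdet k (mix j (minimal_tuple k p) (\<lambda>t. unitv (J t)))\<rfloor>\<bar> \<le> \<bar>K\<bar>"
          unfolding of_int_abs gi[OF p(1), of J] by (rule bd[OF that])
        also have "\<dots> \<le> real_of_int \<lceil>\<bar>K\<bar>\<rceil>" by (rule le_of_int_ceiling)
        finally show ?thesis by (simp only: of_int_le_iff)
      qed
      then show "y \<in> ({j..<k} \<rightarrow>\<^sub>E {..<k}) \<rightarrow>\<^sub>E {- \<lceil>\<bar>K\<bar>\<rceil>..\<lceil>\<bar>K\<bar>\<rceil>}"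
        unfolding p(2) g_def by (intro restrict_PiE_iff[THEN iffD2] ballI) (force simp: abs_le_iff)
    qed
    then have fin: "finite (g ` S j)" by (rule finite_subset) (intro finite_PiE finite_completions, auto)
    have "inj_on g (S j)"
    proof (rule inj_onI)
      fix p q assume p: "p \<in> S j" and q: "q \<in> S j" and e: "g p = g q"
      have "rdet k (mix j (minimal_tuple k p) (\<lambda>t. unitv (J t))) = rdet k (mix j (minimal_tuple k q) (\<lambda>t. unitv (J t)))"
        if "J \<in> {j..<k} \<rightarrow>\<^sub>E {..<k}" for J
      proof -
        have "\<lfloor>rdet k (mix j (minimal_tuple k p) (\<lambda>t. unitv (J t)))\<rfloor> =
            \<lfloor>rdet k (mix j (minimal_tuple k q) (\<lambda>t. unitv (J t)))\<rfloor>"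
          using fun_cong[OF e, of J] that by (simp add: g_def)
        from trans[OF gi[OF p, of J, symmetric] trans[OF arg_cong[where f = real_of_int, OF this] gi[OF q, of J]]]
        show ?thesis .
      qed
      then have "rdet k (mix j (minimal_tuple k p) C) = rdet k (mix j (minimal_tuple k q) C)" for C
        by (rule mix_eq_from_unitv)
      then have "rdet k (mix j (minimal_tuple k p) C) = 1 * rdet k (mix j (minimal_tuple k q) C)" for C
        by simp
      then have "lspan k j (minimal_tuple k p) = lspan k j (minimal_tuple k q)"
        by (rule lspan_eqI[rotated]) simp
      then have "snd p = snd q"
        using minimal_tuple_exists(1)[of p k] minimal_tuple_exists(1)[of q k] p q by (simp add: S_def spans_def)
      then show "p = q" using p q by (simp add: S_def prod_eq_iff)
    qed
    then show ?thesis using fin finite_imageD by blast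
  qed
  moreover have "{p \<in> subspaces k. subspace_covol k c p < 1} \<subseteq> (\<Union>j<k. S j)"
    by (auto simp: S_def subspaces_def)
  ultimately show ?thesis by (meson finite_UN_I finite_lessThan finite_subset)
qed

text \<open>
  Adding a short integer vector \<open>v\<close> to the largest member of the flag that does not contain it gives
  a subspace comparable with the whole flag, whose covolume is bounded below.
\<close>

lemma marked_no_short_vector:
  assumes mk: "marks comparable (\<lambda>p x. subspace_covol k (c x) p) \<epsilon> (subspaces k) F x"
    and \<epsilon>: "0 < \<epsilon>" "\<epsilon> \<le> 1" and det: "\<bar>rdet k (c x)\<bar> \<le> 1" and det0: "rdet k (c x) \<noteq> 0"
    and v: "\<And>i. i < k \<Longrightarrow> v i \<in> \<int>" "\<And>i. i < k \<Longrightarrow> v i = (\<Sum>l<k. z l * c x l i)" and nz: "i0 < k" "v i0 \<noteq> 0"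
  shows "\<epsilon> \<le> fact k * (\<Sum>l<k. \<bar>z l\<bar>)"
proof -
  define F' where "F' = {p \<in> F. v \<notin> snd p}"
  have F: "finite F" "F \<subseteq> subspaces k" "\<And>p q. p \<in> F \<Longrightarrow> q \<in> F \<Longrightarrow> comparable p q"
    "\<And>p. p \<in> F \<Longrightarrow> \<epsilon> \<le> subspace_covol k (c x) p" "\<And>p. p \<in> F \<Longrightarrow> subspace_covol k (c x) p < 1"
    "\<And>q. q \<in> subspaces k \<Longrightarrow> q \<notin> F \<Longrightarrow> \<forall>p\<in>F. comparable p q \<Longrightarrow> 1 \<le> subspace_covol k (c x) q"
    using mk by (auto simp: marks_def)
  have f1: "(1::real) \<le> fact k" by (rule fact_ge_1)
  have "\<exists>j vs. j < k \<and> integral_tuple k j vs \<and> \<not> lindep k j vs \<and> v \<notin> lspan k j vs \<and>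
     covol k (c x) j vs \<le> fact k \<and> (\<forall>q\<in>F'. snd q \<subseteq> lspan k j vs) \<and> (\<forall>q\<in>F. v \<in> snd q \<longrightarrow> (\<forall>t<j. vs t \<in> snd q))"
  proof (cases "F' = {}")
    \<comment> \<open>Every member of the flag contains \<open>v\<close>; the zero subspace, with no
      row of \<open>unitv\<close> kept, takes the place of the largest member missing it.\<close>
    case True
    have nl: "\<not> lindep k 0 unitv"
      using rdet_identity[of k] unfolding lindep_def mix_def unitv_def[abs_def] by (auto intro!: exI[of _ unitv] simp: unitv_def[abs_def])
    have "v \<notin> lspan k 0 unitv"
    proof
      assume "v \<in> lspan k 0 unitv"
      then show False using lspan_lincomb[OF nl, of v] nz by auto
    qed
    then show ?thesis using True nz(1) covol_0_le[OF det, of unitv] nl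
      by (intro exI[of _ 0] exI[of _ unitv]) (auto simp: integral_tuple_def)
  next
    case False
    then have "finite (snd ` F')" "snd ` F' \<noteq> {}" using F(1) by (auto simp: F'_def)
    then obtain V where V: "V \<in> snd ` F'" "\<And>b. b \<in> snd ` F' \<Longrightarrow> V \<subseteq> b \<Longrightarrow> V = b"
      using finite_has_maximal[of "snd ` F'"] by blast
    then obtain p where p: "p \<in> F'" "V = snd p" by blast
    have pF: "p \<in> F" "p \<in> subspaces k" "v \<notin> snd p" using p F(2) by (auto simp: F'_def)
    define vs where "vs = minimal_tuple k p"
    have vs: "spans k p vs" unfolding vs_def by (rule minimal_tuple_exists[OF pF(2)])
    have jk: "fst p < k" using pF by (simp add: subspaces_def)
    have "snd q \<subseteq> snd p" if "q \<in> F'" for q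
      using V(2)[of "snd q"] p that F(3)[of p q] pF by (auto simp: comparable_def F'_def)
    moreover have "vs t \<in> snd q" if "q \<in> F" "v \<in> snd q" "t < fst p" for q t
    proof -
      have "snd p \<subseteq> snd q" using F(3)[OF pF(1) that(1)] pF(3) that(2) by (auto simp: comparable_def)
      then show ?thesis using lspan_base[OF jk that(3), of vs] vs by (auto simp: spans_def)
    qed
    moreover have "covol k (c x) (fst p) vs \<le> fact k"
      using F(5)[OF pF(1)] f1 unfolding subspace_covol_def vs_def by linarith
    ultimately show ?thesis using vs jk pF by (intro exI[of _ "fst p"] exI[of _ vs]) (auto simp: spans_def)
  qed
  then obtain j vs where jk: "j < k" and vs: "integral_tuple k j vs" "\<not> lindep k j vs" "v \<notin> lspan k j vs"
    and cv: "covol k (c x) j vs \<le> fact k" and up: "\<And>q. q \<in> F' \<Longrightarrow> snd q \<subseteq> lspan k j vs"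
    and dn: "\<And>q t. q \<in> F \<Longrightarrow> v \<in> snd q \<Longrightarrow> t < j \<Longrightarrow> vs t \<in> snd q" by blast
  define vs' where "vs' = vs(j := v)"
  have int: "integral_tuple k (Suc j) vs'" using vs(1) v(1) by (auto simp: integral_tuple_def vs'_def less_Suc_eq)
  have ind: "\<not> lindep k (Suc j) vs'"
    using vs(3) unfolding lspan_def lindep_def vs'_def mix_Suc mix_upd by blast
  have "covol k (c x) (Suc j) vs' \<le> (\<Sum>l<k. \<bar>z l\<bar>) * covol k (c x) j vs"
    unfolding vs'_def by (rule covol_add_vector[OF jk v(2)])
  also have "\<dots> \<le> (\<Sum>l<k. \<bar>z l\<bar>) * fact k" using cv by (intro mult_left_mono sum_nonneg) auto
  finally have le: "covol k (c x) (Suc j) vs' \<le> fact k * (\<Sum>l<k. \<bar>z l\<bar>)" by (simp add: mult.commute)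
  have "\<epsilon> \<le> covol k (c x) (Suc j) vs'"
  proof (cases "Suc j = k")
    \<comment> \<open>In full dimension no row is left to complete with, and the covolume is the
      modulus of a nonzero integer determinant.\<close>
    case True
    have e: "rdet k (mix (Suc j) vs' C) = rdet k (mix (Suc j) vs' C')" for C C'
      by (rule rdet_mix_cong) (use True in auto)
    have "covol k (c x) (Suc j) vs' = covol k unitv (Suc j) vs'"
      unfolding covol_def by (intro arg_cong[where f = Max] image_cong refl arg_cong[where f = abs] e)
    then show ?thesis using covol_unitv_ge_1[OF int ind] \<epsilon> by linarith
  next
    case False
    then have jk': "Suc j < k" using jk by simp
    define q where "q = (Suc j, lspan k (Suc j) vs')"
    have sq: "spans k q vs'" using int ind by (simp add: spans_def q_def)
    then have q: "q \<in> subspaces k" using jk' unfolding subspaces_def by (auto simp: q_def)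
    have sub: "lspan k j vs \<subseteq> snd q"
    proof
      fix u assume "u \<in> lspan k j vs"
      then obtain a where "\<And>i. i < k \<Longrightarrow> u i = (\<Sum>t<j. a t * vs t i)" using lspan_lincomb[OF vs(2) jk] by blast
      then show "u \<in> snd q" unfolding q_def snd_conv
        by (intro lspanI_lincomb[OF jk', of _ "a(j := 0)"]) (simp add: vs'_def)
    qed
    have "comparable p q" if pF: "p \<in> F" for p
    proof (cases "v \<in> snd p")
      case False
      then have "p \<in> F'" using that by (simp add: F'_def)
      from up[OF this] sub show ?thesis unfolding comparable_def by blast
    next
      case True
      obtain ws where ws: "spans k p ws" "fst p < k" using pF F(2) by (auto simp: subspaces_def)
      have "snd q \<subseteq> snd p"
      proof
        fix u assume "u \<in> snd q"
        then obtain a where a: "\<And>i. i < k \<Longrightarrow> u i = (\<Sum>t<Suc j. a t * vs' t i)"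
          using lspan_lincomb[OF ind jk'] by (auto simp: q_def)
        have "u \<in> lspan k (fst p) ws"
          by (rule lspan_closed[OF ws(2) _ a])
             (use True dn[OF pF True] ws in \<open>auto simp: vs'_def spans_def\<close>)
        then show "u \<in> snd p" using ws by (simp add: spans_def)
      qed
      then show ?thesis by (simp add: comparable_def)
    qed
    then have "\<epsilon> \<le> subspace_covol k (c x) q"
      using F(4)[of q] F(6)[OF q] \<epsilon> by (cases "q \<in> F") force+
    also have "\<dots> \<le> covol k (c x) (Suc j) vs'" using subspace_covol_le[OF q sq] by (simp add: q_def)
    finally show ?thesis .
  qed
  then show ?thesis using le by linarith
qed

section \<open>Lower bounds for covolumes\<close>

text \<open>The sets \<open>V m\<close> are relatively open, being unions over \<open>x\<close> of
  preimages, and they increase with \<open>m\<close>. They cover \<open>K\<close>, so compactness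
  leaves the one of largest index in a finite subcover.\<close>

lemma compact_family_lower_bound:
  fixes h :: "'a::topological_space \<Rightarrow> 'b \<Rightarrow> real"
  assumes "compact K" "\<And>x. x \<in> X \<Longrightarrow> continuous_on K (\<lambda>p. h p x)" "\<And>p. p \<in> K \<Longrightarrow> \<exists>x\<in>X. h p x \<noteq> 0"
  shows "\<exists>c>0. \<forall>p\<in>K. \<exists>x\<in>X. c \<le> \<bar>h p x\<bar>"
proof -
  define V where "V m = {p\<in>K. \<exists>x\<in>X. inverse (real (Suc m)) < \<bar>h p x\<bar>}" for m
  have op: "openin (top_of_set K) (V m)" for m
  proof -
    have "V m = (\<Union>x\<in>X. K \<inter> (\<lambda>p. \<bar>h p x\<bar>) -` {inverse (real (Suc m))<..})" by (auto simp: V_def)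
    moreover have "openin (top_of_set K) (K \<inter> (\<lambda>p. \<bar>h p x\<bar>) -` {inverse (real (Suc m))<..})" if "x \<in> X" for x
      by (rule continuous_openin_preimage_gen) (use assms(2)[OF that] in \<open>auto intro: continuous_intros\<close>)
    ultimately show ?thesis by (simp only:) (intro openin_Union ballI, blast)
  qed
  have "K \<subseteq> \<Union>(range V)"
  proof
    fix p assume p: "p \<in> K"
    then obtain x where x: "x \<in> X" "h p x \<noteq> 0" using assms(3) by blast
    then obtain m where "inverse (real (Suc m)) < \<bar>h p x\<bar>" using reals_Archimedean[of "\<bar>h p x\<bar>"] by auto
    then show "p \<in> \<Union>(range V)" using p x by (auto simp: V_def)
  qed
  then obtain D where D: "D \<subseteq> range V" "finite D" "K \<subseteq> \<Union>D"
    using assms(1)[unfolded compact_eq_openin_cover, THEN spec, of "range V"] op by blast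
  then obtain M where M: "finite M" "D = V ` M" using finite_subset_image[OF D(2,1)] by blast
  define m0 where "m0 = Max (insert 0 M)"
  show ?thesis
  proof (intro exI[of _ "inverse (real (Suc m0))"] conjI ballI)
    fix p assume "p \<in> K"
    then obtain m where m: "m \<in> M" "p \<in> V m" using D M by blast
    then have "m \<le> m0" using M by (simp add: m0_def)
    then have "inverse (real (Suc m0)) \<le> inverse (real (Suc m))" by (intro le_imp_inverse_le) auto
    moreover obtain x where "x \<in> X" "inverse (real (Suc m)) < \<bar>h p x\<bar>" using m(2) by (auto simp: V_def)
    ultimately show "\<exists>x\<in>X. inverse (real (Suc m0)) \<le> \<bar>h p x\<bar>" by (intro bexI[of _ x]) linarith
  qed simp
qed

text \<open>Coefficient vectors are functions on all of \<open>nat\<close>, so this box is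
  infinite-dimensional; it is compact by Tychonoff's theorem, and the finite sums below depend
  continuously on its points.\<close>

definition unit_box :: "(nat \<Rightarrow> real) set" where
  "unit_box = {F. \<forall>i. F i \<in> {-1..1}}"

lemma compact_unit_box: "compact unit_box"
proof -
  have "compactin (product_topology (\<lambda>_. euclidean) UNIV) (PiE UNIV (\<lambda>_::nat. {-1..1::real}))"
    by (simp add: compactin_PiE)
  moreover have "PiE UNIV (\<lambda>_::nat. {-1..1::real}) = unit_box" by (auto simp: unit_box_def PiE_def Pi_def)
  ultimately show ?thesis by (simp add: euclidean_product_topology)
qed

lemma compact_coord_eq: "compact S \<Longrightarrow> compact {F\<in>S. F (l::nat) = (v::real)}"
proof -
  assume S: "compact S"
  have "closed {F. F l = v}" by (intro closed_Collect_eq continuous_on_product_coordinates continuous_on_const)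
  then have "compact (S \<inter> {F. F l = v})" using S by (rule compact_Int_closed[rotated])
  moreover have "S \<inter> {F. F l = v} = {F\<in>S. F l = v}" by auto
  ultimately show ?thesis by simp
qed

text \<open>Independence is demanded on every subinterval because a quotient of two forms can be
  formed only where the denominator does not vanish.\<close>

definition totally_independent :: "nat \<Rightarrow> (nat \<Rightarrow> real \<Rightarrow> real) \<Rightarrow> real \<Rightarrow> real \<Rightarrow> bool" where
  "totally_independent k y a b \<longleftrightarrow> (\<forall>a1 b1 F. a \<le> a1 \<longrightarrow> a1 < b1 \<longrightarrow> b1 \<le> b \<longrightarrow>
     (\<forall>x\<in>{a1..b1}. (\<Sum>i<k. F i * y i x) = 0) \<longrightarrow> (\<forall>i<k. F i = 0))"

text \<open>The normalisation \<open>F l = 1\<close> cuts out of the box a compact set of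
  coefficients that avoids zero. The entries from index \<open>k\<close> on are arbitrary and are
  replaced by zero to land in the box.\<close>

lemma lincomb_lower_bound:
  assumes "totally_independent k y a b" "a < b"
  shows "\<exists>c>0. \<forall>F. (\<forall>i<k. \<bar>F i\<bar> \<le> 1) \<longrightarrow> (\<exists>l<k. F l = 1) \<longrightarrow>
    (\<exists>x\<in>{a..b}. c \<le> \<bar>\<Sum>i<k. F i * y i x\<bar>)"
proof -
  define K where "K = (\<Union>l<k. {F\<in>unit_box. F l = 1})"
  have "compact K" unfolding K_def by (intro compact_UN compact_coord_eq compact_unit_box) auto
  then have "\<exists>c>0. \<forall>F\<in>K. \<exists>x\<in>{a..b}. c \<le> \<bar>\<Sum>i<k. F i * y i x\<bar>"
  proof (rule compact_family_lower_bound)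
    show "continuous_on K (\<lambda>F. \<Sum>i<k. F i * y i x)" for x
      by (intro continuous_on_sum continuous_on_mult continuous_on_const
          continuous_on_subset[OF continuous_on_product_coordinates]) auto
    fix F assume "F \<in> K"
    then obtain l where "l < k" "F l = 1" by (auto simp: K_def)
    then show "\<exists>x\<in>{a..b}. (\<Sum>i<k. F i * y i x) \<noteq> 0"
      using assms(1)[unfolded totally_independent_def, rule_format, of a b F l] assms(2) by force
  qed
  then obtain c where c: "c > 0" "\<And>F. F \<in> K \<Longrightarrow> \<exists>x\<in>{a..b}. c \<le> \<bar>\<Sum>i<k. F i * y i x\<bar>" by blast
  show ?thesis
  proof (intro exI[of _ c] conjI c(1) allI impI)
    fix F :: "nat \<Rightarrow> real" assume F: "\<forall>i<k. \<bar>F i\<bar> \<le> 1" "\<exists>l<k. F l = 1"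
    define F' where "F' i = (if i < k then F i else 0)" for i
    have "F' \<in> K" using F unfolding K_def unit_box_def F'_def by (auto simp: abs_le_iff)
    moreover have "(\<Sum>i<k. F' i * y i x) = (\<Sum>i<k. F i * y i x)" for x
      by (rule sum.cong) (auto simp: F'_def)
    ultimately show "\<exists>x\<in>{a..b}. c \<le> \<bar>\<Sum>i<k. F i * y i x\<bar>" using c(2)[of F'] by simp
  qed
qed

text \<open>If the Wronskian vanished throughout, then \<open>q / p\<close> would equal a constant
  \<open>t\<close> on an interval free of zeros of \<open>p\<close>. There \<open>q - t * p\<close>
  is zero, although its coefficient at \<open>l'\<close> is 1.\<close>

lemma two_forms_wronskian_nonzero:
  assumes ind: "totally_independent k y a b" and ab: "a < b"
    and yd: "\<And>i x. i < k \<Longrightarrow> x \<in> {a..b} \<Longrightarrow> (y i has_real_derivative y' i x) (at x)"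
    and FG: "l < k" "l' < k" "F l = 1" "F l' = 0" "G l = 0" "G l' = 1"
  shows "\<exists>x\<in>{a..b}. (\<Sum>i<k. F i * y i x) * (\<Sum>i<k. G i * y' i x) -
    (\<Sum>i<k. G i * y i x) * (\<Sum>i<k. F i * y' i x) \<noteq> 0"
proof (rule ccontr)
  define p q p' q' where "p x = (\<Sum>i<k. F i * y i x)" and "q x = (\<Sum>i<k. G i * y i x)"
    and "p' x = (\<Sum>i<k. F i * y' i x)" and "q' x = (\<Sum>i<k. G i * y' i x)" for x
  assume "\<not> ?thesis"
  then have z: "p x * q' x - q x * p' x = 0" if "x \<in> {a..b}" for x
    using that by (auto simp: p_def q_def p'_def q'_def)
  have dp: "(p has_real_derivative p' x) (at x)" and dq: "(q has_real_derivative q' x) (at x)" if "x \<in> {a..b}" for x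
    unfolding p_def q_def p'_def q'_def by (intro DERIV_sum DERIV_cmult yd; use that in simp)+
  have "\<exists>x\<in>{a..b}. p x \<noteq> 0"
    using ind[unfolded totally_independent_def, rule_format, of a b F l] ab FG unfolding p_def by force
  then obtain x1 where x1: "x1 \<in> {a..b}" "p x1 \<noteq> 0" by blast
  have "isCont p x1" using dp[OF x1(1)] by (rule DERIV_isCont)
  then obtain r where r: "r > 0" "\<And>x. \<bar>x - x1\<bar> < r \<Longrightarrow> p x \<noteq> 0"
  proof -
    have "eventually (\<lambda>x. p x \<noteq> 0) (at x1)"
      using \<open>isCont p x1\<close> x1(2) unfolding isCont_def by (rule tendsto_imp_eventually_ne)
    then obtain d where d: "d > 0" "\<And>x. x \<noteq> x1 \<Longrightarrow> dist x x1 < d \<Longrightarrow> p x \<noteq> 0"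
      unfolding eventually_at by auto
    have "p x \<noteq> 0" if "\<bar>x - x1\<bar> < d" for x
      using d(2)[of x] x1(2) that by (cases "x = x1") (auto simp: dist_real_def)
    then show ?thesis using that[of d] d(1) by blast
  qed
  define a1 b1 where "a1 = max a (x1 - r / 2)" and "b1 = min b (x1 + r / 2)"
  have ab1: "a \<le> a1" "a1 < b1" "b1 \<le> b" using x1 r(1) ab by (auto simp: a1_def b1_def)
  have near: "x \<in> {a..b}" "p x \<noteq> 0" if "x \<in> {a1..b1}" for x
  proof -
    show "x \<in> {a..b}" using that ab1 by auto
    have "\<bar>x - x1\<bar> < r" using that r(1) x1(1) by (auto simp: a1_def b1_def abs_less_iff)
    then show "p x \<noteq> 0" by (rule r(2))
  qed
  define t where "t = q a1 / p a1"
  have const: "q x / p x = t" if x: "x \<in> {a1..b1}" for x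
  proof -
    have "((\<lambda>x. q x / p x) has_real_derivative 0) (at u within {a1..b1})" if u: "u \<in> {a1..b1}" for u
    proof -
      have "((\<lambda>x. q x / p x) has_real_derivative (q' u * p u - q u * p' u) / (p u * p u)) (at u)"
        by (rule DERIV_divide) (use near[OF u] dp dq in auto)
      moreover have "q' u * p u - q u * p' u = 0" using z[OF near(1)[OF u]] by (simp add: mult.commute)
      ultimately show ?thesis by (simp add: has_field_derivative_at_within)
    qed
    then have "\<exists>c. \<forall>x\<in>{a1..b1}. q x / p x = c"
      by (intro has_field_derivative_zero_constant) auto
    then show ?thesis unfolding t_def using x ab1 by auto
  qed
  have "(\<Sum>i<k. (G i - t * F i) * y i x) = 0" if "x \<in> {a1..b1}" for x
  proof -
    have "q x = t * p x" using const[OF that] near(2)[OF that] by (simp add: field_simps)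
    then show ?thesis by (simp add: p_def q_def algebra_simps sum_subtractf sum_distrib_left)
  qed
  then have "\<forall>i<k. G i - t * F i = 0"
    using ind[unfolded totally_independent_def, rule_format, of a1 b1 "\<lambda>i. G i - t * F i"] ab1 by blast
  then have "G l - t * F l = 0" "G l' - t * F l' = 0" using FG by blast+
  then show False using FG by simp
qed

text \<open>Compactness for pairs of forms. The identity block at \<open>l\<close> and
  \<open>l'\<close> is a closed condition that keeps the two forms from being proportional.\<close>

lemma wronskian_lower_bound:
  assumes ind: "totally_independent k y a b" and ab: "a < b"
    and yd: "\<And>i x. i < k \<Longrightarrow> x \<in> {a..b} \<Longrightarrow> (y i has_real_derivative y' i x) (at x)"
  shows "\<exists>c>0. \<forall>F G. (\<forall>i<k. \<bar>F i\<bar> \<le> 1 \<and> \<bar>G i\<bar> \<le> 1) \<longrightarrow>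
    (\<exists>l<k. \<exists>l'<k. F l = 1 \<and> F l' = 0 \<and> G l = 0 \<and> G l' = 1) \<longrightarrow>
    (\<exists>x\<in>{a..b}. c \<le> \<bar>(\<Sum>i<k. F i * y i x) * (\<Sum>i<k. G i * y' i x) -
      (\<Sum>i<k. G i * y i x) * (\<Sum>i<k. F i * y' i x)\<bar>)"
proof -
  define h where "h FG x = (\<Sum>i<k. fst FG i * y i x) * (\<Sum>i<k. snd FG i * y' i x) -
      (\<Sum>i<k. snd FG i * y i x) * (\<Sum>i<k. fst FG i * y' i x)" for FG :: "(nat \<Rightarrow> real) \<times> (nat \<Rightarrow> real)" and x
  define K where "K = (\<Union>l<k. \<Union>l'<k. {F\<in>{F\<in>unit_box. F l = 1}. F l' = 0} \<times> {G\<in>{G\<in>unit_box. G l = 0}. G l' = 1})"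
  have "compact K" unfolding K_def
    by (intro compact_UN finite_lessThan ballI compact_Times compact_coord_eq compact_unit_box)
  then have "\<exists>c>0. \<forall>FG\<in>K. \<exists>x\<in>{a..b}. c \<le> \<bar>h FG x\<bar>"
  proof (rule compact_family_lower_bound)
    have co: "continuous_on K (\<lambda>FG. fst FG (i::nat))" "continuous_on K (\<lambda>FG. snd FG i)" for i
    proof -
      have c: "continuous_on UNIV (\<lambda>F::nat \<Rightarrow> real. F i)" by (rule continuous_on_product_coordinates)
      show "continuous_on K (\<lambda>FG. fst FG i)"
        by (rule continuous_on_compose2[OF c continuous_on_fst[OF continuous_on_id]]) auto
      show "continuous_on K (\<lambda>FG. snd FG i)"
        by (rule continuous_on_compose2[OF c continuous_on_snd[OF continuous_on_id]]) auto
    qed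
    show "continuous_on K (\<lambda>FG. h FG x)" for x
      unfolding h_def by (intro continuous_on_diff continuous_on_mult continuous_on_sum continuous_on_const co)
    fix FG assume "FG \<in> K"
    then obtain F G l l' where e: "FG = (F, G)" and "l < k" "l' < k" "F l = 1" "F l' = 0" "G l = 0" "G l' = 1"
      by (auto simp: K_def)
    then show "\<exists>x\<in>{a..b}. h FG x \<noteq> 0"
      unfolding h_def e fst_conv snd_conv by (intro two_forms_wronskian_nonzero[OF ind ab yd]) auto
  qed
  then obtain c where c: "c > 0" "\<And>FG. FG \<in> K \<Longrightarrow> \<exists>x\<in>{a..b}. c \<le> \<bar>h FG x\<bar>" by blast
  show ?thesis
  proof (intro exI[of _ c] conjI c(1) allI impI)
    fix F G :: "nat \<Rightarrow> real" assume FG: "\<forall>i<k. \<bar>F i\<bar> \<le> 1 \<and> \<bar>G i\<bar> \<le> 1"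
      "\<exists>l<k. \<exists>l'<k. F l = 1 \<and> F l' = 0 \<and> G l = 0 \<and> G l' = 1"
    define F' G' where "F' i = (if i < k then F i else 0)" and "G' i = (if i < k then G i else 0)" for i
    have "F' \<in> unit_box" "G' \<in> unit_box" using FG(1) by (auto simp: unit_box_def F'_def G'_def abs_le_iff)
    then have "(F', G') \<in> K" using FG(2) unfolding K_def by (force simp: F'_def G'_def)
    moreover have "(\<Sum>i<k. F' i * u i) = (\<Sum>i<k. F i * u i)" "(\<Sum>i<k. G' i * u i) = (\<Sum>i<k. G i * u i)" for u
      by (rule sum.cong; simp add: F'_def G'_def)+
    ultimately show "\<exists>x\<in>{a..b}. c \<le> \<bar>(\<Sum>i<k. F i * y i x) * (\<Sum>i<k. G i * y' i x) -
      (\<Sum>i<k. G i * y i x) * (\<Sum>i<k. F i * y' i x)\<bar>"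
      using c(2)[of "(F', G')"] by (simp add: h_def)
  qed
qed

text \<open>The scalings act on coordinates, so the basis vectors carry the inverse factors. In the
  application \<open>T = 1 / \<psi>\<close>, and \<open>Q = K * T ^ (n - 1)\<close> makes the frame
  unimodular.\<close>

definition frame :: "(nat \<Rightarrow> real \<Rightarrow> real) \<Rightarrow> (nat \<Rightarrow> real \<Rightarrow> real) \<Rightarrow> real \<Rightarrow> real \<Rightarrow> real \<Rightarrow>
    real \<Rightarrow> nat \<Rightarrow> nat \<Rightarrow> real" where
  "frame y y' Q K T x i j = (if i = 0 then Q * y j x else if i = 1 then inverse K * y' j x else inverse T * unitv i j)"

text \<open>Of the unit vectors the frame contains, up to scaling, only those with index at least 2.
  The rows to be replaced by \<open>y\<close> and \<open>y'\<close> must therefore include all rows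
  with index 0 or 1, and injectivity leaves at most two of these.\<close>

lemma split_off_two:
  fixes J :: "nat \<Rightarrow> nat"
  assumes "inj_on J {j..<k}" "j + 2 \<le> k"
  shows "\<exists>s t. s \<in> {j..<k} \<and> t \<in> {j..<k} \<and> s \<noteq> t \<and> (\<forall>i\<in>{j..<k}. i \<noteq> s \<longrightarrow> i \<noteq> t \<longrightarrow> 2 \<le> J i)"
proof -
  define Z where "Z = {t\<in>{j..<k}. J t < 2}"
  have "inj_on J Z" using assms(1) by (rule inj_on_subset) (auto simp: Z_def)
  then have "card Z \<le> card {..<2::nat}" by (rule card_inj_on_le) (auto simp: Z_def)
  then have "card Z \<le> 2" by simp
  moreover have "Z \<subseteq> {j..<k}" by (auto simp: Z_def)
  moreover have "2 \<le> card {j..<k}" using assms(2) by simp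
  ultimately obtain S where S: "Z \<subseteq> S" "S \<subseteq> {j..<k}" "card S = 2"
    using exists_subset_between[of Z 2 "{j..<k}"] by auto
  then obtain s t where "S = {s, t}" "s \<noteq> t" by (auto simp: card_2_iff)
  then show ?thesis using S by (intro exI[of _ s] exI[of _ t]) (auto simp: Z_def not_less[symmetric])
qed

text \<open>
  The rows \<open>y\<close> and \<open>y'\<close> replace two members of the completion of largest determinant; by Cramer's rule
  the new determinant is a Wronskian of two forms with bounded coefficients.
\<close>

lemma covol_frame_ge_1_codim:
  assumes k: "k = n + 1" "2 \<le> n" and j: "1 \<le> j" "j + 2 \<le> k"
    and vs: "integral_tuple k j vs" "\<not> lindep k j vs"
    and w: "\<And>F G. (\<forall>i<k. \<bar>F i\<bar> \<le> 1 \<and> \<bar>G i\<bar> \<le> 1) \<Longrightarrow>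
      (\<exists>l<k. \<exists>l'<k. F l = 1 \<and> F l' = 0 \<and> G l = 0 \<and> G l' = 1) \<Longrightarrow>
      (\<exists>x\<in>{a..b}. w \<le> \<bar>(\<Sum>i<k. F i * y i x) * (\<Sum>i<k. G i * y' i x) -
        (\<Sum>i<k. G i * y i x) * (\<Sum>i<k. F i * y' i x)\<bar>)" and w0: "0 < w"
    and T: "1 \<le> T" "1 \<le> w * T" and K: "0 < K" "Q = K * T ^ (n - 1)"
  shows "\<exists>x\<in>{a..b}. 1 \<le> covol k (frame y y' Q K T x) j vs"
proof -
  obtain J where J: "J \<in> {j..<k} \<rightarrow>\<^sub>E {..<k}" "covol k unitv j vs = \<bar>rdet k (mix j vs (\<lambda>t. unitv (J t)))\<bar>"
    using covol_attained by blast
  define B where "B = mix j vs (\<lambda>t. unitv (J t))"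
  define D where "D = rdet k B"
  have D1: "1 \<le> \<bar>D\<bar>" using covol_unitv_ge_1[OF vs] J(2) by (simp add: D_def B_def)
  then have D0: "D \<noteq> 0" by auto
  have Bt: "B t = unitv (J t)" if "j \<le> t" for t using that by (simp add: B_def mix_def)
  have injJ: "inj_on J {j..<k}"
  proof (rule inj_onI, rule ccontr)
    fix s t assume st: "s \<in> {j..<k}" "t \<in> {j..<k}" "J s = J t" "s \<noteq> t"
    then have "rdet k B = 0" by (intro rdet_identical_rows[of s k t]) (auto simp: Bt)
    then show False using D0 by (simp add: D_def)
  qed
  obtain s t where st: "s \<in> {j..<k}" "t \<in> {j..<k}" "s \<noteq> t"
    and J2: "\<And>i. i \<in> {j..<k} \<Longrightarrow> i \<noteq> s \<Longrightarrow> i \<noteq> t \<Longrightarrow> 2 \<le> J i"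
    using split_off_two[OF injJ j(2)] by blast
  have lk: "J s < k" "J t < k" using J(1) st by auto
  have "\<forall>i. \<exists>a. \<forall>m<k. unitv i m = (\<Sum>l<k. a l * B l m)" using rdet_solve D0 unfolding D_def by blast
  from choice[OF this] obtain A where A: "\<And>i m. m < k \<Longrightarrow> unitv i m = (\<Sum>l<k. A i l * B l m)" by blast
  have upd: "rdet k (B(r := unitv i)) = A i r * D" if "r < k" for r i
    unfolding D_def by (rule rdet_upd_lincomb[OF that A])
  \<comment> \<open>Putting another unit vector into a completing row gives one of the completions
    over which \<open>\<bar>D\<bar>\<close> is the maximum.\<close>
  have bound: "\<bar>A i r\<bar> \<le> 1" if "r \<in> {j..<k}" "i < k" for r i
  proof -
    have "J(r := i) \<in> {j..<k} \<rightarrow>\<^sub>E {..<k}" using J(1) that by (auto simp: PiE_iff extensional_def)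
    moreover have "B(r := unitv i) = mix j vs (\<lambda>t. unitv ((J(r := i)) t))"
      using that by (auto simp: B_def mix_def)
    ultimately have "\<bar>rdet k (B(r := unitv i))\<bar> \<le> \<bar>D\<bar>"
      using covol_ge[of "J(r := i)" j k vs unitv] J(2) by (simp add: D_def B_def)
    then show ?thesis using upd[of r i] that D0 by (simp add: abs_mult)
  qed
  \<comment> \<open>Together with \<open>off\<close> this provides the identity block at the indices
    \<open>J s\<close> and \<open>J t\<close> which normalises the pair of forms.\<close>
  have diag: "A (J r) r = 1" if "r \<in> {j..<k}" for r
  proof -
    have "B(r := unitv (J r)) = B" using Bt[of r] that by auto
    then show ?thesis using upd[of r "J r"] that D0 by (simp add: D_def)
  qed
  have off: "A (J r') r = 0" if "r \<in> {j..<k}" "r' \<in> {j..<k}" "r \<noteq> r'" for r r'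
  proof -
    have "rdet k (B(r := unitv (J r'))) = 0"
      by (rule rdet_identical_rows[of r k r']) (use that Bt in auto)
    then show ?thesis using upd[of r "J r'"] that D0 by simp
  qed
  obtain x where x: "x \<in> {a..b}" and wx: "w \<le> \<bar>(\<Sum>i<k. A i s * y i x) * (\<Sum>i<k. A i t * y' i x) -
        (\<Sum>i<k. A i t * y i x) * (\<Sum>i<k. A i s * y' i x)\<bar>"
  proof -
    have "\<exists>x\<in>{a..b}. w \<le> \<bar>(\<Sum>i<k. A i s * y i x) * (\<Sum>i<k. A i t * y' i x) -
        (\<Sum>i<k. A i t * y i x) * (\<Sum>i<k. A i s * y' i x)\<bar>"
    proof (rule w)
      show "\<forall>i<k. \<bar>A i s\<bar> \<le> 1 \<and> \<bar>A i t\<bar> \<le> 1" using bound st by blast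
      have "A (J s) s = 1 \<and> A (J t) s = 0 \<and> A (J s) t = 0 \<and> A (J t) t = 1"
        using diag[OF st(1)] diag[OF st(2)] off[OF st(1,2,3)] off[OF st(2,1) st(3)[symmetric]] by blast
      then show "\<exists>l<k. \<exists>l'<k. A l s = 1 \<and> A l' s = 0 \<and> A l t = 0 \<and> A l' t = 1" using lk by blast
    qed
    then show ?thesis using that by blast
  qed
  have vec: "u m = (\<Sum>l<k. (\<Sum>i<k. A i l * u i) * B l m)" if "m < k" for u :: "nat \<Rightarrow> real" and m
  proof -
    have "(\<Sum>l<k. (\<Sum>i<k. A i l * u i) * B l m) = (\<Sum>l<k. \<Sum>i<k. u i * (A i l * B l m))"
      by (simp add: sum_distrib_left sum_distrib_right algebra_simps)
    also have "\<dots> = (\<Sum>i<k. u i * (\<Sum>l<k. A i l * B l m))"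
      by (subst sum.swap) (simp add: sum_distrib_left)
    also have "\<dots> = (\<Sum>i<k. u i * unitv i m)" using A[OF that] by simp
    also have "\<dots> = u m" using unitv_expand[OF that, of u] by simp
    finally show ?thesis by simp
  qed
  define B' where "B' = B(s := (\<lambda>i. y i x), t := (\<lambda>i. y' i x))"
  have "rdet k B' = ((\<Sum>i<k. A i s * y i x) * (\<Sum>i<k. A i t * y' i x) -
        (\<Sum>i<k. A i s * y' i x) * (\<Sum>i<k. A i t * y i x)) * D"
    unfolding B'_def D_def
    by (rule rdet_upd2_lincomb[where a = "\<lambda>l. \<Sum>i<k. A i l * y i x" and b = "\<lambda>l. \<Sum>i<k. A i l * y' i x"])
       (use st vec in auto)
  then have wB: "w \<le> \<bar>rdet k B'\<bar>"
  proof -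
    assume e: "rdet k B' = ((\<Sum>i<k. A i s * y i x) * (\<Sum>i<k. A i t * y' i x) -
        (\<Sum>i<k. A i s * y' i x) * (\<Sum>i<k. A i t * y i x)) * D"
    have "w * 1 \<le> \<bar>(\<Sum>i<k. A i s * y i x) * (\<Sum>i<k. A i t * y' i x) -
        (\<Sum>i<k. A i t * y i x) * (\<Sum>i<k. A i s * y' i x)\<bar> * \<bar>D\<bar>"
      using wx D1 w0 by (intro mult_mono) auto
    then show ?thesis unfolding e abs_mult by (simp add: mult.commute)
  qed
  define J' where "J' = J(s := 0, t := 1)"
  have J': "J' \<in> {j..<k} \<rightarrow>\<^sub>E {..<k}"
    using J(1) st k by (auto simp: J'_def PiE_iff extensional_def)
  define \<sigma> where "\<sigma> i = (if i = s then Q else if i = t then inverse K else if i < j then 1 else inverse T)" for i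
  have "rdet k (mix j vs (\<lambda>i. frame y y' Q K T x (J' i))) = rdet k (\<lambda>i m. \<sigma> i * B' i m)"
  proof (rule rdet_cong)
    fix i m assume im: "i < k" "m < k"
    consider "i = s" | "i = t" | "i < j" "i \<noteq> s" "i \<noteq> t" | "i \<in> {j..<k}" "i \<noteq> s" "i \<noteq> t" using im by fastforce
    then show "mix j vs (\<lambda>i. frame y y' Q K T x (J' i)) i m = \<sigma> i * B' i m"
    proof cases
      case 4
      then show ?thesis using J2[of i] by (auto simp: mix_def B'_def \<sigma>_def J'_def frame_def Bt)
    qed (use st in \<open>auto simp: mix_def B'_def \<sigma>_def J'_def frame_def B_def\<close>)
  qed
  also have "\<dots> = (\<Prod>i<k. \<sigma> i) * rdet k B'" by (rule rdet_scale_rows)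
  \<comment> \<open>The rows \<open>y\<close> and \<open>y'\<close> contribute
    \<open>Q / K = T ^ (n - 1)\<close>, and each of the remaining \<open>n - 1 - j\<close>
    completing rows contributes \<open>1 / T\<close>.\<close>
  also have "(\<Prod>i<k. \<sigma> i) = T ^ j"
  proof -
    have "(\<Prod>i<k. \<sigma> i) = \<sigma> s * (\<sigma> t * (\<Prod>i\<in>{..<k} - {s} - {t}. \<sigma> i))"
      using st by (subst prod.remove[of _ s], simp, simp, subst prod.remove[of _ t]) auto
    also have "(\<Prod>i\<in>{..<k} - {s} - {t}. \<sigma> i) = (\<Prod>i\<in>{j..<k} - {s} - {t}. \<sigma> i)"
      by (rule prod.mono_neutral_right) (use st in \<open>auto simp: \<sigma>_def\<close>)
    also have "\<dots> = (\<Prod>i\<in>{j..<k} - {s} - {t}. inverse T)" by (rule prod.cong) (auto simp: \<sigma>_def)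
    also have "\<dots> = inverse T ^ (k - j - 2)" using st by (simp add: card_Diff_subset)
    finally have "(\<Prod>i<k. \<sigma> i) = Q * inverse K * inverse T ^ (k - j - 2)" using st by (simp add: \<sigma>_def)
    also have "n - 1 = j + (k - j - 2)" using j k by simp
    then have "Q = K * (T ^ j * T ^ (k - j - 2))" by (simp only: K(2) power_add)
    then have "Q * inverse K * inverse T ^ (k - j - 2) = T ^ j"
      using K(1) T(1) by (simp add: power_inverse field_simps)
    finally show ?thesis .
  qed
  finally have "\<bar>rdet k (mix j vs (\<lambda>i. frame y y' Q K T x (J' i)))\<bar> = T ^ j * \<bar>rdet k B'\<bar>"
    using T(1) by (simp add: abs_mult)
  moreover have "T \<le> T ^ j" using self_le_power[OF T(1), of j] j(1) by simp
  then have "T * w \<le> T ^ j * \<bar>rdet k B'\<bar>" using wB w0 T(1) by (intro mult_mono) auto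
  ultimately have "1 \<le> \<bar>rdet k (mix j vs (\<lambda>i. frame y y' Q K T x (J' i)))\<bar>" using T(2) by (simp add: mult.commute)
  then have "1 \<le> covol k (frame y y' Q K T x) j vs" using covol_ge[OF J', of vs "frame y y' Q K T x"] by linarith
  then show ?thesis using x by blast
qed

text \<open>A single row is missing, and filling it with \<open>Q * y\<close> gives \<open>Q\<close>
  times a linear form in \<open>y\<close> whose coefficients are the minors \<open>P i\<close>.
  Division by the largest of them, which has modulus at least 1, normalises the form.\<close>

lemma covol_frame_ge_1_hyperplane:
  assumes k: "k = Suc j"
    and vs: "integral_tuple k j vs" "\<not> lindep k j vs"
    and w: "\<And>F. (\<forall>i<k. \<bar>F i\<bar> \<le> 1) \<Longrightarrow> (\<exists>l<k. F l = 1) \<Longrightarrow>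
      (\<exists>x\<in>{a..b}. w \<le> \<bar>\<Sum>i<k. F i * y i x\<bar>)" and w0: "0 < w" and Q: "1 \<le> w * Q" "0 < Q"
  shows "\<exists>x\<in>{a..b}. 1 \<le> covol k (frame y y' Q K T x) j vs"
proof -
  obtain J where J: "J \<in> {j..<k} \<rightarrow>\<^sub>E {..<k}" "covol k unitv j vs = \<bar>rdet k (mix j vs (\<lambda>t. unitv (J t)))\<bar>"
    using covol_attained by blast
  define P where "P i = rdet k ((mix j vs (\<lambda>t. unitv (J t)))(j := unitv i))" for i
  have tj: "{j..<k} = {j}" using k by auto
  have lk: "J j < k" using J(1) tj by auto
  have "mix j vs (\<lambda>t. unitv (J t)) = (mix j vs (\<lambda>t. unitv (J t)))(j := unitv (J j))" by (auto simp: mix_def)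
  then have Pl: "covol k unitv j vs = \<bar>P (J j)\<bar>" using J(2) by (simp add: P_def)
  then have P1: "1 \<le> \<bar>P (J j)\<bar>" using covol_unitv_ge_1[OF vs] by simp
  have Ple: "\<bar>P i\<bar> \<le> \<bar>P (J j)\<bar>" if "i < k" for i
  proof -
    have "J(j := i) \<in> {j..<k} \<rightarrow>\<^sub>E {..<k}" using J(1) that tj by (auto simp: PiE_iff extensional_def)
    then have "\<bar>rdet k (mix j vs (\<lambda>t. unitv ((J(j := i)) t)))\<bar> \<le> covol k unitv j vs" by (rule covol_ge)
    moreover have "(mix j vs (\<lambda>t. unitv (J t)))(j := unitv i) = mix j vs (\<lambda>t. unitv ((J(j := i)) t))"
      by (auto simp: mix_def)
    ultimately have "\<bar>P i\<bar> \<le> covol k unitv j vs" unfolding P_def by simp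
    then show ?thesis unfolding Pl .
  qed
  obtain x where x: "x \<in> {a..b}" "w \<le> \<bar>\<Sum>i<k. P i / P (J j) * y i x\<bar>"
  proof -
    have "\<exists>x\<in>{a..b}. w \<le> \<bar>\<Sum>i<k. P i / P (J j) * y i x\<bar>"
    proof (rule w)
      show "\<forall>i<k. \<bar>P i / P (J j)\<bar> \<le> 1" using Ple P1 by (auto simp: divide_le_eq_1)
      show "\<exists>l<k. P l / P (J j) = 1" using lk P1 by (intro exI[of _ "J j"]) auto
    qed
    then show ?thesis using that by blast
  qed
  define J' where "J' = (\<lambda>i\<in>{j..<k}. 0::nat)"
  have J': "J' \<in> {j..<k} \<rightarrow>\<^sub>E {..<k}" using k by (auto simp: J'_def)
  have "rdet k (mix j vs (\<lambda>i. frame y y' Q K T x (J' i))) =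
      rdet k ((mix j vs (\<lambda>t. unitv (J t)))(j := (\<lambda>i. Q * y i x)))"
    by (rule rdet_cong) (use k in \<open>auto simp: mix_def J'_def frame_def\<close>)
  also have "\<dots> = (\<Sum>i<k. (Q * y i x) * P i)"
    unfolding P_def by (rule rdet_row_lincomb) (use k in simp, rule unitv_expand)
  also have "\<dots> = Q * P (J j) * (\<Sum>i<k. P i / P (J j) * y i x)"
    unfolding sum_distrib_left using P1 by (intro sum.cong) auto
  finally have e: "\<bar>rdet k (mix j vs (\<lambda>i. frame y y' Q K T x (J' i)))\<bar> =
      Q * (\<bar>P (J j)\<bar> * \<bar>\<Sum>i<k. P i / P (J j) * y i x\<bar>)" using Q(2) by (simp add: abs_mult)
  have "Q * (1 * w) \<le> Q * (\<bar>P (J j)\<bar> * \<bar>\<Sum>i<k. P i / P (J j) * y i x\<bar>)"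
    using x(2) P1 Q(2) w0 by (intro mult_left_mono mult_mono) auto
  then have "1 \<le> covol k (frame y y' Q K T x) j vs"
    using covol_ge[OF J', of vs "frame y y' Q K T x"] e Q(1) by (simp add: mult.commute)
  then show ?thesis using x(1) by blast
qed

section \<open>Integer solutions of linear inequalities\<close>

lemma same_floor_close: "\<lfloor>x :: real\<rfloor> = \<lfloor>y\<rfloor> \<Longrightarrow> \<bar>x - y\<bar> < 1"
  by linarith

text \<open>Pigeonhole principle for pairs: each \<open>q\<close> comes with \<open>M\<close>
  consecutive integers near \<open>q * x\<close>. This treats small and large \<open>s1\<close>
  alike; in the application \<open>s1 = \<eta> / K\<close> may exceed 1. Two pairs with equal
  \<open>q\<close> are allowed to collide, hence only \<open>(q, a)\<close> is claimed
  nonzero.\<close>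

lemma dirichlet_in_tube:
  fixes x N s1 s2 :: real and \<beta> \<gamma> :: "'i \<Rightarrow> real"
  assumes "finite I" "0 \<le> N" "0 < s1" "0 < s2" "s2 \<le> 1"
    and big: "3 * 2 ^ card I \<le> N * s1 * s2 ^ card I"
  shows "\<exists>q a b. (q, a) \<noteq> (0, 0) \<and> \<bar>real_of_int q\<bar> \<le> N \<and> \<bar>of_int q * x - of_int a\<bar> < s1 \<and>
    (\<forall>i\<in>I. \<bar>of_int q * \<beta> i + of_int a * \<gamma> i - of_int (b i)\<bar> < s2)"
proof -
  define M where "M = nat \<lceil>s1\<rceil>"
  have M: "1 \<le> M" "s1 \<le> real M" "real M < s1 + 1" using assms(3) unfolding M_def by linarith+
  define D where "D = {0..nat \<lfloor>N\<rfloor>} \<times> {0..<M}"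
  define al where "al p = \<lfloor>real (fst p) * x\<rfloor> - int (snd p)" for p :: "nat \<times> nat"
  define u where "u p = real (fst p) * x - of_int (al p)" for p
  define th where "th p i = real (fst p) * \<beta> i + of_int (al p) * \<gamma> i" for p i
  define \<Phi> where "\<Phi> p = (\<lfloor>u p / s1\<rfloor>, \<lambda>i\<in>I. \<lfloor>frac (th p i) / s2\<rfloor>)" for p
  define R where "R = {0..\<lfloor>real M / s1\<rfloor>} \<times> (I \<rightarrow>\<^sub>E {0..\<lfloor>1 / s2\<rfloor>})"
  have u0: "0 \<le> u p" "u p < real M" if "p \<in> D" for p
  proof -
    have "u p = frac (real (fst p) * x) + real (snd p)" by (simp add: u_def al_def frac_def)
    moreover have "real (snd p) + 1 \<le> real M" using that by (auto simp: D_def)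
    ultimately show "0 \<le> u p" "u p < real M"
      using frac_ge_0[of "real (fst p) * x"] frac_lt_1[of "real (fst p) * x"] by linarith+
  qed
  have "\<Phi> ` D \<subseteq> R"
  proof
    fix z assume "z \<in> \<Phi> ` D"
    then obtain p where p: "p \<in> D" "z = \<Phi> p" by blast
    have "\<lfloor>u p / s1\<rfloor> \<in> {0..\<lfloor>real M / s1\<rfloor>}"
      using u0[OF p(1)] assms(3) by (auto intro!: floor_mono divide_right_mono)
    moreover have "\<lfloor>frac (th p i) / s2\<rfloor> \<in> {0..\<lfloor>1 / s2\<rfloor>}" for i
      using frac_lt_1[of "th p i"] assms(4) by (auto intro!: floor_mono divide_right_mono)
    ultimately show "z \<in> R" by (auto simp: R_def p(2) \<Phi>_def)
  qed
  moreover have fR: "finite R" unfolding R_def using assms(1) by (intro finite_cartesian_product finite_PiE) auto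
  ultimately have "card (\<Phi> ` D) \<le> card R" by (intro card_mono)
  moreover have "card R < card D"
  proof -
    have f0: "0 \<le> \<lfloor>real M / s1\<rfloor>" "0 \<le> \<lfloor>1 / s2\<rfloor>" using assms by auto
    have "real (card R) = (of_int \<lfloor>real M / s1\<rfloor> + 1) * (of_int \<lfloor>1 / s2\<rfloor> + 1) ^ card I"
      using f0 assms(1) unfolding R_def by (simp add: card_cartesian_product card_PiE)
    \<comment> \<open>Both \<open>M / s1\<close> and \<open>1 / s2\<close> are at least 1, so
      rounding costs bounded factors; they reappear in the hypothesis \<open>big\<close>.\<close>
    also have "\<dots> \<le> (3 * (real M / s1)) * (2 * (1 / s2)) ^ card I"
    proof (intro mult_mono power_mono)
      have "real M / s1 \<ge> 1" using M assms(3) by simp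
      then show "real_of_int \<lfloor>real M / s1\<rfloor> + 1 \<le> 3 * (real M / s1)" by linarith
      have "1 / s2 \<ge> 1" using assms by simp
      then show "real_of_int \<lfloor>1 / s2\<rfloor> + 1 \<le> 2 * (1 / s2)" by linarith
    qed (use assms f0 in auto)
    also have "\<dots> = real M * (3 * 2 ^ card I / (s1 * s2 ^ card I))"
      by (simp add: power_mult_distrib power_divide field_simps)
    also have "\<dots> \<le> real M * N"
    proof (rule mult_left_mono)
      show "3 * 2 ^ card I / (s1 * s2 ^ card I) \<le> N"
        using big assms by (simp add: pos_divide_le_eq mult.assoc)
    qed simp
    also have "\<dots> < real M * (of_int \<lfloor>N\<rfloor> + 1)" using M by (intro mult_strict_left_mono) auto
    also have "\<dots> = real (card D)" using assms(2) by (simp add: D_def algebra_simps)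
    finally show ?thesis by simp
  qed
  ultimately have "\<not> inj_on \<Phi> D" by (intro pigeonhole) linarith
  then obtain p p' where p: "p \<in> D" "p' \<in> D" "p \<noteq> p'" "\<Phi> p = \<Phi> p'" by (auto simp: inj_on_def)
  define q where "q = int (fst p) - int (fst p')"
  define a where "a = al p - al p'"
  define b where "b i = \<lfloor>th p i\<rfloor> - \<lfloor>th p' i\<rfloor>" for i
  have "(q, a) \<noteq> (0, 0)" using p(3) by (auto simp: q_def a_def al_def prod_eq_iff)
  moreover have "\<bar>real_of_int q\<bar> \<le> N"
  proof -
    have "real (fst p) \<le> N" "real (fst p') \<le> N" using p(1,2) assms(2) by (auto simp: D_def le_nat_iff le_floor_iff)
    then show ?thesis by (simp add: q_def abs_le_iff)
  qed
  moreover have "\<bar>of_int q * x - of_int a\<bar> < s1"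
  proof -
    have "\<bar>u p / s1 - u p' / s1\<bar> < 1" by (rule same_floor_close) (use p(4) in \<open>simp add: \<Phi>_def\<close>)
    then have "\<bar>u p - u p'\<bar> < s1" using assms(3) by (simp add: diff_divide_distrib[symmetric])
    moreover have "of_int q * x - of_int a = u p - u p'" by (simp add: q_def a_def u_def algebra_simps)
    ultimately show ?thesis by simp
  qed
  moreover have "\<bar>of_int q * \<beta> i + of_int a * \<gamma> i - of_int (b i)\<bar> < s2" if "i \<in> I" for i
  proof -
    have "\<lfloor>frac (th p i) / s2\<rfloor> = \<lfloor>frac (th p' i) / s2\<rfloor>"
      using p(4) that by (auto simp: \<Phi>_def dest: fun_cong[where x = i])
    then have "\<bar>frac (th p i) / s2 - frac (th p' i) / s2\<bar> < 1" by (rule same_floor_close)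
    then have "\<bar>frac (th p i) - frac (th p' i)\<bar> < s2" using assms(4) by (simp add: diff_divide_distrib[symmetric])
    moreover have "of_int q * \<beta> i + of_int a * \<gamma> i - of_int (b i) = frac (th p i) - frac (th p' i)"
      by (simp add: q_def a_def b_def th_def frac_def algebra_simps)
    ultimately show ?thesis by simp
  qed
  ultimately show ?thesis by blast
qed

text \<open>Division by the greatest common divisor, taken with the sign of \<open>q\<close> so that
  \<open>q'\<close> is positive. As \<open>\<bar>d\<bar>\<close> is at least 1, passing to the
  primitive vector does not enlarge any linear error.\<close>

lemma primitive_multiple:
  fixes q a :: int and b :: "'i \<Rightarrow> int"
  assumes "q \<noteq> 0"
  shows "\<exists>d q' a' b'. q = d * q' \<and> a = d * a' \<and> (\<forall>i\<in>I. b i = d * b' i) \<and> 1 \<le> \<bar>d\<bar> \<and> 0 < q' \<and>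
    Gcd ({q', a'} \<union> b' ` I) = 1"
proof -
  define S where "S = {q, a} \<union> b ` I"
  define d where "d = sgn q * Gcd S"
  have G: "Gcd S dvd s" if "s \<in> S" for s by (rule Gcd_dvd[OF that])
  have "Gcd S \<noteq> 0" using assms by (auto simp: Gcd_0_iff S_def)
  then have G0: "0 < Gcd S" using Gcd_int_greater_eq_0[of S] by linarith
  have d: "\<bar>d\<bar> = Gcd S" "1 \<le> \<bar>d\<bar>" using assms G0 by (auto simp: d_def abs_mult)
  then have d0: "d \<noteq> 0" by auto
  have dd: "d dvd s" if "s \<in> S" for s
  proof -
    have "\<bar>d\<bar> dvd s" using G[OF that] d(1) by simp
    then show ?thesis by simp
  qed
  define q' a' b' where "q' = q div d" and "a' = a div d" and "b' = (\<lambda>i. b i div d)"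
  have e: "q = d * q'" "a = d * a'" "b i = d * b' i" if "i \<in> I" for i
    using dd[of q] dd[of a] dd[of "b i"] that by (auto simp: S_def q'_def a'_def b'_def)
  have e': "q = d * q'" "a = d * a'" using dd[of q] dd[of a] by (auto simp: S_def q'_def a'_def)
  have "sgn q * q = sgn q * (d * q')" using e'(1) by (rule arg_cong)
  also have "\<dots> = (sgn q * sgn q) * (Gcd S * q')" by (simp add: d_def)
  finally have "\<bar>q\<bar> = Gcd S * q'" using assms by (simp add: sgn_if split: if_splits)
  then have q'0: "0 < q'" using assms G0 by (metis zero_less_abs_iff zero_less_mult_pos)
  have "S = (*) d ` ({q', a'} \<union> b' ` I)"
    using e e' by (auto simp: S_def image_iff)
  moreover define X where "X = {q', a'} \<union> b' ` I"
  ultimately have "Gcd S = \<bar>d\<bar> * Gcd X"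
    using Gcd_mult[of d X] by (simp add: abs_mult)
  then have "Gcd S * Gcd X = Gcd S * 1" unfolding d(1) by (simp only: mult_1_right)
  then have "Gcd X = 1" by (rule mult_left_cancel[THEN iffD1, OF less_imp_neq[OF G0, symmetric]])
  then have "Gcd ({q', a'} \<union> b' ` I) = 1" by (simp only: X_def)
  then show ?thesis using e e' d q'0 by blast
qed

section \<open>Rational points near the curve\<close>

lemma rdet_wronskian:
  "wronskian n y x = rdet (n + 1) (\<lambda>i j. (deriv ^^ j) (y i) x)"
  by (simp add: wronskian_def rdet_def)

text \<open>Differentiating a relation on an interval at its midpoint gives a relation between the
  rows of the Wronskian matrix there.\<close>

lemma totally_independent_of_wronskian:
  assumes "open U" "{a..b} \<subseteq> U" "\<And>i. i < n + 1 \<Longrightarrow> real_analytic_on (y i) U"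
    and "\<And>x. x \<in> {a..b} \<Longrightarrow> wronskian n y x \<noteq> 0"
  shows "totally_independent (n + 1) y a b"
  unfolding totally_independent_def
proof (intro allI impI)
  fix a1 b1 F i assume ab: "a \<le> a1" "a1 < b1" "b1 \<le> b" and z: "\<forall>x\<in>{a1..b1}. (\<Sum>i<n + 1. F i * y i x) = 0"
    and i: "i < n + 1"
  define x where "x = (a1 + b1) / 2"
  have x: "x \<in> {a1<..<b1}" "x \<in> {a..b}" "x \<in> U" using ab assms(2) by (auto simp: x_def)
  have "eventually (\<lambda>x. x \<in> {a1<..<b1}) (nhds x)" by (rule eventually_nhds_in_open) (use x in auto)
  then have ev: "eventually (\<lambda>x. (\<Sum>i<n + 1. F i * y i x) = 0) (nhds x)"
    by eventually_elim (use z in auto)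
  have "(\<Sum>i<n + 1. F i * (deriv ^^ j) (y i) x) = 0" for j
  proof -
    have "(\<Sum>i<n + 1. F i * (deriv ^^ j) (y i) x) = (deriv ^^ j) (\<lambda>x. \<Sum>i<n + 1. F i * y i x) x"
      by (rule higher_deriv_lincomb[OF assms(1) x(3), symmetric]) (use assms(3) in auto)
    also have "\<dots> = (deriv ^^ j) (\<lambda>x. 0) x" by (rule higher_deriv_cong_ev[OF ev]) simp
    also have "(deriv ^^ j) (\<lambda>x::real. 0 :: real) = (\<lambda>x. 0)" by (induction j) auto
    finally show ?thesis .
  qed
  moreover have "rdet (n + 1) (\<lambda>i j. (deriv ^^ j) (y i) x) \<noteq> 0"
    using assms(4)[OF x(2)] by (simp only: rdet_wronskian not_False_eq_True)
  ultimately show "F i = 0" using rdet_independent_rows i by blast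
qed

section \<open>Minors of the frame as combinations of a fixed family\<close>

lemma prod_lessThan_Suc_Suc:
  "(\<Prod>i<Suc (Suc m). g i) = g 0 * (g 1 * (\<Prod>i<m. g (Suc (Suc i))))"
  by (simp add: prod.lessThan_Suc_shift del: prod.lessThan_Suc)

lemma rdet_frame:
  assumes n: "2 \<le> n" and y: "y 0 x = 1" "y' 0 x = 0" "y' 1 x = 1"
    and K: "0 < K" "0 < T" "Q = K * T ^ (n - 1)"
  shows "rdet (n + 1) (frame y y' Q K T x) = 1"
proof -
  obtain m where m: "n = Suc m" using n by (cases n) auto
  define \<sigma> where "\<sigma> i = (if i = 0 then Q else if i = 1 then inverse K else inverse T)" for i :: nat
  define B where "B = unitv(0 := (\<lambda>i. y i x), 1 := (\<lambda>i. y' i x))"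
  have "rdet (n + 1) (frame y y' Q K T x) = rdet (n + 1) (\<lambda>i j. \<sigma> i * B i j)"
    by (rule rdet_cong) (auto simp: frame_def \<sigma>_def B_def)
  also have "\<dots> = (\<Prod>i<n + 1. \<sigma> i) * rdet (n + 1) B" by (rule rdet_scale_rows)
  also have "rdet (n + 1) B = (y 0 x * y' 1 x - y' 0 x * y 1 x) * rdet (n + 1) unitv"
    unfolding B_def
    by (rule rdet_upd2_lincomb[where a = "\<lambda>i. y i x" and b = "\<lambda>i. y' i x"])
       (use n in simp, use n in simp, simp, (erule unitv_expand)+)
  also have "rdet (n + 1) unitv = 1" using rdet_identity[of "n + 1"] by (simp add: unitv_def[abs_def])
  also have "(\<Prod>i<n + 1. \<sigma> i) = Q * (inverse K * inverse T ^ m)"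
    unfolding m using prod_lessThan_Suc_Suc[of \<sigma> m] by (simp add: \<sigma>_def)
  finally show ?thesis using y K m by (simp add: power_inverse field_simps)
qed

text \<open>Leibniz expansion, with the permutations grouped by the functions they select. The
  family of products does not depend on the constants \<open>C\<close>, so one smallness estimate
  covers all subspaces and all scales at once.\<close>

lemma rdet_products_in_span:
  assumes "\<And>t i x. t < k \<Longrightarrow> i < k \<Longrightarrow> c x t i = C t i * g (e t i) x"
    and "\<And>t i. t < k \<Longrightarrow> i < k \<Longrightarrow> e t i < (N :: nat)"
  shows "\<exists>cf. \<forall>x. rdet k (c x) = (\<Sum>m\<in>{0..<k} \<rightarrow>\<^sub>E {..<N}. cf m * (\<Prod>t = 0..<k. g (m t) x))"
proof -
  define P where "P = {p. p permutes {0..<k}}"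
  define M where "M = {0..<k} \<rightarrow>\<^sub>E {..<N}"
  define mm where "mm p = (\<lambda>t\<in>{0..<k}. e t (p t))" for p
  define d where "d p = of_int (sign p) * (\<Prod>t = 0..<k. C t (p t))" for p
  have fP: "finite P" unfolding P_def by (rule finite_permutations) simp
  have fM: "finite M" unfolding M_def by (intro finite_PiE) auto
  have mM: "mm ` P \<subseteq> M" using assms(2) permutes_lessThan_le by (auto simp: mm_def M_def P_def)
  have "rdet k (c x) = (\<Sum>m\<in>M. (\<Sum>p\<in>{p\<in>P. mm p = m}. d p) * (\<Prod>t = 0..<k. g (m t) x))" for x
  proof -
    have "rdet k (c x) = (\<Sum>p\<in>P. d p * (\<Prod>t = 0..<k. g (mm p t) x))"
      unfolding rdet_leibniz P_def[symmetric]
    proof (rule sum.cong)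
      fix p assume p: "p \<in> P"
      have "(\<Prod>t = 0..<k. c x t (p t)) = (\<Prod>t = 0..<k. C t (p t) * g (mm p t) x)"
        by (rule prod.cong) (use assms(1) permutes_lessThan_le p in \<open>auto simp: P_def mm_def\<close>)
      then show "of_int (sign p) * (\<Prod>t = 0..<k. c x t (p t)) = d p * (\<Prod>t = 0..<k. g (mm p t) x)"
        by (simp add: d_def prod.distrib mult.assoc)
    qed simp
    also have "\<dots> = (\<Sum>m\<in>M. \<Sum>p\<in>{p\<in>P. mm p = m}. d p * (\<Prod>t = 0..<k. g (mm p t) x))"
      by (rule sum.group[OF fP fM mM, symmetric])
    also have "\<dots> = (\<Sum>m\<in>M. (\<Sum>p\<in>{p\<in>P. mm p = m}. d p) * (\<Prod>t = 0..<k. g (m t) x))"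
      unfolding sum_distrib_right by (intro sum.cong refl) auto
    finally show ?thesis .
  qed
  then show ?thesis unfolding M_def by (intro exI[of _ "\<lambda>m. \<Sum>p\<in>{p\<in>P. mm p = m}. d p"] allI)
qed

definition base_fun :: "nat \<Rightarrow> (nat \<Rightarrow> real \<Rightarrow> real) \<Rightarrow> (nat \<Rightarrow> real \<Rightarrow> real) \<Rightarrow> nat \<Rightarrow> real \<Rightarrow> real" where
  "base_fun k y y' i x = (if i < k then y i x else y' (i - k) x)"

text \<open>Constant entries are written as multiples of \<open>y 0 = 1\<close>, which gives every
  entry the form of a constant times a base function.\<close>

lemma frame_minor_in_span:
  assumes "\<And>x. y 0 x = 1" "0 < k"
  shows "\<exists>cf. \<forall>x. rdet k (mix j vs (\<lambda>t. frame y y' Q K T x (J t))) =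
    (\<Sum>m\<in>{0..<k} \<rightarrow>\<^sub>E {..<2 * k}. cf m * (\<Prod>t = 0..<k. base_fun k y y' (m t) x))"
proof (rule rdet_products_in_span)
  fix t i x assume "t < k" "i < k"
  show "mix j vs (\<lambda>t. frame y y' Q K T x (J t)) t i =
     (if t < j then vs t i else if J t = 0 then Q else if J t = 1 then inverse K else inverse T * unitv (J t) i) *
     base_fun k y y' (if t < j then 0 else if J t = 0 then i else if J t = 1 then k + i else 0) x"
    using assms \<open>i < k\<close> by (auto simp: mix_def frame_def base_fun_def)
qed (use assms in auto)

lemma continuous_on_Max:
  fixes g :: "'i \<Rightarrow> 'a::topological_space \<Rightarrow> real"
  assumes "finite A" "A \<noteq> {}" "\<And>J. J \<in> A \<Longrightarrow> continuous_on S (g J)"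
  shows "continuous_on S (\<lambda>x. Max ((\<lambda>J. g J x) ` A))"
  using assms
proof (induction A rule: finite_ne_induct)
  case (insert J A)
  then have "continuous_on S (\<lambda>x. max (g J x) (Max ((\<lambda>J. g J x) ` A)))"
    by (intro continuous_on_max) auto
  then show ?case using insert.hyps by (simp add: Max_insert)
qed auto

text \<open>Length is the sum of the moduli of the coordinates in the frame; the factor
  \<open>fact k\<close> is the one from the covolume of the zero subspace.\<close>

definition short_vector_free :: "nat \<Rightarrow> real \<Rightarrow> (nat \<Rightarrow> nat \<Rightarrow> real) \<Rightarrow> bool" where
  "short_vector_free k \<epsilon> c \<longleftrightarrow> (\<forall>v z i0. (\<forall>i<k. v i \<in> \<int>) \<longrightarrow> (\<forall>i<k. v i = (\<Sum>l<k. z l * c l i)) \<longrightarrow>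
     i0 < k \<longrightarrow> v i0 \<noteq> 0 \<longrightarrow> \<epsilon> \<le> fact k * (\<Sum>l<k. \<bar>z l\<bar>))"

lemma no_short_vectors_on_large_set:
  fixes y :: "nat \<Rightarrow> real \<Rightarrow> real"
  assumes n: "2 \<le> n" and U: "open U" and an: "\<And>i. i < n + 1 \<Longrightarrow> real_analytic_on (y i) U"
    and y01: "y 0 = (\<lambda>_. 1)" "y 1 = (\<lambda>x. x)"
    and W: "\<And>x. x \<in> U \<Longrightarrow> wronskian n y x \<noteq> 0" and B0: "compact B0" "B0 \<subseteq> U"
  shows "\<exists>\<epsilon>>0. \<exists>\<eta>>0. \<epsilon> \<le> 1 \<and> (\<forall>a b. a < b \<longrightarrow> {a..b} \<subseteq> B0 \<longrightarrow> b - a < \<eta> \<longrightarrow>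
    (\<exists>w>0. \<forall>Q K T. 0 < K \<longrightarrow> Q = K * T ^ (n - 1) \<longrightarrow> 1 \<le> T \<longrightarrow> 1 \<le> w * T \<longrightarrow> 1 \<le> w * Q \<longrightarrow>
      (\<exists>M\<in>sets lborel. M \<subseteq> {a..b} \<and> (b - a) / 20 ^ n \<le> measure lborel M \<and>
        (\<forall>x\<in>M. short_vector_free (n + 1) \<epsilon> (frame y (\<lambda>i. deriv (y i)) Q K T x)))))"
proof -
  define k where "k = n + 1"
  define y' where "y' i = deriv (y i)" for i
  define I where "I = {0..<k} \<rightarrow>\<^sub>E {..<2 * k}"
  define h where "h m x = (\<Prod>t = 0..<k. base_fun k y y' (m t) x)" for m x
  define \<kappa> :: real where "\<kappa> = 1 / (2 * 20 ^ n)"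
  have \<kappa>: "\<kappa> > 0" by (simp add: \<kappa>_def)
  have fI: "finite I" unfolding I_def by (intro finite_PiE) auto
  have anb: "real_analytic_on (base_fun k y y' e) U" if "e < 2 * k" for e
  proof (cases "e < k")
    case True
    then have "base_fun k y y' e = y e" by (simp add: base_fun_def fun_eq_iff)
    then show ?thesis using an True by (simp add: k_def)
  next
    case False
    then have "base_fun k y y' e = deriv (y (e - k))" by (simp add: base_fun_def fun_eq_iff y'_def)
    moreover have "e - k < n + 1" using that False by (simp add: k_def)
    ultimately show ?thesis using an real_analytic_on_deriv by simp
  qed
  have anh: "real_analytic_on (h m) U" if "m \<in> I" for m
  proof -
    have "real_analytic_on (\<lambda>x. \<Prod>t = 0..<k. base_fun k y y' (m t) x) U"
      by (rule real_analytic_on_prod, rule anb) (use that in \<open>auto simp: I_def\<close>)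
    then show ?thesis by (simp add: h_def[abs_def])
  qed
  obtain \<epsilon> \<eta> where \<epsilon>: "0 < \<epsilon>" "\<epsilon> < 1" and \<eta>: "0 < \<eta>"
    and good: "\<And>c a b. a < b \<Longrightarrow> {a..b} \<subseteq> B0 \<Longrightarrow> b - a < \<eta> \<Longrightarrow>
     (\<exists>x\<in>{a..b}. 1 \<le> \<bar>\<Sum>m\<in>I. c m * h m x\<bar>) \<Longrightarrow>
     measure lborel {x\<in>{a..b}. \<bar>\<Sum>m\<in>I. c m * h m x\<bar> < \<epsilon>} \<le> \<kappa> * (b - a)"
    using span_uniformly_good[of I U h B0 \<kappa>, OF fI U anh B0 \<kappa>] by blast
  have main: "\<exists>w>0. \<forall>Q K T. 0 < K \<longrightarrow> Q = K * T ^ (n - 1) \<longrightarrow> 1 \<le> T \<longrightarrow> 1 \<le> w * T \<longrightarrow> 1 \<le> w * Q \<longrightarrow>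
      (\<exists>M\<in>sets lborel. M \<subseteq> {a..b} \<and> (b - a) / 20 ^ n \<le> measure lborel M \<and>
        (\<forall>x\<in>M. short_vector_free k \<epsilon> (frame y y' Q K T x)))"
    if ab: "a < b" "{a..b} \<subseteq> B0" "b - a < \<eta>" for a b
  proof -
    have abU: "{a..b} \<subseteq> U" using ab(2) B0(2) by blast
    have ind: "totally_independent k y a b"
      unfolding k_def by (rule totally_independent_of_wronskian[OF U abU an]) (use W abU in auto)
    have yd: "(y i has_real_derivative y' i x) (at x)" if "i < k" "x \<in> {a..b}" for i x
      unfolding y'_def by (rule real_analytic_on_has_deriv[OF an]) (use that abU in \<open>auto simp: k_def\<close>)
    obtain w1 where w1: "w1 > 0" "\<And>F. (\<forall>i<k. \<bar>F i\<bar> \<le> 1) \<Longrightarrow> (\<exists>l<k. F l = 1) \<Longrightarrow>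
      (\<exists>x\<in>{a..b}. w1 \<le> \<bar>\<Sum>i<k. F i * y i x\<bar>)"
      using lincomb_lower_bound[OF ind ab(1)] by blast
    obtain w2 where w2: "w2 > 0" "\<And>F G. (\<forall>i<k. \<bar>F i\<bar> \<le> 1 \<and> \<bar>G i\<bar> \<le> 1) \<Longrightarrow>
      (\<exists>l<k. \<exists>l'<k. F l = 1 \<and> F l' = 0 \<and> G l = 0 \<and> G l' = 1) \<Longrightarrow>
      (\<exists>x\<in>{a..b}. w2 \<le> \<bar>(\<Sum>i<k. F i * y i x) * (\<Sum>i<k. G i * y' i x) -
        (\<Sum>i<k. G i * y i x) * (\<Sum>i<k. F i * y' i x)\<bar>)"
      using wronskian_lower_bound[OF ind ab(1) yd] by blast
    show ?thesis
    proof (rule exI[of _ "min w1 w2"], intro conjI allI impI)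
      show "min w1 w2 > 0" using w1 w2 by simp
      fix Q K T :: real
      assume K: "0 < K" "Q = K * T ^ (n - 1)" and T: "1 \<le> T" "1 \<le> min w1 w2 * T" and Q: "1 \<le> min w1 w2 * Q"
      have Q0: "0 < Q" using K T(1) by simp
      have wT: "1 \<le> w2 * T" by (rule order_trans[OF T(2)], rule mult_right_mono) (use T(1) in auto)
      have wQ: "1 \<le> w1 * Q" by (rule order_trans[OF Q], rule mult_right_mono) (use Q0 in auto)
      define c where "c x = frame y y' Q K T x" for x
      define \<psi> where "\<psi> p x = subspace_covol k (c x) p" for p x
      have det: "rdet k (c x) = 1" for x
        unfolding c_def k_def
        by (rule rdet_frame[OF n _ _ _ K(1) _ K(2)]) (use T y01 in \<open>auto simp: y'_def\<close>)
      have minor: "\<exists>cf. \<forall>x. rdet k (mix j vs (\<lambda>t. c x (J t))) = (\<Sum>m\<in>I. cf m * h m x)" for j vs J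
        unfolding c_def I_def h_def by (rule frame_minor_in_span) (use y01 in \<open>auto simp: k_def\<close>)
      have minor_cont: "continuous_on {a..b} (\<lambda>x. \<bar>rdet k (mix j vs (\<lambda>t. c x (J t)))\<bar>)" for j vs J
      proof -
        obtain cf where cf: "\<And>x. rdet k (mix j vs (\<lambda>t. c x (J t))) = (\<Sum>m\<in>I. cf m * h m x)"
          using minor by blast
        have "continuous_on {a..b} (h m)" if "m \<in> I" for m
          by (rule real_analytic_on_continuous[OF anh[OF that] abU])
        then show ?thesis unfolding cf
          by (intro continuous_on_rabs continuous_on_sum continuous_on_mult continuous_on_const) auto
      qed
      have cont: "continuous_on {a..b} (\<psi> p)" for p
        unfolding \<psi>_def[abs_def] subspace_covol_def covol_def
        by (intro continuous_on_Max finite_completions completions_nonempty minor_cont)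
      have "\<exists>M\<in>sets lborel. M \<subseteq> {a..b} \<and> (b - a) / 20 ^ n \<le> measure lborel M \<and>
          (\<forall>x\<in>M. \<exists>F. marks comparable \<psi> \<epsilon> (subspaces k) F x)"
      \<comment> \<open>The ranks are the dimensions \<open>1\<close> to \<open>n\<close>, so the
        induction has depth \<open>n\<close>; this is the origin of \<open>20 ^ n\<close>.\<close>
      proof (rule positive_proportion_marked[where rk = fst and R = "{1..n}" and B = "{a..b}" and \<kappa> = \<kappa>])
        show "comparable p p" for p :: "nat \<times> (nat \<Rightarrow> real) set" by (simp add: comparable_def)
        show "comparable q p" if "comparable p q" for p q :: "nat \<times> (nat \<Rightarrow> real) set"
          using that by (auto simp: comparable_def)
        show "p = q" if "p \<in> subspaces k" "q \<in> subspaces k" "comparable p q" "fst p = fst q" for p q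
          using that by (rule comparable_same_dim)
        show "continuous_on {a..b} (\<psi> p)" for p by (rule cont)
        show "finite {p \<in> subspaces k. \<psi> p x < 1}" for x
          unfolding \<psi>_def by (rule finite_small_subspaces) (simp add: det)
        show "\<kappa> \<le> 1 / (2 * 20 ^ n)" by (simp add: \<kappa>_def)
        show "fst ` subspaces k \<subseteq> {1..n}" by (auto simp: subspaces_def k_def)
        show "\<exists>x\<in>{a..b}. 1 \<le> \<psi> p x" if p: "p \<in> subspaces k" for p
        proof -
          have j: "1 \<le> fst p" "fst p < k" using p by (auto simp: subspaces_def)
          have vs: "integral_tuple k (fst p) (minimal_tuple k p)" "\<not> lindep k (fst p) (minimal_tuple k p)"
            using minimal_tuple_exists(1)[OF p] by (auto simp: spans_def)
          show ?thesis
          proof (cases "fst p = n")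
            case True
            show ?thesis unfolding \<psi>_def c_def subspace_covol_def
              by (rule covol_frame_ge_1_hyperplane[OF _ vs w1(2) w1(1) wQ Q0]) (use True in \<open>auto simp: k_def\<close>)
          next
            case False
            have j2: "fst p + 2 \<le> k" using False j(2) by (simp add: k_def)
            show ?thesis unfolding \<psi>_def c_def subspace_covol_def
              by (rule covol_frame_ge_1_codim[OF k_def n j(1) j2 vs w2(2) w2(1) T(1) wT K])
          qed
        qed
        show "measure lborel {x \<in> {a'..b'}. \<psi> p x < \<epsilon>} \<le> \<kappa> * (b' - a')"
          if p: "p \<in> subspaces k" and ab': "{a'..b'} \<subseteq> {a..b}" "a' < b'" and ex: "\<exists>x\<in>{a'..b'}. 1 \<le> \<psi> p x" for p a' b'
        proof -
          define vs where "vs = minimal_tuple k p"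
          define j where "j = fst p"
          define g where "g J x = \<bar>rdet k (mix j vs (\<lambda>t. c x (J t)))\<bar>" for J x
          \<comment> \<open>One minor reaches 1 at \<open>x0\<close>. It stays below the covolume
            everywhere, so the sublevel set of the covolume lies in that of this minor, to which the
            estimate for linear families applies.\<close>
          obtain x0 where x0: "x0 \<in> {a'..b'}" "1 \<le> \<psi> p x0" using ex by blast
          obtain J where J: "J \<in> {j..<k} \<rightarrow>\<^sub>E {..<k}" "covol k (c x0) j vs = \<bar>rdet k (mix j vs (\<lambda>t. c x0 (J t)))\<bar>"
            using covol_attained by blast
          have g1: "1 \<le> g J x0" using x0(2) J(2) by (simp add: g_def \<psi>_def subspace_covol_def vs_def j_def)
          obtain cf where cf: "\<And>x. rdet k (mix j vs (\<lambda>t. c x (J t))) = (\<Sum>m\<in>I. cf m * h m x)"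
            using minor by blast
          have gcf: "g J x = \<bar>\<Sum>m\<in>I. cf m * h m x\<bar>" for x by (simp add: g_def cf)
          have sub: "{a'..b'} \<subseteq> B0" using ab' ab(2) by blast
          have len: "b' - a' < \<eta>" using ab' ab(3) by auto
          have le: "measure lborel {x\<in>{a'..b'}. g J x < \<epsilon>} \<le> \<kappa> * (b' - a')"
            unfolding gcf by (rule good[OF ab'(2) sub len]) (use x0 g1 gcf in auto)
          have s1: "{x \<in> {a'..b'}. \<psi> p x < \<epsilon>} \<in> sets lborel"
            by (rule sublevel_set_in_sets[OF continuous_on_subset[OF cont ab'(1)]])
          have s2: "{x \<in> {a'..b'}. g J x < \<epsilon>} \<in> sets lborel"
            unfolding g_def by (rule sublevel_set_in_sets[OF continuous_on_subset[OF minor_cont ab'(1)]])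
          have "measure lborel {x \<in> {a'..b'}. \<psi> p x < \<epsilon>} \<le> measure lborel {x\<in>{a'..b'}. g J x < \<epsilon>}"
          proof (rule measure_mono_fmeasurable[OF _ s1])
            have "g J x \<le> \<psi> p x" for x
              using covol_ge[OF J(1), of vs "c x"] by (simp add: g_def \<psi>_def subspace_covol_def vs_def j_def)
            then show "{x \<in> {a'..b'}. \<psi> p x < \<epsilon>} \<subseteq> {x\<in>{a'..b'}. g J x < \<epsilon>}"
              by (auto intro: le_less_trans)
            show "{x\<in>{a'..b'}. g J x < \<epsilon>} \<in> fmeasurable lborel"
              by (rule fmeasurableI2[OF fmeasurable_compact[OF compact_Icc[of a' b']] _ s2]) auto
          qed
          then show ?thesis using le by linarith
        qed
      qed (use ab in auto)
      then obtain M where M: "M \<in> sets lborel" "M \<subseteq> {a..b}" "(b - a) / 20 ^ n \<le> measure lborel M"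
        "\<And>x. x \<in> M \<Longrightarrow> \<exists>F. marks comparable \<psi> \<epsilon> (subspaces k) F x" by blast
      show "\<exists>M\<in>sets lborel. M \<subseteq> {a..b} \<and> (b - a) / 20 ^ n \<le> measure lborel M \<and>
        (\<forall>x\<in>M. short_vector_free k \<epsilon> (frame y y' Q K T x))"
        unfolding short_vector_free_def
      proof (intro bexI[of _ M] conjI ballI allI impI M(1,2,3))
        fix x v z i0 assume x: "x \<in> M" and v: "\<forall>i<k. v i \<in> \<int>"
          "\<forall>i<k. v i = (\<Sum>l<k. z l * frame y y' Q K T x l i)" and i0: "i0 < k" "v i0 \<noteq> 0"
        obtain F where "marks comparable \<psi> \<epsilon> (subspaces k) F x" using M(4)[OF x] by blast
        then have mk: "marks comparable (\<lambda>p x. subspace_covol k (c x) p) \<epsilon> (subspaces k) F x"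
          by (simp add: \<psi>_def[abs_def])
        show "\<epsilon> \<le> fact k * (\<Sum>l<k. \<bar>z l\<bar>)"
          by (rule marked_no_short_vector[OF mk \<epsilon>(1) less_imp_le[OF \<epsilon>(2)], of v z i0])
             (use v i0 det in \<open>auto simp: c_def\<close>)
      qed
    qed
  qed
  show ?thesis
    by (rule exI[of _ \<epsilon>], intro conjI \<epsilon>(1), rule exI[of _ \<eta>], intro conjI \<eta> allI impI)
       (use \<epsilon> main in \<open>simp_all add: k_def y'_def[abs_def]\<close>)
qed

section \<open>From frames without short vectors to rational points\<close>

lemma sum_lessThan_Suc_Suc:
  "(\<Sum>i<Suc (Suc m). g i) = g 0 + (g 1 + (\<Sum>i<m. g (Suc (Suc i))))"
  by (simp add: sum.lessThan_Suc_shift add.assoc del: sum.lessThan_Suc)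

lemma coord_simps:
  "coord f 0 = (\<lambda>_. 1)" "coord f (Suc 0) = (\<lambda>x. x)" "coord f (Suc (Suc i)) = f (Suc i)"
  by (auto simp: coord_def fun_eq_iff)

text \<open>
  At a point without short vectors, a solution of Dirichlet's system in a long thin box must be long
  in the direction of \<open>q\<close>.
\<close>

lemma rational_point_of_good_point:
  fixes f :: "nat \<Rightarrow> real \<Rightarrow> real"
  defines "f' \<equiv> \<lambda>i. deriv (f i)"
  assumes n: "2 \<le> n" and \<epsilon>: "0 < \<epsilon>" "\<epsilon> \<le> 1" and \<eta>: "\<eta> = \<epsilon> / (2 * fact (n + 1) * (real n + 1))"
    and R: "R = 3 * 2 ^ (n - 1) / \<eta> ^ n" and Q: "0 < Q" and \<psi>: "0 < \<psi>" "\<psi> \<le> 1"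
    and good: "short_vector_free (n + 1) \<epsilon> (frame (coord f) (\<lambda>i. deriv (coord f i))
      (Q / R) (Q / R * \<psi> ^ (n - 1)) (inverse \<psi>) x)"
  shows "\<exists>q a b. 0 < q \<and> \<eta> * (Q / R) \<le> of_int q \<and> of_int q \<le> Q \<and>
    \<bar>of_int a - of_int q * x\<bar> < \<eta> / (Q / R * \<psi> ^ (n - 1)) \<and>
    (\<forall>i\<in>{1..n-1}. \<bar>of_int q * f i x + f' i x * (of_int a - of_int q * x) - of_int (b i)\<bar> < \<eta> * \<psi>) \<and>
    Gcd ({q, a} \<union> b ` {1..n-1}) = (1 :: int)"
proof -
  note good = good[unfolded short_vector_free_def, THEN spec, THEN spec, THEN spec, THEN mp, THEN mp, THEN mp, THEN mp]
  define k where "k = n + 1"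
  define Q' where "Q' = Q / R"
  define K where "K = Q' * \<psi> ^ (n - 1)"
  obtain m where m: "n = Suc m" "1 \<le> m" using n by (cases n) auto
  define N where "N = (fact k :: real)"
  have N1: "1 \<le> N" unfolding N_def by (rule fact_ge_1)
  have \<eta>N: "\<eta> = \<epsilon> / (2 * N * (real n + 1))" unfolding \<eta> N_def k_def ..
  have D0: "0 < 2 * N * (real n + 1)" using N1 by (intro mult_pos_pos) auto
  have \<eta>0: "0 < \<eta>" unfolding \<eta>N using \<epsilon>(1) D0 by (rule divide_pos_pos)
  have R0: "0 < R" using \<eta>0 by (simp add: R)
  have Q'0: "0 < Q'" using Q R0 by (simp add: Q'_def)
  have K0: "0 < K" using Q'0 \<psi> by (simp add: K_def)
  have \<eta>1: "\<eta> \<le> 1"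
  proof -
    have "1 * 1 \<le> (2 * N) * (real n + 1)" using N1 by (intro mult_mono) auto
    then have "\<epsilon> / (2 * N * (real n + 1)) \<le> \<epsilon> / 1" using \<epsilon> D0 by (intro divide_left_mono) auto
    then show ?thesis using \<epsilon> unfolding \<eta>N by simp
  qed
  have long: "\<eta> * Q' \<le> \<bar>of_int q\<bar>"
    if nz: "(q, a) \<noteq> (0, 0)" and a: "\<bar>of_int a - of_int q * x\<bar> < \<eta> / K"
      and b: "\<And>i. i \<in> {1..n-1} \<Longrightarrow> \<bar>of_int q * f i x + f' i x * (of_int a - of_int q * x) - of_int (b i)\<bar> < \<eta> * \<psi>"
    for q a :: int and b :: "nat \<Rightarrow> int"
  proof -
    define v where "v i = (if i = 0 then of_int q else if i = 1 then of_int a else real_of_int (b (i - 1)))" for i :: nat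
    define z where "z i = (if i = 0 then of_int q / Q' else if i = 1 then (of_int a - of_int q * x) * K
      else (of_int (b (i - 1)) - of_int q * f (i - 1) x - (of_int a - of_int q * x) * f' (i - 1) x) / \<psi>)" for i :: nat
    define c where "c = frame (coord f) (\<lambda>i. deriv (coord f i)) Q' K (inverse \<psi>) x"
    have c0: "c 0 i = Q' * coord f i x" and c1: "c 1 i = inverse K * deriv (coord f i) x"
      and c2: "c (Suc (Suc l)) i = \<psi> * unitv (Suc (Suc l)) i" for i l
      by (auto simp: c_def frame_def)
    have vz: "v i = (\<Sum>l<k. z l * c l i)" if "i < k" for i
    proof -
      have "(\<Sum>l<k. z l * c l i) = of_int q * coord f i x + ((of_int a - of_int q * x) * deriv (coord f i) x +
          (\<Sum>l<m. z (Suc (Suc l)) * (\<psi> * unitv (Suc (Suc l)) i)))"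
        unfolding k_def m(1) add_Suc_right add_0_right Suc_eq_plus1[symmetric] sum_lessThan_Suc_Suc c0 c1 c2
        using Q'0 K0 by (simp add: z_def)
      also have "\<dots> = v i"
      proof -
        consider "i = 0" | "i = Suc 0" | i' where "i = Suc (Suc i')" by (metis nat.exhaust)
        then show ?thesis
        proof cases
          case 1
          then show ?thesis by (simp add: v_def coord_simps unitv_def)
        next
          case 2
          then show ?thesis by (simp add: v_def coord_simps unitv_def)
        next
          case 3
          then have "i' < m" using \<open>i < k\<close> by (simp add: k_def m(1))
          have "(\<Sum>l<m. z (Suc (Suc l)) * (\<psi> * unitv (Suc (Suc l)) i)) = (\<Sum>l<m. if l = i' then z i * \<psi> else 0)"
            by (rule sum.cong) (auto simp: unitv_def 3)
          also have "\<dots> = z i * \<psi>" using \<open>i' < m\<close> by simp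
          also have "\<dots> = of_int (b (Suc i')) - of_int q * f (Suc i') x - (of_int a - of_int q * x) * deriv (f (Suc i')) x"
            using \<psi> by (simp add: z_def 3 f'_def)
          finally have S: "(\<Sum>l<m. z (Suc (Suc l)) * (\<psi> * unitv (Suc (Suc l)) i)) =
            of_int (b (Suc i')) - of_int q * f (Suc i') x - (of_int a - of_int q * x) * deriv (f (Suc i')) x" .
          show ?thesis unfolding S by (simp add: v_def 3 coord_simps)
        qed
      qed
      finally show ?thesis by simp
    qed
    have "\<exists>i0<k. v i0 \<noteq> 0"
    proof (cases "q = 0")
      case True
      then show ?thesis using nz by (intro exI[of _ 1]) (auto simp: v_def k_def m(1))
    next
      case False
      then show ?thesis by (intro exI[of _ 0]) (auto simp: v_def k_def)
    qed
    then obtain i0 where i0: "i0 < k" "v i0 \<noteq> 0" by blast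
    have vi: "\<forall>i<k. v i \<in> \<int>" by (simp add: v_def)
    have "\<epsilon> \<le> fact k * (\<Sum>l<k. \<bar>z l\<bar>)"
      unfolding k_def by (rule good[of v z i0]) (use vi vz i0 in \<open>auto simp: k_def c_def Q'_def K_def\<close>)
    also have "(\<Sum>l<k. \<bar>z l\<bar>) = \<bar>z 0\<bar> + (\<bar>z 1\<bar> + (\<Sum>l<m. \<bar>z (Suc (Suc l))\<bar>))"
      unfolding k_def m(1) add_Suc_right add_0_right Suc_eq_plus1[symmetric] by (rule sum_lessThan_Suc_Suc)
    also have "\<bar>z 1\<bar> \<le> \<eta>"
      using a K0 by (simp add: z_def abs_mult pos_less_divide_eq less_imp_le)
    also have "(\<Sum>l<m. \<bar>z (Suc (Suc l))\<bar>) \<le> (\<Sum>l<m. \<eta>)"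
    proof (rule sum_mono)
      fix l assume "l \<in> {..<m}"
      then have "Suc l \<in> {1..n-1}" by (auto simp: m(1))
      from b[OF this] show "\<bar>z (Suc (Suc l))\<bar> \<le> \<eta>"
        using \<psi> by (simp add: z_def abs_minus_commute pos_divide_le_eq abs_divide algebra_simps less_imp_le)
    qed
    finally have "\<epsilon> \<le> N * (\<bar>z 0\<bar> + (\<eta> + real m * \<eta>))" by (simp add: N_def)
    \<comment> \<open>By the choice of \<eta> the coordinates other than \<open>z 0\<close> use up
      at most half of \<epsilon>; the rest forces \<open>z 0\<close>, that is \<open>q / Q'\<close>,
      to be large.\<close>
    moreover have "N * (\<eta> + real m * \<eta>) \<le> \<epsilon> / 2"
    proof -
      have "N * (\<eta> + real m * \<eta>) = (N * real n) * \<eta>" by (simp add: m(1) algebra_simps)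
      also have "\<dots> \<le> (N * (real n + 1)) * \<eta>" using N1 \<eta>0 by (intro mult_right_mono mult_left_mono) auto
      also have "\<dots> = \<epsilon> / 2" unfolding \<eta>N using D0 by (simp add: field_simps)
      finally show ?thesis .
    qed
    ultimately have "\<epsilon> / 2 \<le> N * \<bar>z 0\<bar>" by (simp add: distrib_left)
    then have "\<epsilon> / (2 * N) \<le> \<bar>z 0\<bar>" using N1 by (simp add: pos_divide_le_eq algebra_simps)
    moreover have "\<eta> \<le> \<epsilon> / (2 * N)"
    proof -
      have "2 * N * 1 \<le> 2 * N * (real n + 1)" using N1 by (intro mult_left_mono) auto
      then show ?thesis unfolding \<eta>N using \<epsilon> D0 N1 by (intro divide_left_mono mult_pos_pos) auto
    qed
    ultimately have "\<eta> \<le> \<bar>of_int q\<bar> / Q'" using Q'0 by (simp add: z_def abs_divide)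
    then show ?thesis using Q'0 by (simp add: pos_le_divide_eq)
  qed
  have eqb: "of_int q * (f i x - f' i x * x) + of_int a * f' i x - of_int (b i) =
      of_int q * f i x + f' i x * (of_int a - of_int q * x) - of_int (b i)" for q a :: int and b i
    by (simp add: algebra_simps)
  have "\<exists>q a b. (q, a) \<noteq> (0, 0) \<and> \<bar>real_of_int q\<bar> \<le> Q \<and> \<bar>of_int q * x - of_int a\<bar> < \<eta> / K \<and>
    (\<forall>i\<in>{1..n-1}. \<bar>of_int q * (f i x - f' i x * x) + of_int a * f' i x - of_int (b i)\<bar> < \<eta> * \<psi>)"
  proof (rule dirichlet_in_tube)
    show "\<eta> * \<psi> \<le> 1" using \<eta>0 \<eta>1 \<psi> mult_mono[of \<eta> 1 \<psi> 1] by simp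
    \<comment> \<open>\<open>R\<close> is the elongation of the box in the direction of
      \<open>q\<close> for which the condition of the pigeonhole argument holds with
      equality.\<close>
    have "Q * (\<eta> / K) * (\<eta> * \<psi>) ^ card {1..n-1} = \<eta> ^ n * R"
      unfolding K_def Q'_def m(1) using Q R0 \<psi> by (simp add: power_mult_distrib field_simps)
    also have "\<dots> = 3 * 2 ^ card {1..n-1}" unfolding R using \<eta>0 by simp
    finally show "3 * 2 ^ card {1..n-1} \<le> Q * (\<eta> / K) * (\<eta> * \<psi>) ^ card {1..n-1}" by simp
  qed (use Q K0 \<eta>0 \<psi> in auto)
  then obtain q a b where qa0: "(q, a) \<noteq> (0, 0)" "\<bar>real_of_int q\<bar> \<le> Q" "\<bar>of_int q * x - of_int a\<bar> < \<eta> / K"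
    and b: "\<And>i. i \<in> {1..n-1} \<Longrightarrow> \<bar>of_int q * f i x + f' i x * (of_int a - of_int q * x) - of_int (b i)\<bar> < \<eta> * \<psi>"
    unfolding eqb by blast
  have qa: "(q, a) \<noteq> (0, 0)" "\<bar>real_of_int q\<bar> \<le> Q" "\<bar>of_int a - of_int q * x\<bar> < \<eta> / K"
    using qa0 by (auto simp: abs_minus_commute)
  have "0 < \<bar>real_of_int q\<bar>" using long[OF qa(1,3) b] \<eta>0 Q'0 by (smt (verit) mult_pos_pos)
  then have "q \<noteq> 0" by simp
  then obtain d q' a' b' where d: "q = d * q'" "a = d * a'" "\<And>i. i \<in> {1..n-1} \<Longrightarrow> b i = d * b' i"
    "1 \<le> \<bar>d\<bar>" "0 < q'" "Gcd ({q', a'} \<union> b' ` {1..n-1}) = 1"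
    using primitive_multiple[of q a "{1..n-1}" b] by blast
  have d1: "1 \<le> \<bar>real_of_int d\<bar>" using d(4) by linarith
  have shrink: "\<bar>t\<bar> \<le> \<bar>real_of_int d * t\<bar>" for t
    unfolding abs_mult using mult_right_mono[OF d1, of "\<bar>t\<bar>"] by simp
  have a': "\<bar>of_int a' - of_int q' * x\<bar> < \<eta> / K"
  proof -
    have "real_of_int d * (of_int a' - of_int q' * x) = of_int a - of_int q * x" using d by (simp add: algebra_simps)
    then show ?thesis using shrink[of "of_int a' - of_int q' * x"] qa(3) by simp
  qed
  have b': "\<bar>of_int q' * f i x + f' i x * (of_int a' - of_int q' * x) - of_int (b' i)\<bar> < \<eta> * \<psi>"
    if i: "i \<in> {1..n-1}" for i
  proof -
    have "real_of_int d * (of_int q' * f i x + f' i x * (of_int a' - of_int q' * x) - of_int (b' i)) =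
       of_int q * f i x + f' i x * (of_int a - of_int q * x) - of_int (b i)"
      using d(1,2) d(3)[OF i] by (simp add: algebra_simps)
    then show ?thesis
      using shrink[of "of_int q' * f i x + f' i x * (of_int a' - of_int q' * x) - of_int (b' i)"] b[OF i] by simp
  qed
  have "\<eta> * Q' \<le> of_int q'" using long[OF _ a' b'] d(5) by simp
  moreover have "of_int q' \<le> Q"
  proof -
    have "\<bar>real_of_int q'\<bar> \<le> \<bar>real_of_int d * of_int q'\<bar>" by (rule shrink)
    also have "\<dots> = \<bar>real_of_int q\<bar>" using d(1) by simp
    finally show ?thesis using qa(2) by simp
  qed
  ultimately show ?thesis using d(5,6) a' b' unfolding Q'_def[symmetric] K_def[symmetric] by blast
qed

section \<open>Elementary estimates for the final argument\<close>

lemma interval_measurable_between: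
  fixes B :: "real set"
  assumes "is_interval B" "bounded B" "measure lborel B \<noteq> 0"
  shows "\<exists>a b. a < b \<and> {a<..<b} \<subseteq> B \<and> B \<subseteq> {a..b}"
proof -
  have ne: "B \<noteq> {}" using assms(3) by auto
  define a b where "a = Inf B" and "b = Sup B"
  have bd: "bdd_above B" "bdd_below B" using assms(2) by (auto intro: bounded_imp_bdd_above bounded_imp_bdd_below)
  have sub: "B \<subseteq> {a..b}" using bd by (auto simp: a_def b_def intro: cInf_lower cSup_upper)
  have "{a<..<b} \<subseteq> B"
  proof
    fix t assume "t \<in> {a<..<b}"
    then obtain u v where "u \<in> B" "u < t" "v \<in> B" "t < v"
      using cInf_lessD[OF ne, of t] less_cSupD[OF ne, of t] by (auto simp: a_def b_def)
    then show "t \<in> B" using assms(1) mem_is_interval_1_I[of B u v t] by auto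
  qed
  moreover have "a < b"
  proof (rule ccontr)
    assume "\<not> a < b"
    then have "B \<subseteq> {a}" using sub by auto
    then have "B = {} \<or> B = {a}" by blast
    then show False using assms(3) by auto
  qed
  ultimately show ?thesis using sub by blast
qed

text \<open>The power of \<open>Q\<close> is made for this: raised to the exponent
  \<open>2 * n - 1\<close> it becomes \<open>1 / Q ^ 3\<close>, and \<open>C \<le> C ^ N\<close> as
  \<open>C\<close> is at least 1.\<close>

lemma power_bound_of_powr:
  fixes Q \<psi> C :: real
  assumes "1 \<le> n" "1 \<le> C" "1 \<le> Q" "C * Q powr (- 3 / (2 * real n - 1)) < \<psi>"
  shows "C \<le> \<psi> ^ (2 * n - 1) * Q ^ 3"
proof -
  define N where "N = 2 * n - 1"
  have N: "real N = 2 * real n - 1" "1 \<le> N" using assms(1) by (auto simp: N_def of_nat_diff)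
  define P where "P = Q powr (- 3 / (2 * real n - 1))"
  have P0: "0 < P" using assms(3) by (simp add: P_def)
  have "P ^ N = Q powr (real N * (- 3 / (2 * real n - 1)))"
    unfolding P_def by (rule powr_power) (use assms(3) in auto)
  also have "real N * (- 3 / (2 * real n - 1)) = - 3" using N by (simp add: field_simps)
  also have "Q powr - 3 = inverse (Q ^ 3)" using assms(3) by (simp add: powr_minus powr_numeral)
  finally have PN: "P ^ N * Q ^ 3 = 1" using assms(3) by simp
  have "C \<le> C ^ N" using self_le_power[OF assms(2), of N] N(2) by simp
  also have "\<dots> = (C * P) ^ N * Q ^ 3" using PN by (simp add: power_mult_distrib mult.assoc)
  also have "\<dots> \<le> \<psi> ^ N * Q ^ 3"
    using assms P0 by (intro mult_right_mono power_mono) (auto simp: P_def)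
  finally show ?thesis by (simp add: N_def)
qed

text \<open>The mean value inequality twice, hence \<open>M\<close> in place of
  \<open>M / 2\<close>.\<close>

lemma taylor_remainder_bound:
  fixes g :: "real \<Rightarrow> real"
  assumes "convex S" "x \<in> S" "t \<in> S"
    and "\<And>u. u \<in> S \<Longrightarrow> (g has_real_derivative g1 u) (at u)" "\<And>u. u \<in> S \<Longrightarrow> (g1 has_real_derivative g2 u) (at u)"
    and "\<And>u. u \<in> S \<Longrightarrow> \<bar>g2 u\<bar> \<le> M"
  shows "\<bar>g t - g x - g1 x * (t - x)\<bar> \<le> M * (t - x)\<^sup>2"
proof -
  define D where "D = closed_segment x t"
  have DS: "D \<subseteq> S" unfolding D_def using assms(1-3) by (rule closed_segment_subset[rotated 2])
  have M0: "0 \<le> M" using assms(2,6) abs_ge_zero order_trans by blast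
  have b1: "\<bar>g1 u - g1 x\<bar> \<le> M * \<bar>t - x\<bar>" if u: "u \<in> D" for u
  proof -
    have "norm (g1 u - g1 x) \<le> M * norm (u - x)"
      by (rule field_differentiable_bound[OF assms(1), of g1 g2])
         (use assms DS u in \<open>auto intro: has_field_derivative_at_within\<close>)
    also have "\<dots> \<le> M * \<bar>t - x\<bar>"
      using u M0 unfolding D_def by (intro mult_left_mono) (auto simp: closed_segment_eq_real_ivl split: if_splits)
    finally show ?thesis by simp
  qed
  have "norm ((g t - g1 x * t) - (g x - g1 x * x)) \<le> (M * \<bar>t - x\<bar>) * norm (t - x)"
  proof (rule field_differentiable_bound[of D "\<lambda>u. g u - g1 x * u" "\<lambda>u. g1 u - g1 x"])
    show "((\<lambda>u. g u - g1 x * u) has_field_derivative g1 u - g1 x) (at u within D)" if "u \<in> D" for u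
      using DS that by (auto intro!: derivative_eq_intros has_field_derivative_at_within[OF assms(4)])
  qed (use b1 in \<open>auto simp: D_def\<close>)
  then show ?thesis by (simp add: algebra_simps power2_eq_square abs_mult[symmetric])
qed

text \<open>Needed for counting, since an infinite set would have \<open>card\<close> equal to
  0.\<close>

lemma finite_rat_points:
  assumes "0 \<le> \<delta>" "0 < Q" "\<And>t. t \<in> S \<Longrightarrow> \<bar>t\<bar> \<le> L" "\<And>i t. i \<in> {1..n-1} \<Longrightarrow> t \<in> S \<Longrightarrow> \<bar>f i t\<bar> \<le> F" "2 \<le> n"
  shows "finite (rat_points n f \<delta> Q \<psi> S)"
proof -
  define A where "A = \<lceil>Q * \<bar>L\<bar>\<rceil>"
  define D where "D = \<lceil>\<bar>\<psi>\<bar> + Q * \<bar>F\<bar>\<rceil>"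
  have "rat_points n f \<delta> Q \<psi> S \<subseteq> {..nat \<lfloor>Q\<rfloor>} \<times> ({-A..A} \<times> ({1..n-1} \<rightarrow>\<^sub>E {-D..D}))"
  proof
    fix z assume "z \<in> rat_points n f \<delta> Q \<psi> S"
    then obtain q a b where z: "z = (q, a, b)" and b: "b \<in> {1..n-1} \<rightarrow>\<^sub>E (UNIV :: int set)"
      and aq: "real_of_int a / real q \<in> S" and q: "\<delta> * Q < real q" "real q \<le> Q"
      and mx: "(MAX i\<in>{1..n-1}. \<bar>real q * f i (real_of_int a / real q) - real_of_int (b i)\<bar>) \<le> \<psi>"
      by (auto simp: rat_points_def)
    have "0 \<le> \<delta> * Q" using assms by simp
    then have q0: "0 < real q" using q by linarith
    have "\<bar>real_of_int a\<bar> = real q * \<bar>real_of_int a / real q\<bar>" using q0 by (simp add: abs_divide)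
    also have "\<dots> \<le> Q * \<bar>L\<bar>" using q assms(3)[OF aq] assms(2) by (intro mult_mono) auto
    also have "\<dots> \<le> real_of_int A" unfolding A_def by (rule le_of_int_ceiling)
    finally have a: "a \<in> {-A..A}" by auto
    have "b i \<in> {-D..D}" if i: "i \<in> {1..n-1}" for i
    proof -
      have "\<bar>real q * f i (real_of_int a / real q) - real_of_int (b i)\<bar> \<le> \<psi>"
        by (rule order_trans[OF Max_ge mx]) (use i in auto)
      moreover have "\<bar>real q * f i (real_of_int a / real q)\<bar> \<le> Q * \<bar>F\<bar>"
        unfolding abs_mult using q assms(4)[OF i aq] assms(2) by (intro mult_mono) auto
      ultimately have "\<bar>real_of_int (b i)\<bar> \<le> \<bar>\<psi>\<bar> + Q * \<bar>F\<bar>" by linarith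
      also have "\<dots> \<le> real_of_int D" unfolding D_def by (rule le_of_int_ceiling)
      finally show ?thesis by auto
    qed
    then have "b \<in> {1..n-1} \<rightarrow>\<^sub>E {-D..D}" using b by (auto simp: PiE_iff)
    moreover have "q \<in> {..nat \<lfloor>Q\<rfloor>}" using q by (auto simp: le_nat_iff le_floor_iff)
    ultimately show "z \<in> {..nat \<lfloor>Q\<rfloor>} \<times> ({-A..A} \<times> ({1..n-1} \<rightarrow>\<^sub>E {-D..D}))" using a by (simp add: z)
  qed
  then show ?thesis
    by (rule finite_subset) (intro finite_cartesian_product finite_PiE finite_atMost finite_atLeastAtMost finite_atLeastAtMost_int)
qed

text \<open>The union bound through which the measure estimate (a) yields the count (b).\<close>

lemma measure_rat_nbhd_le:
  assumes "finite (rat_points n f \<delta> Q \<psi> S)" "0 \<le> \<rho>" "S \<in> sets lborel"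
  shows "measure lborel (rat_nbhd n f \<delta> Q \<psi> S \<rho> \<inter> S) \<le> real (card (rat_points n f \<delta> Q \<psi> S)) * (2 * \<rho>)"
proof -
  define P where "P = rat_points n f \<delta> Q \<psi> S"
  define I where "I z = (case z of (q, a, b) \<Rightarrow> {real_of_int a / real q - \<rho> <..< real_of_int a / real q + \<rho>})"
    for z :: "nat \<times> int \<times> (nat \<Rightarrow> int)"
  have N: "rat_nbhd n f \<delta> Q \<psi> S \<rho> = (\<Union>z\<in>P. I z)" by (simp add: rat_nbhd_def P_def I_def)
  have Is: "I z \<in> fmeasurable lborel" "measure lborel (I z) = 2 * \<rho>" for z
    using assms(2) by (auto simp: I_def split: prod.split intro!: fmeasurableI)
  have Ib: "I z \<in> sets lborel" for z using Is(1) by (rule fmeasurableD)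
  have "measure lborel ((\<Union>z\<in>P. I z) \<inter> S) \<le> measure lborel (\<Union>z\<in>P. I z)"
    by (rule measure_mono_fmeasurable)
       (use assms Is(1) Ib in \<open>auto simp: P_def intro!: fmeasurable.finite_UN sets.Int sets.finite_UN simp del: sets_lborel\<close>)
  also have "\<dots> \<le> (\<Sum>z\<in>P. measure lborel (I z))"
    by (rule measure_UNION_le) (use assms Ib in \<open>auto simp: P_def\<close>)
  also have "\<dots> = real (card P) * (2 * \<rho>)" by (simp add: Is)
  finally show ?thesis by (simp add: N P_def)
qed

text \<open>The admissible error \<psi> is shared equally: the bound
  \<open>\<eta> \<le> 1 / 2\<close> pays for the tangent line, the hypothesis \<open>big\<close> for
  the quadratic remainder. \<open>S\<close> contains the whole neighbourhood, so Taylor's formula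
  applies up to \<open>a / q\<close> and \<open>a / q\<close> belongs to \<open>S\<close>.\<close>

lemma good_point_in_rat_nbhd:
  fixes f :: "nat \<Rightarrow> real \<Rightarrow> real"
  assumes n: "2 \<le> n" and \<epsilon>: "0 < \<epsilon>" "\<epsilon> \<le> 1" and \<eta>: "\<eta> = \<epsilon> / (2 * fact (n + 1) * (real n + 1))"
    and R: "R = 3 * 2 ^ (n - 1) / \<eta> ^ n" and Q: "0 < Q" and \<psi>: "0 < \<psi>" "\<psi> \<le> 1"
    and good: "short_vector_free (n + 1) \<epsilon> (frame (coord f) (\<lambda>i. deriv (coord f i))
      (Q / R) (Q / R * \<psi> ^ (n - 1)) (inverse \<psi>) x)"
    and \<rho>: "\<rho> = R\<^sup>2 * inverse (\<psi> ^ (n - 1) * Q\<^sup>2)"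
    and S: "{x - \<rho> <..< x + \<rho>} \<subseteq> S"
    and d1: "\<And>i u. i \<in> {1..n-1} \<Longrightarrow> u \<in> S \<Longrightarrow> (f i has_real_derivative deriv (f i) u) (at u)"
    and d2: "\<And>i u. i \<in> {1..n-1} \<Longrightarrow> u \<in> S \<Longrightarrow> (deriv (f i) has_real_derivative deriv (deriv (f i)) u) (at u)"
    and M: "\<And>i u. i \<in> {1..n-1} \<Longrightarrow> u \<in> S \<Longrightarrow> \<bar>deriv (deriv (f i)) u\<bar> \<le> M" and M0: "0 \<le> M"
    and big: "2 * M * R ^ 4 \<le> \<psi> ^ (2 * n - 1) * Q ^ 3"
  shows "x \<in> rat_nbhd n f (\<eta> / (2 * R)) Q \<psi> S \<rho>"
proof -
  define N where "N = (fact (n + 1) :: real)"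
  have N1: "1 \<le> N" unfolding N_def by (rule fact_ge_1)
  have D1: "2 * 1 * 1 \<le> 2 * N * (real n + 1)" using N1 by (intro mult_mono) auto
  then have \<eta>0: "0 < \<eta>" unfolding \<eta> N_def[symmetric] using \<epsilon> by (intro divide_pos_pos) auto
  have "\<epsilon> / (2 * N * (real n + 1)) \<le> \<epsilon> / 2" using D1 \<epsilon> by (intro divide_left_mono) auto
  then have \<eta>2: "\<eta> \<le> 1 / 2" unfolding \<eta> N_def[symmetric] using \<epsilon> by linarith
  have R0: "0 < R" using \<eta>0 by (simp add: R)
  define K where "K = Q / R * \<psi> ^ (n - 1)"
  have K0: "0 < K" using Q R0 \<psi> by (simp add: K_def)
  have \<rho>0: "0 < \<rho>" using R0 Q \<psi> by (simp add: \<rho>)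
  have "\<exists>q a b. 0 < q \<and> \<eta> * (Q / R) \<le> of_int q \<and> of_int q \<le> Q \<and>
    \<bar>of_int a - of_int q * x\<bar> < \<eta> / (Q / R * \<psi> ^ (n - 1)) \<and>
    (\<forall>i\<in>{1..n-1}. \<bar>of_int q * f i x + deriv (f i) x * (of_int a - of_int q * x) - of_int (b i)\<bar> < \<eta> * \<psi>) \<and>
    Gcd ({q, a} \<union> b ` {1..n-1}) = (1 :: int)"
    by (rule rational_point_of_good_point[OF n \<epsilon> \<eta> R Q \<psi> good])
  then obtain q a b where q: "0 < q" "\<eta> * (Q / R) \<le> of_int q" "of_int q \<le> Q"
    and a: "\<bar>of_int a - of_int q * x\<bar> < \<eta> / K"
    and b: "\<And>i. i \<in> {1..n-1} \<Longrightarrow>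
      \<bar>of_int q * f i x + deriv (f i) x * (of_int a - of_int q * x) - of_int (b i)\<bar> < \<eta> * \<psi>"
    and g: "Gcd ({q, a} \<union> b ` {1..n-1}) = (1 :: int)"
    unfolding K_def[symmetric] by blast
  define qn where "qn = nat q"
  have qn: "int qn = q" "real qn = of_int q" using q(1) by (auto simp: qn_def)
  have q0: "0 < real_of_int q" using q(1) by simp
  define t where "t = real_of_int a / real qn"
  have qt: "of_int a - of_int q * x = of_int q * (t - x)" using q0 by (simp add: t_def qn field_simps)
  have tx: "\<bar>t - x\<bar> < \<rho>"
  proof -
    \<comment> \<open>Dividing the error of \<open>a - q * x\<close> by the lower bound for
      \<open>q\<close> gives \<open>R / (K * Q)\<close>, which is \<rho>; \<eta> cancels and
      \<open>\<rho>0 = R\<^sup>2\<close> results.\<close>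
    have "(\<eta> * (Q / R)) * \<bar>t - x\<bar> \<le> of_int q * \<bar>t - x\<bar>" using q(2) by (intro mult_right_mono) auto
    also have "\<dots> < \<eta> / K" using a q0 unfolding qt by (simp add: abs_mult)
    finally have "\<bar>t - x\<bar> < \<eta> / K / (\<eta> * (Q / R))"
      by (subst pos_less_divide_eq) (use \<eta>0 Q R0 in \<open>simp_all only: mult.commute mult_pos_pos divide_pos_pos\<close>)
    also have "\<dots> = \<rho>" using \<eta>0 Q R0 \<psi> by (simp add: \<rho> K_def field_simps power2_eq_square)
    finally show ?thesis .
  qed
  then have tS: "t \<in> {x - \<rho> <..< x + \<rho>}" by auto
  have xS: "x \<in> {x - \<rho> <..< x + \<rho>}" using \<rho>0 by simp
  have err: "Q * (M * \<rho>\<^sup>2) \<le> \<psi> / 2"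
  proof -
    have pw: "\<psi> ^ (2 * n - 1) = \<psi> * (\<psi> ^ (n - 1))\<^sup>2"
    proof -
      have "2 * n - 1 = Suc (2 * (n - 1))" using n by simp
      then show ?thesis by (simp only: power_Suc power_even_eq)
    qed
    have p0: "0 < \<psi> ^ (n - 1)" using \<psi> by simp
    have "Q * (M * \<rho>\<^sup>2) = (2 * M * R ^ 4) / (2 * (\<psi> ^ (n - 1))\<^sup>2 * Q ^ 3)"
      unfolding \<rho> using Q p0 by (simp add: field_simps power2_eq_square power4_eq_xxxx power3_eq_cube)
    also have "\<dots> \<le> (\<psi> ^ (2 * n - 1) * Q ^ 3) / (2 * (\<psi> ^ (n - 1))\<^sup>2 * Q ^ 3)"
      using big by (rule divide_right_mono) (use Q in simp)
    also have "\<dots> = \<psi> / 2" unfolding pw using Q p0 by (simp add: field_simps)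
    finally show ?thesis .
  qed
  have close: "\<bar>of_int q * f i t - of_int (b i)\<bar> \<le> \<psi>" if i: "i \<in> {1..n-1}" for i
  proof -
    have "\<bar>f i t - f i x - deriv (f i) x * (t - x)\<bar> \<le> M * (t - x)\<^sup>2"
      by (rule taylor_remainder_bound[of "{x - \<rho> <..< x + \<rho>}" _ _ _ _ "deriv (deriv (f i))"])
         (use tS xS S d1[OF i] d2[OF i] M[OF i] in \<open>auto simp: subset_iff\<close>)
    also have "\<dots> \<le> M * \<rho>\<^sup>2"
      using tx M0 by (intro mult_left_mono) (auto simp: abs_le_square_iff[symmetric])
    finally have "of_int q * \<bar>f i t - f i x - deriv (f i) x * (t - x)\<bar> \<le> Q * (M * \<rho>\<^sup>2)"
      using q(3) q0 M0 Q by (intro mult_mono) auto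
    then have e: "\<bar>of_int q * (f i t - f i x - deriv (f i) x * (t - x))\<bar> \<le> \<psi> / 2"
      using err q0 by (simp add: abs_mult)
    have "\<eta> * \<psi> \<le> 1 / 2 * \<psi>" using \<eta>2 \<psi> by (intro mult_right_mono) auto
    then have "\<bar>of_int q * f i x + deriv (f i) x * (of_int q * (t - x)) - of_int (b i)\<bar> \<le> \<psi> / 2"
      using b[OF i] unfolding qt by linarith
    moreover have "of_int q * f i t - of_int (b i) = (of_int q * f i x + deriv (f i) x * (of_int q * (t - x)) - of_int (b i)) +
        of_int q * (f i t - f i x - deriv (f i) x * (t - x))" by (simp add: algebra_simps)
    ultimately show ?thesis using e by linarith
  qed
  define b' where "b' = restrict b {1..n-1}"
  have "(qn, a, b') \<in> rat_points n f (\<eta> / (2 * R)) Q \<psi> S"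
    unfolding rat_points_def mem_Collect_eq case_prod_conv
  proof (intro conjI)
    show "b' \<in> {1..n-1} \<rightarrow>\<^sub>E (UNIV :: int set)" by (auto simp: b'_def)
    show "real_of_int a / real qn \<in> S" using tS S by (auto simp: t_def)
    \<comment> \<open>The factor 2 in the denominator turns the lower bound for \<open>q\<close>
      into a strict inequality.\<close>
    have "\<eta> / (2 * R) * Q < \<eta> * (Q / R)" using \<eta>0 R0 Q by (simp add: field_simps)
    then show "\<eta> / (2 * R) * Q < real qn" using q(2) qn by linarith
    show "real qn \<le> Q" using q(3) qn by simp
    show "(MAX i\<in>{1..n-1}. \<bar>real qn * f i (real_of_int a / real qn) - real_of_int (b' i)\<bar>) \<le> \<psi>"
    proof (rule Max.boundedI)
      fix y assume "y \<in> (\<lambda>i. \<bar>real qn * f i (real_of_int a / real qn) - real_of_int (b' i)\<bar>) ` {1..n-1}"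
      then obtain i where i: "i \<in> {1..n-1}" "y = \<bar>real qn * f i (real_of_int a / real qn) - real_of_int (b' i)\<bar>" by blast
      then show "y \<le> \<psi>" using close[OF i(1)] by (simp add: b'_def t_def qn)
    qed (use n in auto)
    have "b' ` {1..n-1} = b ` {1..n-1}" by (rule image_cong) (auto simp: b'_def)
    then show "Gcd ({int qn, a} \<union> b' ` {1..n-1}) = 1" using g qn(1) by simp
  qed
  moreover have "x \<in> {real_of_int a / real qn - \<rho> <..< real_of_int a / real qn + \<rho>}"
    using tx by (auto simp: t_def)
  ultimately show ?thesis unfolding rat_nbhd_def by blast
qed

theorem theorem7p1:
  fixes n :: nat and U B0 :: "real set" and f :: "nat \<Rightarrow> real \<Rightarrow> real"
  assumes "n \<ge> 2"
    and "open U" and "is_interval U"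
    and "\<forall>i\<in>{1..n-1}. real_analytic_on (f i) U"
    and "\<forall>x\<in>U. wronskian n (coord f) x \<noteq> 0"
    and "compact B0" and "is_interval B0" and "B0 \<subseteq> U"
  shows
    "(\<exists>k0>0. \<exists>\<rho>0>0. \<exists>\<delta>0>0. \<forall>B. is_interval B \<and> B \<subseteq> B0 \<longrightarrow>
       (\<exists>C0>0. \<exists>Q0>0. \<forall>Q \<psi> :: real. Q \<ge> Q0 \<longrightarrow>
          C0 * Q powr (- 3 / (2 * real n - 1)) < \<psi> \<longrightarrow> \<psi> < inverse C0 \<longrightarrow>
          measure lborel (rat_nbhd n f \<delta>0 Q \<psi> B (\<rho>0 * inverse (\<psi> ^ (n - 1) * Q\<^sup>2)) \<inter> B)
            \<ge> k0 * measure lborel B))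
     \<and>
     (\<exists>\<delta>0>0. \<exists>k1>0. \<forall>B. is_interval B \<and> B \<subseteq> B0 \<longrightarrow>
       (\<exists>Q0>0. \<exists>C0>0. \<forall>Q \<psi> :: real. Q \<ge> Q0 \<longrightarrow>
          C0 * Q powr (- 3 / (2 * real n - 1)) < \<psi> \<longrightarrow> \<psi> < inverse C0 \<longrightarrow>
          real (card (rat_points n f \<delta>0 Q \<psi> B))
            \<ge> k1 * \<psi> ^ (n - 1) * Q\<^sup>2 * measure lborel B))"
proof -
  note n = assms(1)
  have anf: "real_analytic_on (f i) U" if "i \<in> {1..n-1}" for i using assms(4) that by blast
  have any: "real_analytic_on (coord f i) U" if "i < n + 1" for i
  proof -
    consider "i = 0" | "i = Suc 0" | i' where "i = Suc (Suc i')" by (metis nat.exhaust)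
    then show ?thesis
    proof cases
      case 3
      then show ?thesis using anf[of "Suc i'"] that by (simp add: coord_simps)
    qed (simp_all add: coord_simps real_analytic_on_const real_analytic_on_ident)
  qed
  obtain \<epsilon> \<tau> where \<epsilon>: "0 < \<epsilon>" "\<epsilon> \<le> 1" and \<tau>: "0 < \<tau>"
    and "\<forall>a b. a < b \<longrightarrow> {a..b} \<subseteq> B0 \<longrightarrow> b - a < \<tau> \<longrightarrow>
    (\<exists>w>0. \<forall>Q K T. 0 < K \<longrightarrow> Q = K * T ^ (n - 1) \<longrightarrow> 1 \<le> T \<longrightarrow> 1 \<le> w * T \<longrightarrow> 1 \<le> w * Q \<longrightarrow>
      (\<exists>M\<in>sets lborel. M \<subseteq> {a..b} \<and> (b - a) / 20 ^ n \<le> measure lborel M \<and>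
        (\<forall>x\<in>M. short_vector_free (n + 1) \<epsilon> (frame (coord f) (\<lambda>i. deriv (coord f i)) Q K T x))))"
  proof -
    have "coord f 0 = (\<lambda>_. 1)" "coord f 1 = (\<lambda>x. x)" by (simp_all add: coord_simps)
    from no_short_vectors_on_large_set[OF n assms(2) any this assms(5)[rule_format] assms(6,8)]
    show ?thesis by - (drule meta_mp, assumption, drule meta_mp, assumption, elim exE conjE, rule that)
  qed
  note main = this(4)[THEN spec, THEN spec, THEN mp, THEN mp, THEN mp]
  define \<eta> where "\<eta> = \<epsilon> / (2 * fact (n + 1) * (real n + 1))"
  define R where "R = 3 * 2 ^ (n - 1) / \<eta> ^ n"
  define \<delta>0 where "\<delta>0 = \<eta> / (2 * R)"
  have \<eta>0: "0 < \<eta>" unfolding \<eta>_def using \<epsilon> by (intro divide_pos_pos mult_pos_pos) auto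
  have R0: "0 < R" using \<eta>0 by (simp add: R_def)
  have \<delta>0: "0 < \<delta>0" using \<eta>0 R0 by (simp add: \<delta>0_def)
  have bB0: "bounded B0" using assms(6) by (rule compact_imp_bounded)
  then obtain L where L: "\<And>t. t \<in> B0 \<Longrightarrow> \<bar>t\<bar> \<le> L" unfolding bounded_iff by auto
  have cont_bd: "\<exists>F. \<forall>i\<in>{1..n-1}. \<forall>u\<in>B0. \<bar>g i u\<bar> \<le> F" if g: "\<And>i. i \<in> {1..n-1} \<Longrightarrow> real_analytic_on (g i) U" for g
  proof -
    have "\<exists>F. \<forall>u\<in>B0. \<bar>g i u\<bar> \<le> F" if "i \<in> {1..n-1}" for i
    proof -
      have "compact (g i ` B0)"
        by (intro compact_continuous_image real_analytic_on_continuous[OF g[OF that] assms(8)] assms(6))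
      then have "bounded (g i ` B0)" by (rule compact_imp_bounded)
      then show ?thesis unfolding bounded_iff by auto
    qed
    then have "\<forall>i\<in>{1..n-1}. \<exists>F. \<forall>u\<in>B0. \<bar>g i u\<bar> \<le> F" by blast
    from bchoice[OF this] obtain F where F: "\<forall>i\<in>{1..n-1}. \<forall>u\<in>B0. \<bar>g i u\<bar> \<le> F i" ..
    have "\<bar>g i u\<bar> \<le> (\<Sum>i\<in>{1..n-1}. \<bar>F i\<bar>)" if "i \<in> {1..n-1}" "u \<in> B0" for i u
    proof -
      have "\<bar>g i u\<bar> \<le> \<bar>F i\<bar>" using F that by (meson abs_ge_self order_trans)
      also have "\<dots> \<le> (\<Sum>i\<in>{1..n-1}. \<bar>F i\<bar>)" by (rule member_le_sum) (use that in auto)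
      finally show ?thesis .
    qed
    then show ?thesis by blast
  qed
  obtain F0 where F0: "\<And>i u. i \<in> {1..n-1} \<Longrightarrow> u \<in> B0 \<Longrightarrow> \<bar>f i u\<bar> \<le> F0"
    using cont_bd[of f, OF anf] by blast
  obtain M2' where M2': "\<And>i u. i \<in> {1..n-1} \<Longrightarrow> u \<in> B0 \<Longrightarrow> \<bar>deriv (deriv (f i)) u\<bar> \<le> M2'"
    using cont_bd[of "\<lambda>i. deriv (deriv (f i))", OF real_analytic_on_deriv[OF real_analytic_on_deriv[OF anf]]] by blast
  define M2 where "M2 = \<bar>M2'\<bar>"
  have M2: "\<bar>deriv (deriv (f i)) u\<bar> \<le> M2" if "i \<in> {1..n-1}" "u \<in> B0" for i u
    using M2'[OF that] by (simp add: M2_def)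
  have M20: "0 \<le> M2" by (simp add: M2_def)
  have B0U: "u \<in> U" if "u \<in> B0" for u using assms(8) that by blast
  have d1: "(f i has_real_derivative deriv (f i) u) (at u)" if "i \<in> {1..n-1}" "u \<in> B0" for i u
    by (rule real_analytic_on_has_deriv[OF anf[OF that(1)] B0U[OF that(2)]])
  have d2: "(deriv (f i) has_real_derivative deriv (deriv (f i)) u) (at u)" if "i \<in> {1..n-1}" "u \<in> B0" for i u
    by (rule real_analytic_on_has_deriv[OF real_analytic_on_deriv[OF anf[OF that(1)]] B0U[OF that(2)]])
  \<comment> \<open>The minimum bounds from below the share of \<open>B\<close> taken by the
    subinterval \<open>{a1..b1}\<close> chosen later: one half if \<open>B\<close> is short,
    otherwise \<open>\<tau> / 2\<close> out of a length of at most \<open>2 * \<bar>L\<bar>\<close>.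
    The 1 keeps the denominator positive.\<close>
  define k0 where "k0 = min (1 / 2) (\<tau> / (2 * (2 * \<bar>L\<bar> + 1))) / 20 ^ n"
  have k0: "0 < k0" using \<tau> by (auto simp: k0_def intro!: divide_pos_pos)
  have R2: "0 < R\<^sup>2" using R0 by simp
  have core: "\<exists>C0\<ge>1. \<exists>Q0\<ge>1. \<forall>Q \<psi>. Q \<ge> Q0 \<longrightarrow> C0 * Q powr (- 3 / (2 * real n - 1)) < \<psi> \<longrightarrow> \<psi> < inverse C0 \<longrightarrow>
          measure lborel (rat_nbhd n f \<delta>0 Q \<psi> B (R\<^sup>2 * inverse (\<psi> ^ (n - 1) * Q\<^sup>2)) \<inter> B) \<ge> k0 * measure lborel B"
    if B: "is_interval B" "B \<subseteq> B0" for B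
  proof (cases "measure lborel B = 0")
    case True
    then show ?thesis by (intro exI[of _ 1]) auto
  next
    case False
    obtain a b where ab: "a < b" "{a<..<b} \<subseteq> B" "B \<subseteq> {a..b}"
      using interval_measurable_between[OF B(1) bounded_subset[OF bB0 B(2)] False] by blast
    have Bs: "B \<in> sets lborel" using real_interval_borel_measurable[OF B(1)] by simp
    have fB: "B \<in> fmeasurable lborel" by (rule fmeasurableI2[OF fmeasurable_compact[OF compact_Icc] ab(3) Bs])
    have mB: "measure lborel B \<le> b - a"
      using measure_mono_fmeasurable[OF ab(3) Bs fmeasurable_compact[OF compact_Icc]] ab(1) by simp
    have abL: "b - a \<le> 2 * \<bar>L\<bar>"
    proof (rule field_le_epsilon)
      fix e :: real assume e: "0 < e"
      define e' where "e' = min e (b - a) / 4"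
      have e': "0 < e'" "2 * e' \<le> e" "e' < b - a" using e ab(1) by (auto simp: e'_def)
      then have "a + e' \<in> B" "b - e' \<in> B" using ab(2) by auto
      then have "\<bar>a + e'\<bar> \<le> L" "\<bar>b - e'\<bar> \<le> L" using L B(2) by blast+
      then show "b - a \<le> 2 * \<bar>L\<bar> + e" using e'(2) by linarith
    qed
    define g where "g = (b - a) / 4"
    have g: "0 < g" "b = a + 4 * g" using ab(1) by (simp_all add: g_def field_simps)
    \<comment> \<open>The middle half of \<open>B\<close>, cut down to length less than \<tau>. A
      margin of length \<open>g\<close> stays on either side, so neighbourhoods of radius \<rho>
      remain in \<open>B\<close> once \<open>\<rho> \<le> g\<close>.\<close>
    define h where "h = min g (\<tau> / 4)"
    define a1 b1 where "a1 = a + 2 * g - h" and "b1 = a + 2 * g + h"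
    have h: "0 < h" "h \<le> g" "h \<le> \<tau> / 4"
    proof -
      show "0 < h" unfolding h_def using g(1) \<tau> by simp
      show "h \<le> g" unfolding h_def by (rule min.cobounded1)
      show "h \<le> \<tau> / 4" unfolding h_def by (rule min.cobounded2)
    qed
    have ab1: "a1 < b1" "b1 - a1 < \<tau>" "{a1..b1} \<subseteq> B" and gap: "a + g \<le> a1" "b1 \<le> a + 3 * g"
    proof -
      show "a1 < b1" "b1 - a1 < \<tau>" using h \<tau> unfolding a1_def b1_def by linarith+
      show gap: "a + g \<le> a1" "b1 \<le> a + 3 * g" using h(2) unfolding a1_def b1_def by linarith+
      have "{a1..b1} \<subseteq> {a<..<b}"
      proof
        fix t assume "t \<in> {a1..b1}"
        then have "a1 \<le> t" "t \<le> b1" by auto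
        then have "a < t" "t < b" using gap g by linarith+
        then show "t \<in> {a<..<b}" by simp
      qed
      then show "{a1..b1} \<subseteq> B" using ab(2) by blast
    qed
    have k0h: "k0 * (b - a) \<le> (b1 - a1) / 20 ^ n"
    proof -
      define \<mu> where "\<mu> = min (1 / 2) (\<tau> / (2 * (2 * \<bar>L\<bar> + 1)))"
      have "\<mu> \<le> 1 / 2" unfolding \<mu>_def by (rule min.cobounded1)
      then have "\<mu> * (b - a) \<le> 1 / 2 * (b - a)" using ab(1) by (intro mult_right_mono) auto
      also have "\<dots> = 2 * g" by (simp add: g_def)
      finally have \<mu>1: "\<mu> * (b - a) \<le> 2 * g" .
      have "\<mu> \<le> \<tau> / (2 * (2 * \<bar>L\<bar> + 1))" unfolding \<mu>_def by (rule min.cobounded2)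
      then have "\<mu> * (b - a) \<le> \<tau> / (2 * (2 * \<bar>L\<bar> + 1)) * (2 * \<bar>L\<bar> + 1)"
        using abL ab(1) \<tau> by (intro mult_mono) auto
      also have "\<dots> = \<tau> / 2"
      proof -
        have "2 * \<bar>L\<bar> + 1 \<noteq> 0" by linarith
        then show ?thesis by (simp del: distrib_left_numeral)
      qed
      finally have \<mu>2: "\<mu> * (b - a) \<le> \<tau> / 2" .
      have "\<mu> * (b - a) \<le> 2 * h"
      proof (cases "g \<le> \<tau> / 4")
        case True
        then have "h = g" unfolding h_def by (rule min_absorb1)
        then show ?thesis using \<mu>1 by linarith
      next
        case False
        then have "h = \<tau> / 4" unfolding h_def by (intro min_absorb2) linarith
        then show ?thesis using \<mu>2 by linarith
      qed
      then have "\<mu> * (b - a) / 20 ^ n \<le> 2 * h / 20 ^ n" by (rule divide_right_mono) simp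
      then show ?thesis by (simp add: k0_def \<mu>_def a1_def b1_def)
    qed
    have sub0: "{a1..b1} \<subseteq> B0" using ab1(3) B(2) by blast
    obtain w where w: "0 < w" and "\<forall>Q K T. 0 < K \<longrightarrow> Q = K * T ^ (n - 1) \<longrightarrow> 1 \<le> T \<longrightarrow> 1 \<le> w * T \<longrightarrow> 1 \<le> w * Q \<longrightarrow>
      (\<exists>M\<in>sets lborel. M \<subseteq> {a1..b1} \<and> (b1 - a1) / 20 ^ n \<le> measure lborel M \<and>
        (\<forall>x\<in>M. short_vector_free (n + 1) \<epsilon> (frame (coord f) (\<lambda>i. deriv (coord f i)) Q K T x)))"
      using main[OF ab1(1) sub0 ab1(2)] by (elim exE conjE) (rule that)
    note good = this(2)[THEN spec, THEN spec, THEN spec, THEN mp, THEN mp, THEN mp, THEN mp, THEN mp]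
    define e where "e = 4 * R\<^sup>2 / (b - a)"
    have e0: "0 < e" using R0 ab(1) by (simp add: e_def)
    \<comment> \<open>One summand for each demand: 1 gives \<open>\<psi> \<le> 1\<close>, the second
      absorbs the Taylor error, \<open>e\<^sup>2\<close> gives \<open>\<rho> \<le> g\<close>, and
      \<open>1 / w\<close> makes \<open>T = 1 / \<psi>\<close> large. The last demand, on
      \<open>Q / R\<close>, is met by \<open>Q0\<close>.\<close>
    define C0 where "C0 = 1 + 2 * M2 * R ^ 4 + e\<^sup>2 + 1 / w"
    have MR: "0 \<le> 2 * M2 * R ^ 4" using M20 R0 by simp
    have C0: "1 \<le> C0" "2 * M2 * R ^ 4 \<le> C0" "e\<^sup>2 \<le> C0" "1 / w \<le> C0"
      using MR w zero_le_power2[of e] unfolding C0_def by (auto intro: add_nonneg_nonneg)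
    define Q0 where "Q0 = 1 + R / w"
    have Q0: "1 \<le> Q0" using R0 w by (simp add: Q0_def)
    show ?thesis
    proof (rule exI[of _ C0], intro conjI C0(1), rule exI[of _ Q0], intro conjI Q0 allI impI)
      fix Q \<psi> assume QQ: "Q0 \<le> Q" and lo: "C0 * Q powr (- 3 / (2 * real n - 1)) < \<psi>" and hi: "\<psi> < inverse C0"
      have Q1: "1 \<le> Q" using QQ Q0 by linarith
      have "0 \<le> C0 * Q powr (- 3 / (2 * real n - 1))" using C0(1) by simp
      then have \<psi>0: "0 < \<psi>" using lo by linarith
      have "inverse C0 \<le> 1" using C0(1) by (simp add: inverse_le_1_iff)
      then have \<psi>1: "\<psi> \<le> 1" using hi by linarith
      have "inverse C0 \<le> inverse (1 / w)" using C0(4) w by (intro le_imp_inverse_le) auto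
      then have \<psi>w: "\<psi> \<le> w" using hi by simp
      have pb: "C0 \<le> \<psi> ^ (2 * n - 1) * Q ^ 3"
        by (rule power_bound_of_powr[OF _ C0(1) Q1 lo]) (use n in simp)
      define X where "X = \<psi> ^ (n - 1) * Q\<^sup>2"
      have X0: "0 < X" using \<psi>0 Q1 by (simp add: X_def)
      \<comment> \<open>As \<open>\<psi> \<le> 1 \<le> Q\<close>, the quantity
        \<open>\<psi> ^ (2 * n - 1) * Q ^ 3\<close> is at most \<open>X\<^sup>2\<close>; hence the
        same lower bound also makes \<rho> small.\<close>
      have "e \<le> X"
      proof (rule power2_le_imp_le)
        have "e\<^sup>2 \<le> \<psi> ^ (2 * n - 1) * Q ^ 3" using pb C0(3) by linarith
        also have "\<dots> \<le> \<psi> ^ (2 * (n - 1)) * Q ^ 4"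
          using \<psi>0 \<psi>1 Q1 n by (intro mult_mono power_decreasing power_increasing) auto
        also have "\<dots> = X\<^sup>2" by (simp add: X_def power_mult_distrib power_even_eq)
        finally show "e\<^sup>2 \<le> X\<^sup>2" .
      qed (use X0 in simp)
      define \<rho> where "\<rho> = R\<^sup>2 * inverse (\<psi> ^ (n - 1) * Q\<^sup>2)"
      have \<rho>X: "\<rho> = R\<^sup>2 / X" by (simp add: \<rho>_def X_def divide_inverse)
      have "4 * R\<^sup>2 \<le> X * (b - a)" using \<open>e \<le> X\<close> ab(1) by (simp add: e_def pos_divide_le_eq)
      then have \<rho>4: "\<rho> \<le> g" unfolding \<rho>X g_def using X0 by (simp add: pos_divide_le_eq mult.commute)
      have K0: "0 < Q / R * \<psi> ^ (n - 1)" using Q1 R0 \<psi>0 by simp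
      have QK: "Q / R = Q / R * \<psi> ^ (n - 1) * inverse \<psi> ^ (n - 1)" using \<psi>0 by (simp add: power_inverse)
      have T1: "1 \<le> inverse \<psi>" using \<psi>0 \<psi>1 by (simp add: one_le_inverse_iff)
      have wT: "1 \<le> w * inverse \<psi>" using \<psi>w \<psi>0 by (simp add: field_simps)
      have "R / w \<le> Q" using QQ by (simp add: Q0_def)
      then have wQ: "1 \<le> w * (Q / R)" using w R0 by (simp add: field_simps)
      obtain M where M: "M \<in> sets lborel" "M \<subseteq> {a1..b1}" "(b1 - a1) / 20 ^ n \<le> measure lborel M"
        and gM: "\<forall>x\<in>M. short_vector_free (n + 1) \<epsilon> (frame (coord f) (\<lambda>i. deriv (coord f i))
          (Q / R) (Q / R * \<psi> ^ (n - 1)) (inverse \<psi>) x)"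
        using good[OF K0 QK T1 wT wQ] by (elim bexE conjE) (rule that)
      have "M \<subseteq> rat_nbhd n f \<delta>0 Q \<psi> B \<rho> \<inter> B"
      proof
        fix x assume x: "x \<in> M"
        then have x1: "x \<in> {a1..b1}" using M(2) by blast
        have "{x - \<rho> <..< x + \<rho>} \<subseteq> {a<..<b}"
        proof
          fix t assume "t \<in> {x - \<rho> <..< x + \<rho>}"
          moreover have "a1 \<le> x" "x \<le> b1" using x1 by auto
          ultimately have "a < t" "t < b" using gap \<rho>4 g(2) unfolding greaterThanLessThan_iff by linarith+
          then show "t \<in> {a<..<b}" by simp
        qed
        then have SB: "{x - \<rho> <..< x + \<rho>} \<subseteq> B" using ab(2) by blast
        have "x \<in> rat_nbhd n f (\<eta> / (2 * R)) Q \<psi> B \<rho>"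
        proof (rule good_point_in_rat_nbhd[OF n \<epsilon> \<eta>_def R_def _ \<psi>0 \<psi>1 bspec[OF gM x] \<rho>_def SB])
          show "2 * M2 * R ^ 4 \<le> \<psi> ^ (2 * n - 1) * Q ^ 3" using C0(2) pb by linarith
        qed (use Q1 d1 d2 M2 M20 B(2) in auto)
        then show "x \<in> rat_nbhd n f \<delta>0 Q \<psi> B \<rho> \<inter> B" using x1 ab1(3) by (auto simp: \<delta>0_def)
      qed
      moreover have "rat_nbhd n f \<delta>0 Q \<psi> B \<rho> \<inter> B \<in> fmeasurable lborel"
      proof (rule fmeasurableI2[OF fB])
        have "open (rat_nbhd n f \<delta>0 Q \<psi> B \<rho>)" unfolding rat_nbhd_def by (intro open_UN) auto
        then show "rat_nbhd n f \<delta>0 Q \<psi> B \<rho> \<inter> B \<in> sets lborel" using Bs by auto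
      qed auto
      ultimately have "measure lborel M \<le> measure lborel (rat_nbhd n f \<delta>0 Q \<psi> B \<rho> \<inter> B)"
        using M(1) by (intro measure_mono_fmeasurable)
      moreover have "k0 * measure lborel B \<le> k0 * (b - a)" using mB k0 by (intro mult_left_mono) auto
      ultimately show "k0 * measure lborel B \<le>
          measure lborel (rat_nbhd n f \<delta>0 Q \<psi> B (R\<^sup>2 * inverse (\<psi> ^ (n - 1) * Q\<^sup>2)) \<inter> B)"
        using M(3) k0h unfolding \<rho>_def by linarith
    qed
  qed
  show ?thesis
  proof (rule conjI, goal_cases)
    case 1
    show ?case
    proof (rule exI[of _ k0], rule conjI[OF k0], rule exI[of _ "R\<^sup>2"], rule conjI[OF R2],
        rule exI[of _ \<delta>0], rule conjI[OF \<delta>0], intro allI impI)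
      fix B assume "is_interval B \<and> B \<subseteq> B0"
      then obtain C0 Q0 where "1 \<le> C0" "1 \<le> Q0" and c: "\<forall>Q \<psi>. Q \<ge> Q0 \<longrightarrow>
          C0 * Q powr (- 3 / (2 * real n - 1)) < \<psi> \<longrightarrow> \<psi> < inverse C0 \<longrightarrow>
          measure lborel (rat_nbhd n f \<delta>0 Q \<psi> B (R\<^sup>2 * inverse (\<psi> ^ (n - 1) * Q\<^sup>2)) \<inter> B) \<ge> k0 * measure lborel B"
        using core by blast
      then have "0 < C0" "0 < Q0" by linarith+
      then show "\<exists>C0>0. \<exists>Q0>0. \<forall>Q \<psi> :: real. Q \<ge> Q0 \<longrightarrow>
          C0 * Q powr (- 3 / (2 * real n - 1)) < \<psi> \<longrightarrow> \<psi> < inverse C0 \<longrightarrow>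
          measure lborel (rat_nbhd n f \<delta>0 Q \<psi> B (R\<^sup>2 * inverse (\<psi> ^ (n - 1) * Q\<^sup>2)) \<inter> B) \<ge> k0 * measure lborel B"
        using c by blast
    qed
  next
    case 2
    \<comment> \<open>Each rational point covers at most
      \<open>2 * \<rho> = 2 * R\<^sup>2 / (\<psi> ^ (n - 1) * Q\<^sup>2)\<close> of the
      measure.\<close>
    define k1 where "k1 = k0 / (2 * R\<^sup>2)"
    have k1: "0 < k1" using k0 R0 by (simp add: k1_def)
    show ?case
    proof (rule exI[of _ \<delta>0], rule conjI[OF \<delta>0], rule exI[of _ k1], rule conjI[OF k1], intro allI impI)
      fix B assume B: "is_interval B \<and> B \<subseteq> B0"
      then obtain C0 Q0 where CQ: "1 \<le> C0" "1 \<le> Q0" and c: "\<And>Q \<psi>. Q \<ge> Q0 \<Longrightarrow>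
          C0 * Q powr (- 3 / (2 * real n - 1)) < \<psi> \<Longrightarrow> \<psi> < inverse C0 \<Longrightarrow>
          measure lborel (rat_nbhd n f \<delta>0 Q \<psi> B (R\<^sup>2 * inverse (\<psi> ^ (n - 1) * Q\<^sup>2)) \<inter> B) \<ge> k0 * measure lborel B"
        using core[of B] by blast
      have pos: "0 < C0" "0 < Q0" using CQ by linarith+
      show "\<exists>Q0>0. \<exists>C0>0. \<forall>Q \<psi> :: real. Q \<ge> Q0 \<longrightarrow>
          C0 * Q powr (- 3 / (2 * real n - 1)) < \<psi> \<longrightarrow> \<psi> < inverse C0 \<longrightarrow>
          real (card (rat_points n f \<delta>0 Q \<psi> B))
            \<ge> k1 * \<psi> ^ (n - 1) * Q\<^sup>2 * measure lborel B"
      proof (rule exI[of _ Q0], rule conjI[OF pos(2)], rule exI[of _ C0], rule conjI[OF pos(1)], intro allI impI)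
        fix Q \<psi> :: real
        assume QQ: "Q0 \<le> Q" and lo: "C0 * Q powr (- 3 / (2 * real n - 1)) < \<psi>" and hi: "\<psi> < inverse C0"
        have Q0: "0 < Q" using QQ CQ by linarith
        have "0 \<le> C0 * Q powr (- 3 / (2 * real n - 1))" using CQ by simp
        then have \<psi>0: "0 < \<psi>" using lo by linarith
        define Y where "Y = \<psi> ^ (n - 1) * Q\<^sup>2"
        have Y0: "0 < Y" using Q0 \<psi>0 by (simp add: Y_def)
        have fin: "finite (rat_points n f \<delta>0 Q \<psi> B)"
          by (rule finite_rat_points[OF less_imp_le[OF \<delta>0] Q0, of B L n f F0])
             (use B L F0 n in \<open>auto simp: subset_iff\<close>)
        have Bs: "B \<in> sets lborel" using real_interval_borel_measurable B by simp
        have "0 \<le> R\<^sup>2 * inverse Y" using Y0 by simp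
        from order_trans[OF c[OF QQ lo hi, folded Y_def] measure_rat_nbhd_le[OF fin this Bs]]
        have "k0 * measure lborel B \<le> real (card (rat_points n f \<delta>0 Q \<psi> B)) * (2 * (R\<^sup>2 * inverse Y))" .
        then have "k0 * measure lborel B / (2 * R\<^sup>2) * Y \<le> real (card (rat_points n f \<delta>0 Q \<psi> B))"
          using Y0 R0 by (simp add: field_simps)
        then show "k1 * \<psi> ^ (n - 1) * Q\<^sup>2 * measure lborel B \<le> real (card (rat_points n f \<delta>0 Q \<psi> B))"
          by (simp add: k1_def Y_def mult_ac)
      qed
    qed
  qed
qed

end
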